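(* Let $R\subseteq T$ be rings forming a regular conductor square with conductor $C$, and set $A=R/C$, $B=T/C$. Assume that $T$ is flat as an $R$-module, that $C$ is a principal ideal of $T$, and that every non-zero 2-generated ideal $I$ of $R$ satisfies the following condition: there are elements $r,s\in R$ and an ideal $U\subseteq R$ such that $UT=T=rT$ and $rI=sU$, and such that the multiplication maps $I\xrightarrow{r}rI$ and $U\xrightarrow{s}sU$ are isomorphisms. Assume further that $A$ is a (possibly infinite) product $\prod_{\lambda\in\Lambda}A_\lambda$ of integral domains. If $R$ is a generalized GCD ring, then each of the following rings is a generalized GCD ring: $T$, $A$, and $A_\lambda$ for every $\lambda\in\Lambda$. Conversely, if $A$ is a generalized GCD ring, then each of the following rings is a generalized GCD ring: $T$, $R$, and $A_\lambda$ for every $\lambda\in\Lambda$.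
   Context: All rings are commutative with identity. A conductor square consists of a ring $T$, a subring $R\subseteq T$ such that $R$ and $T$ have a common non-zero ideal, the largest common ideal $C$ of $R$ and $T$ (called the conductor of $T$ into $R$), and the rings $A=R/C$ and $B=T/C$, together with the inclusions $R\hookrightarrow T$, $A\hookrightarrow B$ and the projections $\eta_2\colon R\twoheadrightarrow A$, $\eta_1\colon T\twoheadrightarrow B$; equivalently, $R$ is the pullback $\{(a,t)\in A\times T\mid a=\eta_1(t)\text{ in }B\}$ and $C=\operatorname{Ker}(\eta_1)=\operatorname{Ker}(\eta_2)$ is the largest common ideal. The square is regular if $C$ contains a non-zero-divisor of $T$. An ideal is 2-generated if it can be generated by two elements. A ring is a generalized GCD ring if every principal ideal of it is projective and every intersection of two finitely generated flat ideals is finitely generated and flat. *)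

theory Defs
  imports "HOL-Algebra.Algebra"
begin

text \<open>Module homomorphisms and isomorphisms, for modules as in the locale \<open>module\<close>.
  The fields \<open>mult\<close> and \<open>one\<close> of a module record carry no meaning.\<close>

definition module_hom ::
    "('a, 'm) ring_scheme \<Rightarrow> ('a, 'b) module \<Rightarrow> ('a, 'c) module \<Rightarrow> ('b \<Rightarrow> 'c) set" where
  "module_hom R M N =
     {f \<in> carrier M \<rightarrow> carrier N.
        (\<forall>x\<in>carrier M. \<forall>y\<in>carrier M. f (x \<oplus>\<^bsub>M\<^esub> y) = f x \<oplus>\<^bsub>N\<^esub> f y) \<and>
        (\<forall>a\<in>carrier R. \<forall>x\<in>carrier M. f (a \<odot>\<^bsub>M\<^esub> x) = a \<odot>\<^bsub>N\<^esub> f x)}"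

definition module_iso ::
    "('a, 'm) ring_scheme \<Rightarrow> ('a, 'b) module \<Rightarrow> ('a, 'c) module \<Rightarrow> ('b \<Rightarrow> 'c) set" where
  "module_iso R M N = {f \<in> module_hom R M N. bij_betw f (carrier M) (carrier N)}"

text \<open>A subset \<open>S\<close> of a ring \<open>T\<close> with the operations of \<open>T\<close>, scalars acting by multiplication
  in \<open>T\<close>.  This gives an ideal of \<open>T\<close> as a \<open>T\<close>-module, and \<open>T\<close> itself as a module over a
  subring.\<close>

definition ring_module :: "('a, 'm) ring_scheme \<Rightarrow> 'a set \<Rightarrow> ('a, 'a) module" where
  "ring_module T S =
     \<lparr>carrier = S, monoid.mult = monoid.mult T, monoid.one = \<one>\<^bsub>T\<^esub>,
      ring.zero = \<zero>\<^bsub>T\<^esub>, ring.add = ring.add T, smult = monoid.mult T\<rparr>"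

text \<open>The tensor product over \<open>R\<close>, as an abelian group: the free abelian group on pairs modulo
  the subgroup generated by the bilinearity relations.\<close>

definition tensor_relations ::
    "('a, 'm) ring_scheme \<Rightarrow> ('a, 'b) module \<Rightarrow> ('a, 'c) module \<Rightarrow> ('b \<times> 'c \<Rightarrow>\<^sub>0 int) set" where
  "tensor_relations R M N =
     {frag_of (x \<oplus>\<^bsub>M\<^esub> x', y) - frag_of (x, y) - frag_of (x', y) | x x' y.
        x \<in> carrier M \<and> x' \<in> carrier M \<and> y \<in> carrier N} \<union>
     {frag_of (x, y \<oplus>\<^bsub>N\<^esub> y') - frag_of (x, y) - frag_of (x, y') | x y y'.
        x \<in> carrier M \<and> y \<in> carrier N \<and> y' \<in> carrier N} \<union>
     {frag_of (a \<odot>\<^bsub>M\<^esub> x, y) - frag_of (x, a \<odot>\<^bsub>N\<^esub> y) | a x y.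
        a \<in> carrier R \<and> x \<in> carrier M \<and> y \<in> carrier N}"

definition tensor_kernel ::
    "('a, 'm) ring_scheme \<Rightarrow> ('a, 'b) module \<Rightarrow> ('a, 'c) module \<Rightarrow> ('b \<times> 'c \<Rightarrow>\<^sub>0 int) set" where
  "tensor_kernel R M N =
     generate (free_Abelian_group (carrier M \<times> carrier N)) (tensor_relations R M N)"

definition tensor_product ::
    "('a, 'm) ring_scheme \<Rightarrow> ('a, 'b) module \<Rightarrow> ('a, 'c) module \<Rightarrow> ('b \<times> 'c \<Rightarrow>\<^sub>0 int) set monoid" where
  "tensor_product R M N =
     free_Abelian_group (carrier M \<times> carrier N) Mod tensor_kernel R M N"

text \<open>For linear maps \<open>f : M \<rightarrow> M'\<close> and \<open>g : N \<rightarrow> N'\<close>, the map \<open>f \<otimes> g\<close> into the tensor product of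
  \<open>M'\<close> and \<open>N'\<close>.  Elements of a tensor product are cosets; all members of a coset \<open>Z\<close> are sent
  to one and the same coset, so the union below is that coset.\<close>

definition tensor_map ::
    "('a, 'm) ring_scheme \<Rightarrow> ('a, 'd) module \<Rightarrow> ('a, 'e) module \<Rightarrow> ('b \<Rightarrow> 'd) \<Rightarrow> ('c \<Rightarrow> 'e)
      \<Rightarrow> ('b \<times> 'c \<Rightarrow>\<^sub>0 int) set \<Rightarrow> ('d \<times> 'e \<Rightarrow>\<^sub>0 int) set" where
  "tensor_map R M' N' f g Z =
     (\<Union>z\<in>Z. tensor_kernel R M' N' #>\<^bsub>free_Abelian_group (carrier M' \<times> carrier N')\<^esub>
              frag_extend (\<lambda>(x, y). frag_of (f x, g y)) z)"

text \<open>Flatness: tensoring preserves injectivity.  The test modules \<open>N\<close>, \<open>N'\<close> must live in a fixed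
  type.  The type \<open>(nat \<Rightarrow> 'a) set\<close> contains, as the sets of cosets of submodules of \<open>R\<^sup>n\<close>, a copy of
  every finitely generated \<open>R\<close>-module, as well as a copy of every ideal of \<open>R\<close>; so restricting to
  this type loses nothing.\<close>

definition flat_module :: "('a, 'm) ring_scheme \<Rightarrow> ('a, 'b) module \<Rightarrow> bool" where
  "flat_module R M \<longleftrightarrow> module R M \<and>
     (\<forall>(N :: ('a, (nat \<Rightarrow> 'a) set) module) (N' :: ('a, (nat \<Rightarrow> 'a) set) module) f.
        module R N \<and> module R N' \<and> f \<in> module_hom R N N' \<and> inj_on f (carrier N) \<longrightarrow>
        inj_on (tensor_map R N' M f (\<lambda>x. x)) (carrier (tensor_product R N M)))"

text \<open>Projectivity: lifting along surjections.  Again the test modules must live in a fixed type.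
  For \<open>P\<close> with carrier in \<open>'b\<close>, the type \<open>('b \<Rightarrow> 'a) set\<close> contains copies of \<open>P\<close> and of the free
  \<open>R\<close>-module on the carrier of \<open>P\<close>, and lifting the identity of \<open>P\<close> along the canonical surjection
  between these already makes \<open>P\<close> a direct summand of a free module.\<close>

definition projective_module :: "('a, 'm) ring_scheme \<Rightarrow> ('a, 'b) module \<Rightarrow> bool" where
  "projective_module R P \<longleftrightarrow> module R P \<and>
     (\<forall>(N :: ('a, ('b \<Rightarrow> 'a) set) module) (N' :: ('a, ('b \<Rightarrow> 'a) set) module) g h.
        module R N \<and> module R N' \<and>
        g \<in> module_hom R N N' \<and> g ` carrier N = carrier N' \<and> h \<in> module_hom R P N' \<longrightarrow>
        (\<exists>k \<in> module_hom R P N. \<forall>x\<in>carrier P. g (k x) = h x))"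

definition finitely_generated_ideal :: "('a, 'm) ring_scheme \<Rightarrow> 'a set \<Rightarrow> bool" where
  "finitely_generated_ideal R I \<longleftrightarrow> (\<exists>S \<subseteq> carrier R. finite S \<and> I = Idl\<^bsub>R\<^esub> S)"

definition two_generated_ideal :: "('a, 'm) ring_scheme \<Rightarrow> 'a set \<Rightarrow> bool" where
  "two_generated_ideal R I \<longleftrightarrow> (\<exists>a\<in>carrier R. \<exists>b\<in>carrier R. I = Idl\<^bsub>R\<^esub> {a, b})"

definition generalized_gcd_ring :: "('a, 'm) ring_scheme \<Rightarrow> bool" where
  "generalized_gcd_ring R \<longleftrightarrow> cring R \<and>
     (\<forall>I. principalideal I R \<longrightarrow> projective_module R (ring_module R I)) \<and>
     (\<forall>I J.
        finitely_generated_ideal R I \<and> flat_module R (ring_module R I) \<and>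
        finitely_generated_ideal R J \<and> flat_module R (ring_module R J) \<longrightarrow>
        finitely_generated_ideal R (I \<inter> J) \<and> flat_module R (ring_module R (I \<inter> J)))"

text \<open>The maps of a conductor square are determined by \<open>T\<close>, \<open>R\<close> and \<open>C\<close>.  The cosets of \<open>C\<close> in
  \<open>R\<close> are literally cosets of \<open>C\<close> in \<open>T\<close>, so that the carrier of \<open>A\<close> is a subset of the carrier
  of \<open>B\<close>.\<close>

definition common_ideal :: "'a ring \<Rightarrow> 'a ring \<Rightarrow> 'a set \<Rightarrow> bool" where
  "common_ideal R T I \<longleftrightarrow> ideal I R \<and> ideal I T"

definition conductor_square ::
    "'a ring \<Rightarrow> 'a ring \<Rightarrow> 'a set \<Rightarrow> 'a set ring \<Rightarrow> 'a set ring \<Rightarrow> bool" where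
  "conductor_square R T C A B \<longleftrightarrow>
     cring T \<and> subcring (carrier R) T \<and> R = T\<lparr>carrier := carrier R\<rparr> \<and>
     (\<exists>I. common_ideal R T I \<and> I \<noteq> {\<zero>\<^bsub>T\<^esub>}) \<and>
     common_ideal R T C \<and> (\<forall>I. common_ideal R T I \<longrightarrow> I \<subseteq> C) \<and>
     A = R Quot C \<and> B = T Quot C"

definition non_zero_divisor :: "('a, 'm) ring_scheme \<Rightarrow> 'a \<Rightarrow> bool" where
  "non_zero_divisor T c \<longleftrightarrow>
     c \<in> carrier T \<and> (\<forall>x\<in>carrier T. c \<otimes>\<^bsub>T\<^esub> x = \<zero>\<^bsub>T\<^esub> \<longrightarrow> x = \<zero>\<^bsub>T\<^esub>)"

definition regular_conductor_square ::
    "'a ring \<Rightarrow> 'a ring \<Rightarrow> 'a set \<Rightarrow> 'a set ring \<Rightarrow> 'a set ring \<Rightarrow> bool" where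
  "regular_conductor_square R T C A B \<longleftrightarrow>
     conductor_square R T C A B \<and> (\<exists>c\<in>C. non_zero_divisor T c)"

definition product_ring :: "'i set \<Rightarrow> ('i \<Rightarrow> 'b ring) \<Rightarrow> ('i \<Rightarrow> 'b) ring" where
  "product_ring \<Lambda> F =
     \<lparr>carrier = (\<Pi>\<^sub>E l\<in>\<Lambda>. carrier (F l)),
      monoid.mult = (\<lambda>x y. \<lambda>l\<in>\<Lambda>. x l \<otimes>\<^bsub>F l\<^esub> y l),
      monoid.one = (\<lambda>l\<in>\<Lambda>. \<one>\<^bsub>F l\<^esub>),
      ring.zero = (\<lambda>l\<in>\<Lambda>. \<zero>\<^bsub>F l\<^esub>),
      ring.add = (\<lambda>x y. \<lambda>l\<in>\<Lambda>. x l \<oplus>\<^bsub>F l\<^esub> y l)\<rparr>"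

end

theory Submission
  imports Defs
begin

text \<open>Call an ideal \<open>I\<close> invertible if it contains a regular element \<open>q\<close> with \<open>q \<in> I (q : I)\<close>.  Invertible
  ideals are finitely generated and flat, and testing flatness of \<open>I = (x\<^sub>1, \<dots>, x\<^sub>n)\<close> on the inclusion of
  \<open>R/(q : I)\<close> into \<open>(R/q)\<^sup>n\<close> given by the \<open>x\<^sub>i\<close> shows that \<open>q \<in> I (q : I)\<close> for every \<open>q \<in> I\<close>.
  Hence, in a ring whose annihilators of elements are generated by idempotents, such as a domain or a
  product of domains, being a generalized GCD ring means that invertible ideals are closed under
  intersection.

  The condition on 2-generated ideals makes \<open>T\<close> a Bezout domain and a localization of \<open>R\<close> at elements
  that are units of \<open>T\<close>; in particular \<open>T\<close> is a generalized GCD ring.  It follows that, up to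
  isomorphism, an invertible ideal of \<open>R\<close> is an ideal \<open>U\<close> with \<open>U T = T\<close>; such a \<open>U\<close> contains \<open>C\<close>, and
  these \<open>U\<close> correspond to the invertible ideals of \<open>A\<close>.  An intersection of two invertible ideals of
  \<open>R\<close> becomes \<open>{w \<in> T. \<kappa>' w \<in> U \<and> \<kappa> w \<in> U'}\<close> with \<open>\<kappa> T + \<kappa>' T = T\<close>, and idempotents of \<open>A\<close> turn this
  into an intersection of two invertible ideals of \<open>A\<close>.\<close>

section \<open>Tensor products and flatness\<close>

text \<open>Invertibility is stated inside the ring, with \<open>(q : I)\<close> in the role of
  \<open>q\<close> times the inverse ideal, so that one notion serves the domains \<open>R\<close>
  and \<open>T\<close> and the ring \<open>A\<close>, which may have zero divisors; scaling by a
  regular element replaces fractional ideals. Flatness frees the notion from its witness: any member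
  of an invertible ideal can take the place of \<open>q\<close>. Elements of \<open>R\<close> that
  are units of \<open>T\<close> are the witnesses that make lifting from \<open>A\<close> work,
  since they act bijectively on \<open>C\<close>. The obstacle on the way from \<open>A\<close> to
  \<open>R\<close> is that \<kappa> and \<kappa>' may become zero divisors modulo \<open>C\<close>.
  The idempotents repair this, and coprimality in \<open>T\<close> makes the product of their
  complements vanish modulo \<open>C\<close>, which brings elements constructed in \<open>T\<close>
  back into \<open>R\<close>. That \<open>C\<close> is principal enters through gcds: if
  \<open>a\<close> is regular modulo \<open>C\<close>, then a gcd of \<open>a\<close> and a
  generator of \<open>C\<close> is a unit of \<open>T\<close>.\<close>

lemma subgroup_free_Abelian_groupI:
  assumes "K \<subseteq> {z. Poly_Mapping.keys z \<subseteq> S}" "0 \<in> K" "\<And>x y. x \<in> K \<Longrightarrow> y \<in> K \<Longrightarrow> x - y \<in> K"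
  shows "subgroup K (free_Abelian_group S)"
proof (rule group.subgroupI)
  fix a b assume ab: "a \<in> K" "b \<in> K"
  have "- a \<in> K" using assms(3)[OF assms(2) ab(1)] by simp
  then show "inv\<^bsub>free_Abelian_group S\<^esub> a \<in> K" using ab assms(1) by auto
  have "- b \<in> K" using assms(3)[OF assms(2) ab(2)] by simp
  then show "a \<otimes>\<^bsub>free_Abelian_group S\<^esub> b \<in> K" using assms(3)[OF ab(1), of "- b"] by simp
qed (use assms in auto)

locale tensor_pair =
  fixes R :: "('a, 'm) ring_scheme" and M :: "('a, 'b) module" and N :: "('a, 'c) module"
  assumes module_left: "module R M" and module_right: "module R N"
begin

interpretation M: module R M by (rule module_left)
interpretation N: module R N by (rule module_right)

lemma tensor_relations_subset:
  "tensor_relations R M N \<subseteq> carrier (free_Abelian_group (carrier M \<times> carrier N))"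
  unfolding tensor_relations_def
  by (auto dest!: set_mp[OF keys_diff] split: if_splits)

lemma subgroup_tensor_kernel:
  "subgroup (tensor_kernel R M N) (free_Abelian_group (carrier M \<times> carrier N))"
  unfolding tensor_kernel_def
  by (rule group.generate_is_subgroup[OF group_free_Abelian_group tensor_relations_subset])

lemma tensor_kernel_carrier: "z \<in> tensor_kernel R M N \<Longrightarrow> Poly_Mapping.keys z \<subseteq> carrier M \<times> carrier N"
  by (rule iffD1[OF carrier_free_Abelian_group_iff subgroup.mem_carrier[OF subgroup_tensor_kernel]])

lemma tensor_kernel_zero: "0 \<in> tensor_kernel R M N"
  using subgroup.one_closed[OF subgroup_tensor_kernel] by simp

lemma tensor_kernel_add: "x \<in> tensor_kernel R M N \<Longrightarrow> y \<in> tensor_kernel R M N \<Longrightarrow> x + y \<in> tensor_kernel R M N"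
  using subgroup.m_closed[OF subgroup_tensor_kernel] by simp

lemma tensor_kernel_uminus: "x \<in> tensor_kernel R M N \<Longrightarrow> - x \<in> tensor_kernel R M N"
  using subgroup.m_inv_closed[OF subgroup_tensor_kernel, of x] inv_free_Abelian_group[OF tensor_kernel_carrier]
  by simp

lemma tensor_kernel_diff: "x \<in> tensor_kernel R M N \<Longrightarrow> y \<in> tensor_kernel R M N \<Longrightarrow> x - y \<in> tensor_kernel R M N"
  using tensor_kernel_add[OF _ tensor_kernel_uminus, of x y] by simp

lemma tensor_kernel_congr:
  "x - y \<in> tensor_kernel R M N \<Longrightarrow> x \<in> tensor_kernel R M N \<longleftrightarrow> y \<in> tensor_kernel R M N"
  using tensor_kernel_add[of "x - y" y] tensor_kernel_diff[of x "x - y"] by auto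

lemma relation_in_tensor_kernel: "z \<in> tensor_relations R M N \<Longrightarrow> z \<in> tensor_kernel R M N"
  unfolding tensor_kernel_def by (rule generate.incl)

lemma tensor_kernel_add_left:
  "x \<in> carrier M \<Longrightarrow> x' \<in> carrier M \<Longrightarrow> y \<in> carrier N \<Longrightarrow>
   frag_of (x \<oplus>\<^bsub>M\<^esub> x', y) - frag_of (x, y) - frag_of (x', y) \<in> tensor_kernel R M N"
  by (rule relation_in_tensor_kernel) (unfold tensor_relations_def, blast)

lemma tensor_kernel_add_right:
  "x \<in> carrier M \<Longrightarrow> y \<in> carrier N \<Longrightarrow> y' \<in> carrier N \<Longrightarrow>
   frag_of (x, y \<oplus>\<^bsub>N\<^esub> y') - frag_of (x, y) - frag_of (x, y') \<in> tensor_kernel R M N"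
  by (rule relation_in_tensor_kernel) (unfold tensor_relations_def, blast)

lemma tensor_kernel_smult:
  "a \<in> carrier R \<Longrightarrow> x \<in> carrier M \<Longrightarrow> y \<in> carrier N \<Longrightarrow>
   frag_of (a \<odot>\<^bsub>M\<^esub> x, y) - frag_of (x, a \<odot>\<^bsub>N\<^esub> y) \<in> tensor_kernel R M N"
  by (rule relation_in_tensor_kernel) (unfold tensor_relations_def, blast)

lemma tensor_kernel_zero_left:
  assumes "y \<in> carrier N" shows "frag_of (\<zero>\<^bsub>M\<^esub>, y) \<in> tensor_kernel R M N"
  using tensor_kernel_uminus[OF tensor_kernel_add_left[of "\<zero>\<^bsub>M\<^esub>" "\<zero>\<^bsub>M\<^esub>" y]] assms by simp

lemma tensor_kernel_diff_left:
  assumes "x \<in> carrier M" "x' \<in> carrier M" "y \<in> carrier N"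
  shows "frag_of (x \<ominus>\<^bsub>M\<^esub> x', y) - frag_of (x, y) + frag_of (x', y) \<in> tensor_kernel R M N"
proof -
  have "(x \<ominus>\<^bsub>M\<^esub> x') \<oplus>\<^bsub>M\<^esub> x' = x"
    using assms by (simp add: M.minus_eq M.add.m_assoc M.l_neg)
  then show ?thesis
    using tensor_kernel_uminus[OF tensor_kernel_add_left[of "x \<ominus>\<^bsub>M\<^esub> x'" x' y]] assms
    by (simp add: algebra_simps)
qed

text \<open>Closure under differences, together with \<open>0\<close>, already gives a subgroup, so
  sums and inverses need no cases of their own. The membership premises in the \<open>diff\<close>
  case supply the bounds on keys that a map controlled only on the free group needs there.\<close>

lemma tensor_kernel_induct [consumes 1, case_names zero diff add_left add_right smult]:
  assumes "z \<in> tensor_kernel R M N"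
    and "P 0"
    and "\<And>z w. z \<in> tensor_kernel R M N \<Longrightarrow> w \<in> tensor_kernel R M N \<Longrightarrow> P z \<Longrightarrow> P w \<Longrightarrow> P (z - w)"
    and "\<And>x x' y. x \<in> carrier M \<Longrightarrow> x' \<in> carrier M \<Longrightarrow> y \<in> carrier N \<Longrightarrow>
      P (frag_of (x \<oplus>\<^bsub>M\<^esub> x', y) - frag_of (x, y) - frag_of (x', y))"
    and "\<And>x y y'. x \<in> carrier M \<Longrightarrow> y \<in> carrier N \<Longrightarrow> y' \<in> carrier N \<Longrightarrow>
      P (frag_of (x, y \<oplus>\<^bsub>N\<^esub> y') - frag_of (x, y) - frag_of (x, y'))"
    and "\<And>a x y. a \<in> carrier R \<Longrightarrow> x \<in> carrier M \<Longrightarrow> y \<in> carrier N \<Longrightarrow>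
      P (frag_of (a \<odot>\<^bsub>M\<^esub> x, y) - frag_of (x, a \<odot>\<^bsub>N\<^esub> y))"
  shows "P z"
proof -
  let ?F = "free_Abelian_group (carrier M \<times> carrier N)"
  let ?K = "{z \<in> tensor_kernel R M N. P z}"
  have "subgroup ?K ?F"
    by (rule subgroup_free_Abelian_groupI)
      (use assms(2,3) tensor_kernel_carrier tensor_kernel_zero tensor_kernel_diff in auto)
  moreover have "tensor_relations R M N \<subseteq> ?K"
  proof
    fix r assume r: "r \<in> tensor_relations R M N"
    then have "P r"
      unfolding tensor_relations_def by (elim UnE CollectE exE conjE) (simp_all add: assms(4-6))
    with r show "r \<in> ?K" by (simp add: relation_in_tensor_kernel)
  qed
  ultimately have "tensor_kernel R M N \<subseteq> ?K"
    unfolding tensor_kernel_def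
    by (intro group.generate_subgroup_incl[OF group_free_Abelian_group])
  then show ?thesis using assms(1) by auto
qed

lemma tensor_class_eq_iff:
  assumes "Poly_Mapping.keys z \<subseteq> carrier M \<times> carrier N" "Poly_Mapping.keys w \<subseteq> carrier M \<times> carrier N"
  shows "tensor_kernel R M N #>\<^bsub>free_Abelian_group (carrier M \<times> carrier N)\<^esub> z =
         tensor_kernel R M N #>\<^bsub>free_Abelian_group (carrier M \<times> carrier N)\<^esub> w \<longleftrightarrow>
         z - w \<in> tensor_kernel R M N"
proof -
  let ?F = "free_Abelian_group (carrier M \<times> carrier N)"
  interpret group ?F by simp
  interpret K: subgroup "tensor_kernel R M N" ?F by (rule subgroup_tensor_kernel)
  have "tensor_kernel R M N #>\<^bsub>?F\<^esub> z = tensor_kernel R M N #>\<^bsub>?F\<^esub> w \<longleftrightarrow> z \<in> tensor_kernel R M N #>\<^bsub>?F\<^esub> w"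
    using repr_independence[of z "tensor_kernel R M N" w] rcos_self[of z "tensor_kernel R M N"] assms
      subgroup_tensor_kernel by auto
  also have "\<dots> \<longleftrightarrow> z - w \<in> tensor_kernel R M N"
    using K.rcos_module[OF is_group, of w z] assms by simp
  finally show ?thesis .
qed

text \<open>Bilinearity is deliberately left out: the map comes from the universal property of the
  free abelian group, and its effect on the relations is left to \<open>bilinear_kernel\<close>.
  Subtraction is the operation reported, matching the cases of
  \<open>tensor_kernel_induct\<close>.\<close>

lemma bilinear_lift:
  fixes G (structure)
  assumes G: "abelian_group G" and f: "\<And>x y. x \<in> carrier M \<Longrightarrow> y \<in> carrier N \<Longrightarrow> f x y \<in> carrier G"
  obtains h where "\<And>x y. x \<in> carrier M \<Longrightarrow> y \<in> carrier N \<Longrightarrow> h (frag_of (x, y)) = f x y"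
    and "h 0 = \<zero>"
    and "\<And>z w. Poly_Mapping.keys z \<subseteq> carrier M \<times> carrier N \<Longrightarrow> Poly_Mapping.keys w \<subseteq> carrier M \<times> carrier N
      \<Longrightarrow> h (z - w) = h z \<ominus> h w"
    and "\<And>z. Poly_Mapping.keys z \<subseteq> carrier M \<times> carrier N \<Longrightarrow> h z \<in> carrier G"
proof -
  interpret G: abelian_group G by (rule G)
  interpret F: group "free_Abelian_group (carrier M \<times> carrier N)" by simp
  obtain h where h: "h \<in> hom (free_Abelian_group (carrier M \<times> carrier N)) (add_monoid G)"
    and hf: "\<And>x. x \<in> carrier M \<times> carrier N \<Longrightarrow> h (frag_of x) = case_prod f x"
  proof (rule comm_group.free_Abelian_group_universal[OF G.a_comm_group])
    show "case_prod f ` (carrier M \<times> carrier N) \<subseteq> carrier (add_monoid G)"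
      using f by auto
  qed blast
  interpret h: group_hom "free_Abelian_group (carrier M \<times> carrier N)" "add_monoid G" h
    by unfold_locales (rule h)
  have 1: "h (z - w) = h z \<ominus> h w"
    if "Poly_Mapping.keys z \<subseteq> carrier M \<times> carrier N" "Poly_Mapping.keys w \<subseteq> carrier M \<times> carrier N" for z w
    using h.hom_mult[of z "- w"] h.hom_inv[of w] that
    by (simp add: a_minus_def a_inv_def)
  show thesis
    by (rule that[of h]) (use hf 1 h.hom_one h.hom_closed in auto)
qed

text \<open>Asking for bilinearity only modulo an additive subgroup \<open>W\<close> replaces a map
  into the quotient \<open>G/W\<close>, which is never built. \<open>W\<close> is zero in the proof
  of \<open>flat_if_trace\<close> and the product ideal \<open>I (q : I)\<close> in that of
  \<open>colon_prod_if_flat\<close>, where values are computed on chosen representatives.\<close>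

lemma bilinear_kernel:
  fixes G (structure)
  assumes W: "additive_subgroup W G" "abelian_group G"
    and h: "\<And>x y. x \<in> carrier M \<Longrightarrow> y \<in> carrier N \<Longrightarrow> h (frag_of (x, y)) = f x y" "h 0 = \<zero>"
      "\<And>z w. Poly_Mapping.keys z \<subseteq> carrier M \<times> carrier N \<Longrightarrow> Poly_Mapping.keys w \<subseteq> carrier M \<times> carrier N
      \<Longrightarrow> h (z - w) = h z \<ominus> h w"
    and f: "\<And>x x' y. x \<in> carrier M \<Longrightarrow> x' \<in> carrier M \<Longrightarrow> y \<in> carrier N \<Longrightarrow>
        f (x \<oplus>\<^bsub>M\<^esub> x') y \<ominus> f x y \<ominus> f x' y \<in> W"
      "\<And>x y y'. x \<in> carrier M \<Longrightarrow> y \<in> carrier N \<Longrightarrow> y' \<in> carrier N \<Longrightarrow>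
        f x (y \<oplus>\<^bsub>N\<^esub> y') \<ominus> f x y \<ominus> f x y' \<in> W"
      "\<And>a x y. a \<in> carrier R \<Longrightarrow> x \<in> carrier M \<Longrightarrow> y \<in> carrier N \<Longrightarrow>
        f (a \<odot>\<^bsub>M\<^esub> x) y \<ominus> f x (a \<odot>\<^bsub>N\<^esub> y) \<in> W"
    and z: "z \<in> tensor_kernel R M N"
  shows "h z \<in> W"
proof -
  interpret G: abelian_group G by (rule W)
  interpret W: additive_subgroup W G by (rule W)
  have k: "Poly_Mapping.keys (frag_of u - frag_of v) \<subseteq> carrier M \<times> carrier N"
    if "u \<in> carrier M \<times> carrier N" "v \<in> carrier M \<times> carrier N" for u v
    using keys_diff[of "frag_of u" "frag_of v"] that by auto
  show ?thesis
    using z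
  proof (induction rule: tensor_kernel_induct)
    case (diff z w)
    then show ?case
      by (simp add: h tensor_kernel_carrier G.minus_eq)
  qed (auto simp: h f k)
qed

end

text \<open>Both sides of a tensor product are classes modulo the tensor kernel, so injectivity of
  \<open>f \<otimes> 1\<close> is a statement about the free group on pairs.\<close>

lemma flat_module_iff:
  fixes R :: "('a, 'm) ring_scheme" and M :: "('a, 'b) module"
  shows "flat_module R M \<longleftrightarrow> module R M \<and>
    (\<forall>(N :: ('a, (nat \<Rightarrow> 'a) set) module) (N' :: ('a, (nat \<Rightarrow> 'a) set) module) f.
      module R N \<and> module R N' \<and> f \<in> module_hom R N N' \<and> inj_on f (carrier N) \<longrightarrow>
      (\<forall>z. Poly_Mapping.keys z \<subseteq> carrier N \<times> carrier M \<and>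
         frag_extend (\<lambda>(x, y). frag_of (f x, y)) z \<in> tensor_kernel R N' M \<longrightarrow> z \<in> tensor_kernel R N M))"
proof -
  have core: "inj_on (tensor_map R N' M f (\<lambda>x. x)) (carrier (tensor_product R N M)) \<longleftrightarrow>
      (\<forall>z. Poly_Mapping.keys z \<subseteq> carrier N \<times> carrier M \<and>
         frag_extend (\<lambda>(x, y). frag_of (f x, y)) z \<in> tensor_kernel R N' M \<longrightarrow> z \<in> tensor_kernel R N M)"
    (is "inj_on ?t ?X \<longleftrightarrow> ?rhs")
    if "module R M" "module R N" "module R N'" and f: "f \<in> module_hom R N N'"
    for N N' :: "('a, (nat \<Rightarrow> 'a) set) module" and f
  proof -
    interpret tensor_pair R N M by (rule tensor_pair.intro) fact+
    interpret T': tensor_pair R N' M by (rule tensor_pair.intro) fact+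
    interpret M: module R M by fact
    let ?F = "free_Abelian_group (carrier N \<times> carrier M)"
    let ?F' = "free_Abelian_group (carrier N' \<times> carrier M)"
    let ?K = "tensor_kernel R N M" and ?K' = "tensor_kernel R N' M"
    let ?e = "frag_extend (\<lambda>(x, y). frag_of (f x, y)) :: _ \<Rightarrow> ((nat \<Rightarrow> 'a) set \<times> 'b \<Rightarrow>\<^sub>0 int)"
    have fcl: "f x \<in> carrier N'" if "x \<in> carrier N" for x
      using f that by (auto simp: module_hom_def)
    have fadd: "f (x \<oplus>\<^bsub>N\<^esub> y) = f x \<oplus>\<^bsub>N'\<^esub> f y" if "x \<in> carrier N" "y \<in> carrier N" for x y
      using f that by (auto simp: module_hom_def)
    have fsm: "f (a \<odot>\<^bsub>N\<^esub> x) = a \<odot>\<^bsub>N'\<^esub> f x" if "a \<in> carrier R" "x \<in> carrier N" for a x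
      using f that by (auto simp: module_hom_def)
    have ecl: "Poly_Mapping.keys (?e z) \<subseteq> carrier N' \<times> carrier M"
      if "Poly_Mapping.keys z \<subseteq> carrier N \<times> carrier M" for z
      using that fcl by (force dest!: set_mp[OF keys_frag_extend])
    have eK: "?e z \<in> ?K'" if "z \<in> ?K" for z
      using that
      by (induction rule: tensor_kernel_induct)
        (simp_all add: frag_extend_diff fadd fsm fcl T'.tensor_kernel_zero T'.tensor_kernel_diff
          T'.tensor_kernel_add_left T'.tensor_kernel_add_right T'.tensor_kernel_smult)
    have t: "?t (?K #>\<^bsub>?F\<^esub> z) = ?K' #>\<^bsub>?F'\<^esub> ?e z"
      if z: "Poly_Mapping.keys z \<subseteq> carrier N \<times> carrier M" for z
    proof -
      have "?K' #>\<^bsub>?F'\<^esub> ?e (k + z) = ?K' #>\<^bsub>?F'\<^esub> ?e z" if "k \<in> ?K" for k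
      proof (subst T'.tensor_class_eq_iff)
        have "Poly_Mapping.keys (k + z) \<subseteq> carrier N \<times> carrier M"
          using keys_add[of k z] tensor_kernel_carrier[OF that] z by blast
        then show "Poly_Mapping.keys (?e (k + z)) \<subseteq> carrier N' \<times> carrier M" by (rule ecl)
      qed (use ecl[OF z] eK[OF that] in \<open>simp_all add: frag_extend_add\<close>)
      moreover have "?K \<noteq> {}" using tensor_kernel_zero by auto
      ultimately show ?thesis
        unfolding tensor_map_def r_coset_def[of ?F] by auto
    qed
    have X: "?X = (\<lambda>z. ?K #>\<^bsub>?F\<^esub> z) ` {z. Poly_Mapping.keys z \<subseteq> carrier N \<times> carrier M}"
      unfolding tensor_product_def FactGroup_def RCOSETS_def
      by (auto simp: free_Abelian_group_def)
    show ?thesis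
    proof
      assume inj: "inj_on ?t ?X"
      show ?rhs
      proof (intro allI impI, elim conjE)
        fix z assume z: "Poly_Mapping.keys z \<subseteq> carrier N \<times> carrier M" "?e z \<in> ?K'"
        have "?t (?K #>\<^bsub>?F\<^esub> z) = ?t (?K #>\<^bsub>?F\<^esub> 0)"
          using z ecl[OF z(1)] by (simp add: t T'.tensor_class_eq_iff)
        then have "?K #>\<^bsub>?F\<^esub> z = ?K #>\<^bsub>?F\<^esub> 0"
          by (rule inj_onD[OF inj]) (use z X in auto)
        then show "z \<in> ?K" using z by (simp add: tensor_class_eq_iff)
      qed
    next
      assume rhs: ?rhs
      show "inj_on ?t ?X"
      proof (rule inj_onI)
        fix Z W assume "Z \<in> ?X" "W \<in> ?X" and tt: "?t Z = ?t W"
        then obtain z w where z: "Poly_Mapping.keys z \<subseteq> carrier N \<times> carrier M" "Z = ?K #>\<^bsub>?F\<^esub> z"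
          and w: "Poly_Mapping.keys w \<subseteq> carrier N \<times> carrier M" "W = ?K #>\<^bsub>?F\<^esub> w"
          unfolding X by blast
        have "?e (z - w) \<in> ?K'"
          using tt z w ecl by (simp add: t T'.tensor_class_eq_iff frag_extend_diff)
        moreover have "Poly_Mapping.keys (z - w) \<subseteq> carrier N \<times> carrier M"
          using keys_diff[of z w] z w by blast
        ultimately have "z - w \<in> ?K" using rhs by blast
        then show "Z = W" using z w by (simp add: tensor_class_eq_iff)
      qed
    qed
  qed
  show ?thesis
    unfolding flat_module_def
    by (rule conj_cong[OF refl], intro all_cong1, rule imp_cong[OF refl], rule core) simp_all
qed

section \<open>Trace ideals\<close>

lemma ring_module_simps [simp]:
  "carrier (ring_module R I) = I" "\<zero>\<^bsub>ring_module R I\<^esub> = \<zero>\<^bsub>R\<^esub>"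
  "x \<oplus>\<^bsub>ring_module R I\<^esub> y = x \<oplus>\<^bsub>R\<^esub> y" "a \<odot>\<^bsub>ring_module R I\<^esub> x = a \<otimes>\<^bsub>R\<^esub> x"
  by (simp_all add: ring_module_def)

lemma module_homI:
  assumes "\<And>x. x \<in> carrier M \<Longrightarrow> f x \<in> carrier N"
    and "\<And>x y. x \<in> carrier M \<Longrightarrow> y \<in> carrier M \<Longrightarrow> f (x \<oplus>\<^bsub>M\<^esub> y) = f x \<oplus>\<^bsub>N\<^esub> f y"
    and "\<And>a x. a \<in> carrier R \<Longrightarrow> x \<in> carrier M \<Longrightarrow> f (a \<odot>\<^bsub>M\<^esub> x) = a \<odot>\<^bsub>N\<^esub> f x"
  shows "f \<in> module_hom R M N"
  using assms by (auto simp: module_hom_def)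

lemma module_homD:
  assumes "f \<in> module_hom R M N"
  shows "x \<in> carrier M \<Longrightarrow> f x \<in> carrier N"
    and "x \<in> carrier M \<Longrightarrow> y \<in> carrier M \<Longrightarrow> f (x \<oplus>\<^bsub>M\<^esub> y) = f x \<oplus>\<^bsub>N\<^esub> f y"
    and "a \<in> carrier R \<Longrightarrow> x \<in> carrier M \<Longrightarrow> f (a \<odot>\<^bsub>M\<^esub> x) = a \<odot>\<^bsub>N\<^esub> f x"
  using assms by (auto simp: module_hom_def)

lemma (in abelian_group) add_diff_self:
  assumes "a \<in> carrier G" "b \<in> carrier G" shows "a \<oplus> b \<ominus> a \<ominus> b = \<zero>"
proof -
  have "a \<oplus> b \<ominus> a \<ominus> b = b \<oplus> (a \<oplus> (\<ominus> a \<oplus> \<ominus> b))"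
    using assms by (simp add: minus_eq a_assoc a_lcomm)
  then show ?thesis using assms by (simp add: a_assoc[symmetric] r_neg)
qed

lemma (in cring) idealI':
  assumes "I \<subseteq> carrier R" "\<zero> \<in> I" "\<And>x y. x \<in> I \<Longrightarrow> y \<in> I \<Longrightarrow> x \<oplus> y \<in> I"
    and "\<And>a x. a \<in> carrier R \<Longrightarrow> x \<in> I \<Longrightarrow> a \<otimes> x \<in> I"
  shows "ideal I R"
proof (rule idealI)
  show "subgroup I (add_monoid R)"
  proof (rule add.subgroupI)
    fix x assume x: "x \<in> I"
    have "\<ominus> x = \<ominus> \<one> \<otimes> x" using x assms(1) by (auto simp: l_minus)
    then show "\<ominus> x \<in> I" using assms(4)[of "\<ominus> \<one>" x] x by simp
  qed (use assms in auto)
  show "a \<otimes> x \<in> I" if "a \<in> I" "x \<in> carrier R" for a x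
    using assms(4)[OF that(2,1)] that assms(1) by (metis m_comm subsetD)
qed (use assms ring_axioms in auto)

lemma (in ideal) closed_simps:
  "\<zero> \<in> I" "x \<in> I \<Longrightarrow> y \<in> I \<Longrightarrow> x \<oplus> y \<in> I" "x \<in> I \<Longrightarrow> y \<in> I \<Longrightarrow> x \<ominus> y \<in> I" "x \<in> I \<Longrightarrow> \<ominus> x \<in> I"
  "a \<in> carrier R \<Longrightarrow> x \<in> I \<Longrightarrow> a \<otimes> x \<in> I" "a \<in> carrier R \<Longrightarrow> x \<in> I \<Longrightarrow> x \<otimes> a \<in> I"
  by (auto simp: I_l_closed I_r_closed a_minus_def)

lemma (in cring) module_ring_module:
  assumes "ideal I R" shows "module R (ring_module R I)"
proof -
  interpret I: ideal I R by fact
  show ?thesis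
  proof (rule moduleI)
    show "abelian_group (ring_module R I)"
    proof (rule abelian_groupI)
      fix x assume "x \<in> carrier (ring_module R I)"
      then show "\<exists>y\<in>carrier (ring_module R I). y \<oplus>\<^bsub>ring_module R I\<^esub> x = \<zero>\<^bsub>ring_module R I\<^esub>"
        by (intro bexI[of _ "\<ominus> x"]) (auto simp: l_neg)
    qed (auto simp: a_assoc a_comm a_lcomm)
  qed (auto simp: is_cring I.I_l_closed l_distr r_distr m_assoc)
qed

lemma (in cring) module_self: "module R (ring_module R (carrier R))"
  by (rule module_ring_module[OF oneideal])

text \<open>For ideals, an endomorphism of the form \<open>y \<mapsto> \<phi> y \<otimes> x\<close> is multiplication by \<open>\<phi> x\<close>.  An ideal
  is therefore finitely generated and projective as soon as some element of its trace ideal acts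
  on it as the identity.\<close>

inductive_set trace_ideal :: "('a, 'm) ring_scheme \<Rightarrow> 'a set \<Rightarrow> 'a set"
  for R (structure) and I where
  value_in: "\<phi> \<in> module_hom R (ring_module R I) (ring_module R (carrier R)) \<Longrightarrow> x \<in> I \<Longrightarrow>
    \<phi> x \<in> trace_ideal R I"
| add_in: "v \<in> trace_ideal R I \<Longrightarrow> w \<in> trace_ideal R I \<Longrightarrow> v \<oplus> w \<in> trace_ideal R I"

context cring begin

lemma trace_ideal_carrier:
  assumes "ideal I R" "w \<in> trace_ideal R I" shows "w \<in> carrier R"
  using assms(2) by induction (auto simp: module_hom_def)

text \<open>Both sides are \<open>\<phi> (x \<otimes> y)\<close>: in an ideal, the same elements
  serve as scalars and as vectors.\<close>

lemma trace_swap: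
  assumes "ideal I R" "\<phi> \<in> module_hom R (ring_module R I) (ring_module R (carrier R))" "x \<in> I" "y \<in> I"
  shows "\<phi> x \<otimes> y = \<phi> y \<otimes> x"
proof -
  interpret I: ideal I R by fact
  have "y \<otimes> \<phi> x = \<phi> (y \<otimes> x)" "x \<otimes> \<phi> y = \<phi> (x \<otimes> y)" "\<phi> x \<in> carrier R" "\<phi> y \<in> carrier R"
    using assms(2-4) by (auto simp: module_hom_def)
  then show ?thesis using assms(3,4) I.Icarr m_comm by metis
qed

text \<open>If \<open>w\<close> is a sum of values \<open>\<phi> x\<close>, then by
  \<open>trace_swap\<close> the element \<open>y = w y\<close> is the corresponding sum of products
  \<open>\<phi> y \<otimes> x\<close>: a dual basis. The induction on \<open>w\<close> collects the
  finitely many \<open>x\<close> that occur.\<close>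

lemma finitely_generated_if_trace:
  assumes I: "ideal I R" and w: "w \<in> trace_ideal R I" "\<And>y. y \<in> I \<Longrightarrow> w \<otimes> y = y"
  shows "finitely_generated_ideal R I"
proof -
  interpret I: ideal I R by fact
  have "\<exists>S. S \<subseteq> I \<and> finite S \<and> (\<forall>y\<in>I. w \<otimes> y \<in> Idl S)"
    using w(1)
  proof induction
    case (value_in \<phi> x)
    have "\<phi> x \<otimes> y \<in> Idl {x}" if y: "y \<in> I" for y
    proof -
      interpret J: ideal "Idl {x}" R using value_in by (intro genideal_ideal) auto
      have "\<phi> y \<in> carrier R" using module_homD(1)[OF value_in(1)] y by simp
      moreover have "x \<in> Idl {x}" using genideal_self[of "{x}"] value_in by auto
      ultimately show ?thesis
        unfolding trace_swap[OF I value_in y] by (rule J.I_l_closed[rotated])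
    qed
    then show ?case using value_in by (intro exI[of _ "{x}"]) auto
  next
    case (add_in v w)
    then obtain S S' where S: "S \<subseteq> I" "finite S" "\<forall>y\<in>I. v \<otimes> y \<in> Idl S"
      and S': "S' \<subseteq> I" "finite S'" "\<forall>y\<in>I. w \<otimes> y \<in> Idl S'" by auto
    have c: "S \<union> S' \<subseteq> carrier R" using S S' I.a_subset by auto
    interpret J: ideal "Idl (S \<union> S')" R by (rule genideal_ideal[OF c])
    have m: "Idl S \<subseteq> Idl (S \<union> S')" "Idl S' \<subseteq> Idl (S \<union> S')"
      using subset_Idl_subset[OF c] by auto
    have "(v \<oplus> w) \<otimes> y \<in> Idl (S \<union> S')" if "y \<in> I" for y
      using S(3) S'(3) that m trace_ideal_carrier[OF I] add_in
      by (subst l_distr) (auto intro!: J.a_closed)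
    then show ?case using S S' by (intro exI[of _ "S \<union> S'"]) auto
  qed
  then obtain S where S: "S \<subseteq> I" "finite S" "\<forall>y\<in>I. w \<otimes> y \<in> Idl S" by blast
  have "I = Idl S"
    using S w(2) genideal_minimal[OF I S(1)] by auto
  then show ?thesis
    unfolding finitely_generated_ideal_def using S I.a_subset by auto
qed

text \<open>If \<open>w\<close> is a sum of values \<open>\<phi> x\<close>, a tensor
  \<open>n \<otimes> y\<close> equals \<open>n \<otimes> w y\<close>, the sum of the tensors
  \<open>\<phi> y n \<otimes> x\<close>. So it is enough that each contraction
  \<open>n \<otimes> y \<mapsto> \<phi> y n\<close> into \<open>N\<close> sends a tensor that dies
  over \<open>N'\<close> to zero, and this follows from the injectivity of \<open>f\<close> on
  elements.\<close>

lemma flat_if_trace: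
  assumes I: "ideal I R" and w: "w \<in> trace_ideal R I" "\<And>y. y \<in> I \<Longrightarrow> w \<otimes> y = y"
  shows "flat_module R (ring_module R I)"
  unfolding flat_module_iff
proof (intro conjI allI impI, goal_cases)
  case 1 show ?case by (rule module_ring_module[OF I])
next
  case (2 N N' f z)
  then have N: "module R N" and N': "module R N'" and f: "f \<in> module_hom R N N'"
    and inj: "inj_on f (carrier N)"
    and z: "Poly_Mapping.keys z \<subseteq> carrier N \<times> I"
    and ez: "frag_extend (\<lambda>(x, y). frag_of (f x, y)) z \<in> tensor_kernel R N' (ring_module R I)"
    by auto
  interpret I: ideal I R by fact
  interpret N: module R N by fact
  interpret N': module R N' by fact
  interpret T: tensor_pair R N "ring_module R I"
    by (rule tensor_pair.intro[OF N module_ring_module[OF I]])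
  interpret T': tensor_pair R N' "ring_module R I"
    by (rule tensor_pair.intro[OF N' module_ring_module[OF I]])
  let ?K = "tensor_kernel R N (ring_module R I)"
  define e :: "((nat \<Rightarrow> 'a) set \<times> 'a \<Rightarrow>\<^sub>0 int) \<Rightarrow> ((nat \<Rightarrow> 'a) set \<times> 'a \<Rightarrow>\<^sub>0 int)"
    where "e = frag_extend (\<lambda>(x, y). frag_of (f x, y))"
  \<comment> \<open>\<open>p v\<close> multiplies all second components by \<open>v\<close>. Modulo
    the kernel it is additive in \<open>v\<close>, so \<open>p w z\<close> can be treated by
    induction on \<open>w\<close>; and it equals \<open>z\<close>, because \<open>w\<close> acts on
    \<open>I\<close> as the identity.\<close>
  define p :: "'a \<Rightarrow> ((nat \<Rightarrow> 'a) set \<times> 'a \<Rightarrow>\<^sub>0 int) \<Rightarrow> ((nat \<Rightarrow> 'a) set \<times> 'a \<Rightarrow>\<^sub>0 int)"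
    where "p = (\<lambda>v. frag_extend (\<lambda>(n, y). frag_of (n, v \<otimes> y)))"
  have ekeys: "Poly_Mapping.keys (e a) \<subseteq> carrier N' \<times> I" if "Poly_Mapping.keys a \<subseteq> carrier N \<times> I" for a
  proof -
    have "Poly_Mapping.keys (case x of (x, y) \<Rightarrow> frag_of (f x, y)) \<subseteq> carrier N' \<times> I"
      if "x \<in> Poly_Mapping.keys a" for x
    proof -
      have "fst x \<in> carrier N" "snd x \<in> I" using that \<open>Poly_Mapping.keys a \<subseteq> _\<close> by auto
      then show ?thesis using module_homD(1)[OF f] by (simp add: split_beta)
    qed
    then show ?thesis
      unfolding e_def by (intro order_trans[OF keys_frag_extend] UN_least)
  qed
  have "p w z \<in> ?K" using w(1)
  proof induction
    case (value_in \<phi> x)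
    note \<phi> = module_homD[OF value_in(1), simplified]
    obtain h where h: "\<And>n y. n \<in> carrier N \<Longrightarrow> y \<in> I \<Longrightarrow> h (frag_of (n, y)) = \<phi> y \<odot>\<^bsub>N\<^esub> n"
      "h 0 = \<zero>\<^bsub>N\<^esub>"
      "\<And>z w. Poly_Mapping.keys z \<subseteq> carrier N \<times> I \<Longrightarrow> Poly_Mapping.keys w \<subseteq> carrier N \<times> I \<Longrightarrow>
        h (z - w) = h z \<ominus>\<^bsub>N\<^esub> h w"
      "\<And>z. Poly_Mapping.keys z \<subseteq> carrier N \<times> I \<Longrightarrow> h z \<in> carrier N"
      by (rule T.bilinear_lift[OF N.abelian_group_axioms, of "\<lambda>n y. \<phi> y \<odot>\<^bsub>N\<^esub> n", simplified])
        (simp add: \<phi>, rule that)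
    obtain h' where h': "\<And>n y. n \<in> carrier N' \<Longrightarrow> y \<in> I \<Longrightarrow> h' (frag_of (n, y)) = \<phi> y \<odot>\<^bsub>N'\<^esub> n"
      "h' 0 = \<zero>\<^bsub>N'\<^esub>"
      "\<And>z w. Poly_Mapping.keys z \<subseteq> carrier N' \<times> I \<Longrightarrow> Poly_Mapping.keys w \<subseteq> carrier N' \<times> I \<Longrightarrow>
        h' (z - w) = h' z \<ominus>\<^bsub>N'\<^esub> h' w"
      "\<And>z. Poly_Mapping.keys z \<subseteq> carrier N' \<times> I \<Longrightarrow> h' z \<in> carrier N'"
      by (rule T'.bilinear_lift[OF N'.abelian_group_axioms, of "\<lambda>n y. \<phi> y \<odot>\<^bsub>N'\<^esub> n", simplified])
        (simp add: \<phi>, rule that)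
    interpret gf: group_hom "add_monoid N" "add_monoid N'" f
      by unfold_locales (use module_homD[OF f] in \<open>auto intro!: homI\<close>)
    have fdiff: "f (a \<ominus>\<^bsub>N\<^esub> b) = f a \<ominus>\<^bsub>N'\<^esub> f b" if "a \<in> carrier N" "b \<in> carrier N" for a b
      using gf.hom_mult gf.hom_inv that by (simp add: a_minus_def a_inv_def)
    have f0: "f \<zero>\<^bsub>N\<^esub> = \<zero>\<^bsub>N'\<^esub>"
      using gf.hom_one by simp
    have "h' (e z) \<in> {\<zero>\<^bsub>N'\<^esub>}"
    proof (rule T'.bilinear_kernel[where G = N' and f = "\<lambda>n y. \<phi> y \<odot>\<^bsub>N'\<^esub> n"])
      show "additive_subgroup {\<zero>\<^bsub>N'\<^esub>} N'"
        by (rule additive_subgroupI) (rule N'.add.triv_subgroup[simplified])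
      show "e z \<in> tensor_kernel R N' (ring_module R I)" using ez by (simp add: e_def)
    qed (auto simp: h' \<phi> N'.abelian_group_axioms N'.smult_r_distr N'.smult_l_distr
        N'.smult_assoc1[symmetric] N'.add_diff_self m_comm N'.r_neg[folded N'.minus_eq])
    then have kill: "h' (e z) = \<zero>\<^bsub>N'\<^esub>" by simp
    have fh: "f (h a) = h' (e a)" if "Poly_Mapping.keys a \<subseteq> carrier N \<times> I" for a
      using that
    proof (induction rule: free_Abelian_group_induct[consumes 1, case_names zero diff one])
      case zero then show ?case by (simp add: e_def h h' f0)
    next
      case (diff x y)
      moreover have "e (x - y) = e x - e y" by (simp add: e_def frag_extend_diff)
      ultimately show ?case using ekeys by (simp add: h h' fdiff)
    next
      case (one a)
      then show ?case using module_homD[OF f] \<phi> by (auto simp: e_def h h')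
    qed
    \<comment> \<open>Modulo the kernel, multiplying by \<open>\<phi> x\<close> is contraction
      against \<open>\<phi>\<close> followed by tensoring with \<open>x\<close>; on a generator this
      is \<open>trace_swap\<close> and moving \<open>\<phi> y\<close> across the tensor
      sign.\<close>
    have ph: "p (\<phi> x) a - frag_of (h a, x) \<in> ?K" if "Poly_Mapping.keys a \<subseteq> carrier N \<times> I" for a
      using that
    proof (induction rule: free_Abelian_group_induct[consumes 1, case_names zero diff one])
      case zero then show ?case
        using T.tensor_kernel_uminus[OF T.tensor_kernel_zero_left] value_in(2) by (simp add: p_def h)
    next
      case (diff b c)
      have "frag_of (h b \<ominus>\<^bsub>N\<^esub> h c, x) - frag_of (h b, x) + frag_of (h c, x) \<in> ?K"
        using T.tensor_kernel_diff_left h diff value_in by simp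
      from T.tensor_kernel_diff[OF T.tensor_kernel_diff[OF diff(3,4)] this]
      show ?case using diff by (simp add: p_def frag_extend_diff h algebra_simps)
    next
      case (one c)
      then obtain n y where c: "c = (n, y)" "n \<in> carrier N" "y \<in> I" by auto
      show ?case
        using T.tensor_kernel_uminus[OF T.tensor_kernel_smult[of "\<phi> y" n x]] c \<phi>(1)[of y] value_in
        by (simp add: p_def h trace_swap[OF I value_in, of y])
    qed
    have "f (h z) = f \<zero>\<^bsub>N\<^esub>" using fh[OF z] kill f0 by simp
    then have "h z = \<zero>\<^bsub>N\<^esub>" using inj h(4)[OF z] by (simp add: inj_on_def)
    then show ?case
      using ph[OF z] T.tensor_kernel_zero_left value_in(2) T.tensor_kernel_congr by simp
  next
    case (add_in v w)
    have "p (v \<oplus> w) z - p v z - p w z \<in> ?K"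
      using z
    proof (induction rule: free_Abelian_group_induct[consumes 1, case_names zero diff one])
      case zero then show ?case by (simp add: p_def T.tensor_kernel_zero)
    next
      case (diff b c)
      from T.tensor_kernel_diff[OF diff(3,4)] show ?case
        by (simp add: p_def frag_extend_diff algebra_simps)
    next
      case (one c)
      then obtain n y where c: "c = (n, y)" "n \<in> carrier N" "y \<in> I" by auto
      have "v \<in> carrier R" "w \<in> carrier R" using add_in trace_ideal_carrier[OF I] by auto
      then show ?case using T.tensor_kernel_add_right[of n "v \<otimes> y" "w \<otimes> y"] c
        by (simp add: p_def l_distr I.I_l_closed)
    qed
    from T.tensor_kernel_add[OF T.tensor_kernel_add[OF this add_in.IH(1)] add_in.IH(2)]
    show ?case by simp
  qed
  moreover have "p w z = z"
  proof -
    have "p w z = frag_extend frag_of z"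
      unfolding p_def by (rule frag_extend_eq) (use z w(2) in auto)
    then show ?thesis using frag_expansion[of z] by simp
  qed
  ultimately show ?case by simp
qed

end

section \<open>Finitely generated flat ideals\<close>

text \<open>For regular \<open>q\<close> in \<open>I\<close> this is \<open>q\<close> times the
  inverse fractional ideal of \<open>I\<close>; its members \<open>r\<close> give the linear forms
  \<open>x \<mapsto> r x / q\<close> on \<open>I\<close>.\<close>

definition colon :: "('a, 'm) ring_scheme \<Rightarrow> 'a \<Rightarrow> 'a set \<Rightarrow> 'a set" where
  "colon R q I = {r \<in> carrier R. \<forall>x\<in>I. \<exists>t\<in>carrier R. r \<otimes>\<^bsub>R\<^esub> x = q \<otimes>\<^bsub>R\<^esub> t}"

lemma colonI:
  "r \<in> carrier R \<Longrightarrow> (\<And>x. x \<in> I \<Longrightarrow> \<exists>t\<in>carrier R. r \<otimes>\<^bsub>R\<^esub> x = q \<otimes>\<^bsub>R\<^esub> t) \<Longrightarrow> r \<in> colon R q I"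
  by (simp add: colon_def)

lemma colonE:
  assumes "r \<in> colon R q I" "x \<in> I"
  obtains t where "t \<in> carrier R" "r \<otimes>\<^bsub>R\<^esub> x = q \<otimes>\<^bsub>R\<^esub> t"
  using assms unfolding colon_def by blast

lemma colon_carrier: "r \<in> colon R q I \<Longrightarrow> r \<in> carrier R"
  by (simp add: colon_def)

text \<open>The quotient of \<open>M\<close> by the relation of having the same value under
  \<open>p\<close>, with these values as the classes. Thus \<open>p\<close> decides in which type
  the quotient lives, and a quotient whose classes are among those of another can be included in it
  by the identity function.\<close>

definition image_module ::
    "('a, 'm) ring_scheme \<Rightarrow> ('a, 'b) module \<Rightarrow> ('b \<Rightarrow> 'c) \<Rightarrow> ('a, 'c) module" where
  "image_module R M p =
     \<lparr>carrier = p ` carrier M, monoid.mult = (\<lambda>_ _. p \<zero>\<^bsub>M\<^esub>), monoid.one = p \<zero>\<^bsub>M\<^esub>, ring.zero = p \<zero>\<^bsub>M\<^esub>,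
      ring.add = (\<lambda>A B. p (inv_into (carrier M) p A \<oplus>\<^bsub>M\<^esub> inv_into (carrier M) p B)),
      smult = (\<lambda>a A. p (a \<odot>\<^bsub>M\<^esub> inv_into (carrier M) p A))\<rparr>"

locale module_congruence = module R M for R :: "('a, 'm) ring_scheme" and M :: "('a, 'b) module" +
  fixes p :: "'b \<Rightarrow> 'c"
  assumes cong_add: "\<And>x x' y y'. x \<in> carrier M \<Longrightarrow> x' \<in> carrier M \<Longrightarrow> y \<in> carrier M \<Longrightarrow> y' \<in> carrier M \<Longrightarrow>
      p x = p x' \<Longrightarrow> p y = p y' \<Longrightarrow> p (x \<oplus>\<^bsub>M\<^esub> y) = p (x' \<oplus>\<^bsub>M\<^esub> y')"
    and cong_smult: "\<And>a x x'. a \<in> carrier R \<Longrightarrow> x \<in> carrier M \<Longrightarrow> x' \<in> carrier M \<Longrightarrow>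
      p x = p x' \<Longrightarrow> p (a \<odot>\<^bsub>M\<^esub> x) = p (a \<odot>\<^bsub>M\<^esub> x')"
begin

abbreviation "Q \<equiv> image_module R M p"

lemma image_simps:
  "carrier Q = p ` carrier M" "\<zero>\<^bsub>Q\<^esub> = p \<zero>\<^bsub>M\<^esub>"
  by (simp_all add: image_module_def)

lemma image_add: "x \<in> carrier M \<Longrightarrow> y \<in> carrier M \<Longrightarrow> p x \<oplus>\<^bsub>Q\<^esub> p y = p (x \<oplus>\<^bsub>M\<^esub> y)"
  unfolding image_module_def by (simp, rule cong_add) (auto intro: inv_into_into f_inv_into_f)

lemma image_smult: "a \<in> carrier R \<Longrightarrow> x \<in> carrier M \<Longrightarrow> a \<odot>\<^bsub>Q\<^esub> p x = p (a \<odot>\<^bsub>M\<^esub> x)"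
  unfolding image_module_def by (simp, rule cong_smult) (auto intro: inv_into_into f_inv_into_f)

lemma module_image: "module R Q"
proof (rule moduleI)
  show "abelian_group Q"
  proof (rule abelian_groupI)
    fix A assume "A \<in> carrier Q"
    then obtain x where x: "x \<in> carrier M" "A = p x" by (auto simp: image_simps)
    then show "\<exists>B\<in>carrier Q. B \<oplus>\<^bsub>Q\<^esub> A = \<zero>\<^bsub>Q\<^esub>"
      by (intro bexI[of _ "p (\<ominus>\<^bsub>M\<^esub> x)"]) (auto simp: image_simps image_add M.l_neg)
  qed (auto simp: image_simps image_add M.a_ac)
qed (auto simp: image_simps image_add image_smult R.is_cring smult_l_distr smult_r_distr smult_assoc1)

end

text \<open>Infinite sequences in place of a finite power of \<open>R\<close>, so that no length has
  to be carried along; the vectors used later come from finitely many generators padded by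
  zeros.\<close>

definition function_module :: "('a, 'm) ring_scheme \<Rightarrow> ('a, nat \<Rightarrow> 'a) module" where
  "function_module R =
     \<lparr>carrier = {g. \<forall>j. g j \<in> carrier R}, monoid.mult = (\<lambda>g h j. g j \<otimes>\<^bsub>R\<^esub> h j),
      monoid.one = (\<lambda>j. \<one>\<^bsub>R\<^esub>), ring.zero = (\<lambda>j. \<zero>\<^bsub>R\<^esub>), ring.add = (\<lambda>g h j. g j \<oplus>\<^bsub>R\<^esub> h j),
      smult = (\<lambda>a g j. a \<otimes>\<^bsub>R\<^esub> g j)\<rparr>"

text \<open>The class of \<open>g\<close> modulo \<open>Q\<close> in each coordinate, as a set of
  sequences; this is the type over which \<open>flat_module\<close> quantifies.\<close>

definition residues_mod :: "('a, 'm) ring_scheme \<Rightarrow> 'a set \<Rightarrow> (nat \<Rightarrow> 'a) \<Rightarrow> (nat \<Rightarrow> 'a) set" where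
  "residues_mod R Q g = {h. \<forall>j. h j \<in> carrier R \<and> h j \<ominus>\<^bsub>R\<^esub> g j \<in> Q}"

lemma function_module_simps [simp]:
  "carrier (function_module R) = {g. \<forall>j. g j \<in> carrier R}" "\<zero>\<^bsub>function_module R\<^esub> = (\<lambda>j. \<zero>\<^bsub>R\<^esub>)"
  "g \<oplus>\<^bsub>function_module R\<^esub> h = (\<lambda>j. g j \<oplus>\<^bsub>R\<^esub> h j)" "a \<odot>\<^bsub>function_module R\<^esub> g = (\<lambda>j. a \<otimes>\<^bsub>R\<^esub> g j)"
  by (simp_all add: function_module_def)

context cring begin

lemma module_function_module: "module R (function_module R)"
proof (rule moduleI)
  show "abelian_group (function_module R)"
  proof (rule abelian_groupI)
    fix g assume "g \<in> carrier (function_module R)"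
    then show "\<exists>h\<in>carrier (function_module R). h \<oplus>\<^bsub>function_module R\<^esub> g = \<zero>\<^bsub>function_module R\<^esub>"
      by (intro bexI[of _ "\<lambda>j. \<ominus> g j"]) (auto simp: l_neg)
  qed (auto simp: a_ac)
qed (auto simp: is_cring l_distr r_distr m_assoc)

lemma residues_mod_eq_iff:
  assumes "ideal Q R" and g: "\<And>j. g j \<in> carrier R" and h: "\<And>j. h j \<in> carrier R"
  shows "residues_mod R Q g = residues_mod R Q h \<longleftrightarrow> (\<forall>j. g j \<ominus> h j \<in> Q)"
proof
  interpret Q: ideal Q R by fact
  assume "residues_mod R Q g = residues_mod R Q h"
  moreover have "g \<in> residues_mod R Q g"
    using g by (simp add: residues_mod_def minus_eq r_neg)
  ultimately show "\<forall>j. g j \<ominus> h j \<in> Q" by (auto simp: residues_mod_def)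
next
  interpret Q: ideal Q R by fact
  assume gh: "\<forall>j. g j \<ominus> h j \<in> Q"
  have "u j \<ominus> h j = (u j \<ominus> g j) \<oplus> (g j \<ominus> h j)" "u j \<ominus> g j = (u j \<ominus> h j) \<ominus> (g j \<ominus> h j)"
    if "u j \<in> carrier R" for u j
    using that g[of j] h[of j] by algebra+
  then show "residues_mod R Q g = residues_mod R Q h"
    using gh by (auto simp: residues_mod_def) (metis Q.closed_simps(2), metis Q.closed_simps(3))
qed

lemma residues_mod_congruence:
  assumes "ideal Q R"
  shows "module_congruence R (function_module R) (residues_mod R Q)"
proof -
  interpret Q: ideal Q R by fact
  interpret F: module R "function_module R" by (rule module_function_module)
  show ?thesis
  proof
    fix x x' y y'
    assume c: "x \<in> carrier (function_module R)" "x' \<in> carrier (function_module R)"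
      "y \<in> carrier (function_module R)" "y' \<in> carrier (function_module R)"
      and e: "residues_mod R Q x = residues_mod R Q x'" "residues_mod R Q y = residues_mod R Q y'"
    have "(x j \<oplus> y j) \<ominus> (x' j \<oplus> y' j) = (x j \<ominus> x' j) \<oplus> (y j \<ominus> y' j)" for j
    proof -
      have "x j \<in> carrier R" "x' j \<in> carrier R" "y j \<in> carrier R" "y' j \<in> carrier R" using c by auto
      then show ?thesis by algebra
    qed
    then show "residues_mod R Q (x \<oplus>\<^bsub>function_module R\<^esub> y) = residues_mod R Q (x' \<oplus>\<^bsub>function_module R\<^esub> y')"
      using c e assms by (simp add: residues_mod_eq_iff)
  next
    fix a x x'
    assume c: "a \<in> carrier R" "x \<in> carrier (function_module R)" "x' \<in> carrier (function_module R)"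
      and e: "residues_mod R Q x = residues_mod R Q x'"
    have "a \<otimes> x j \<ominus> a \<otimes> x' j = a \<otimes> (x j \<ominus> x' j)" for j
    proof -
      have "x j \<in> carrier R" "x' j \<in> carrier R" using c by auto
      with c(1) show ?thesis by algebra
    qed
    then show "residues_mod R Q (a \<odot>\<^bsub>function_module R\<^esub> x) = residues_mod R Q (a \<odot>\<^bsub>function_module R\<^esub> x')"
      using c e assms by (simp add: residues_mod_eq_iff Q.I_l_closed)
  qed
qed

section \<open>Colon ideals and the flatness test\<close>

lemma colon_ideal:
  assumes I: "I \<subseteq> carrier R" and q: "q \<in> carrier R"
  shows "ideal (colon R q I) R"
proof (rule idealI')
  show "\<zero> \<in> colon R q I"
    by (rule colonI) (use q I in \<open>auto intro!: bexI[of _ \<zero>]\<close>)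
  fix r s assume r: "r \<in> colon R q I" and s: "s \<in> colon R q I"
  show "r \<oplus> s \<in> colon R q I"
  proof (rule colonI)
    fix x assume x: "x \<in> I"
    obtain t where t: "t \<in> carrier R" "r \<otimes> x = q \<otimes> t" using r x by (rule colonE)
    obtain u where u: "u \<in> carrier R" "s \<otimes> x = q \<otimes> u" using s x by (rule colonE)
    show "\<exists>t\<in>carrier R. (r \<oplus> s) \<otimes> x = q \<otimes> t"
      using t u x I q colon_carrier[OF r] colon_carrier[OF s]
      by (intro bexI[of _ "t \<oplus> u"]) (auto simp: l_distr r_distr)
  qed (use colon_carrier[OF r] colon_carrier[OF s] in simp)
next
  fix a r assume a: "a \<in> carrier R" and r: "r \<in> colon R q I"
  show "a \<otimes> r \<in> colon R q I"
  proof (rule colonI)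
    fix x assume x: "x \<in> I"
    obtain t where t: "t \<in> carrier R" "r \<otimes> x = q \<otimes> t" using r x by (rule colonE)
    show "\<exists>t\<in>carrier R. (a \<otimes> r) \<otimes> x = q \<otimes> t"
      using a t x I q colon_carrier[OF r]
      by (intro bexI[of _ "a \<otimes> t"]) (auto simp: m_assoc m_lcomm)
  qed (use a colon_carrier[OF r] in simp)
qed (auto simp: colon_carrier)

lemma multiples_ideal:
  assumes "q \<in> carrier R" shows "ideal {q \<otimes> t |t. t \<in> carrier R} R"
proof -
  have "{q \<otimes> t |t. t \<in> carrier R} = PIdl q" 
    unfolding cgenideal_def by (intro Collect_cong ex_cong1) (use assms m_comm[of q] in auto)
  then show ?thesis using cgenideal_ideal[OF assms] by simp
qed

text \<open>The element \<open>(x\<^sub>j)\<^sub>j \<otimes> q\<close> of \<open>(R/q)\<^sup>\<nat> \<otimes> I\<close> vanishes, because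
  \<open>e\<^sub>j x\<^sub>j \<otimes> q = e\<^sub>j \<otimes> q x\<^sub>j = q e\<^sub>j \<otimes> x\<^sub>j = 0\<close>.  By flatness it vanishes over the submodule generated by
  \<open>(x\<^sub>j)\<^sub>j\<close>, which is \<open>R/(q : I)\<close>.\<close>

lemma colon_prod_if_flat:
  assumes flat: "flat_module R (ring_module R I)" and fg: "finitely_generated_ideal R I"
    and q: "q \<in> I"
  shows "q \<in> I \<cdot> colon R q I"
proof -
  obtain S where S: "S \<subseteq> carrier R" "finite S" "I = Idl S"
    using fg unfolding finitely_generated_ideal_def by auto
  have I: "ideal I R" unfolding S(3) by (rule genideal_ideal[OF S(1)])
  interpret I: ideal I R by (rule I)
  have qR: "q \<in> carrier R" using q I.a_subset by auto
  have SI: "S \<subseteq> I" unfolding S(3) by (rule genideal_self[OF S(1)])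
  define Q where "Q = {q \<otimes> t |t. t \<in> carrier R}"
  have Q: "ideal Q R" unfolding Q_def by (rule multiples_ideal[OF qR])
  interpret Q: ideal Q R by (rule Q)
  obtain xs where xs: "set xs = S" using finite_list[OF S(2)] by blast
  \<comment> \<open>Padding with \<open>\<zero>\<close> is harmless:
    \<open>r \<otimes> \<zero>\<close> always lies in \<open>Q\<close>, so the conditions on all
    \<open>j\<close> in \<open>V_iff\<close> are conditions on the generators.\<close>
  define gen where "gen j = (if j < length xs then xs ! j else \<zero>)" for j
  have gen_zero: "gen j = \<zero>" if "\<not> j < length xs" for j using that by (simp add: gen_def)
  have gen_I: "gen j \<in> I" for j using xs SI nth_mem[of j xs] by (auto simp: gen_def)
  then have gen_R [simp]: "gen j \<in> carrier R" for j using I.a_subset by auto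
  let ?V = "colon R q I"
  have V: "ideal ?V R" by (rule colon_ideal[OF I.a_subset qR])
  interpret V: ideal ?V R by (rule V)
  have V_iff: "r \<in> ?V \<longleftrightarrow> (\<forall>j. r \<otimes> gen j \<in> Q)" if r: "r \<in> carrier R" for r
  proof
    assume "r \<in> ?V" then show "\<forall>j. r \<otimes> gen j \<in> Q"
      using colonE[OF _ gen_I] unfolding Q_def by blast
  next
    assume *: "\<forall>j. r \<otimes> gen j \<in> Q"
    have "ideal {x \<in> carrier R. r \<otimes> x \<in> Q} R"
      by (rule idealI') (use r in \<open>auto simp: r_distr Q.I_l_closed m_lcomm[of r]\<close>)
    moreover have "S \<subseteq> {x \<in> carrier R. r \<otimes> x \<in> Q}"
    proof
      fix s assume "s \<in> S"
      then obtain j where "j < length xs" "xs ! j = s" using xs by (metis in_set_conv_nth)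
      then have "gen j = s" by (simp add: gen_def)
      then show "s \<in> {x \<in> carrier R. r \<otimes> x \<in> Q}" using * gen_R[of j] by auto
    qed
    ultimately have "I \<subseteq> {x \<in> carrier R. r \<otimes> x \<in> Q}"
      unfolding S(3) by (rule genideal_minimal)
    then have "r \<otimes> x \<in> Q" if "x \<in> I" for x using that by blast
    then show "r \<in> ?V" using r unfolding Q_def by (intro colonI) blast+
  qed
  interpret c': module_congruence R "function_module R" "residues_mod R Q"
    by (rule residues_mod_congruence[OF Q])
  \<comment> \<open>The fibres of \<open>p\<close> are the cosets of \<open>(q : I)\<close>, so its
    image is \<open>R/(q : I)\<close>, sitting literally inside the quotient of sequences. Hence the
    identity function is the injective test map.\<close>
  define p where "p r = residues_mod R Q (\<lambda>j. r \<otimes> gen j)" for r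
  have p_eq: "p r = p s \<longleftrightarrow> r \<ominus> s \<in> ?V" if "r \<in> carrier R" "s \<in> carrier R" for r s
  proof -
    have "r \<otimes> gen j \<ominus> s \<otimes> gen j = (r \<ominus> s) \<otimes> gen j" for j
      using that gen_R[of j] by algebra
    then show ?thesis using that by (simp add: p_def residues_mod_eq_iff[OF Q] V_iff)
  qed
  interpret c: module_congruence R "ring_module R (carrier R)" p
  proof (intro module_congruence.intro module_self module_congruence_axioms.intro)
    fix x x' y y'
    assume c: "x \<in> carrier (ring_module R (carrier R))" "x' \<in> carrier (ring_module R (carrier R))"
      "y \<in> carrier (ring_module R (carrier R))" "y' \<in> carrier (ring_module R (carrier R))"
      and e: "p x = p x'" "p y = p y'"
    have "(x \<oplus> y) \<ominus> (x' \<oplus> y') = (x \<ominus> x') \<oplus> (y \<ominus> y')" using c by simp algebra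
    then show "p (x \<oplus>\<^bsub>ring_module R (carrier R)\<^esub> y) = p (x' \<oplus>\<^bsub>ring_module R (carrier R)\<^esub> y')"
      using c e by (simp add: p_eq)
  next
    fix a x x'
    assume c: "a \<in> carrier R" "x \<in> carrier (ring_module R (carrier R))" "x' \<in> carrier (ring_module R (carrier R))"
      and e: "p x = p x'"
    have "a \<otimes> x \<ominus> a \<otimes> x' = a \<otimes> (x \<ominus> x')" using c by simp algebra
    then show "p (a \<odot>\<^bsub>ring_module R (carrier R)\<^esub> x) = p (a \<odot>\<^bsub>ring_module R (carrier R)\<^esub> x')"
      using c e by (simp add: p_eq V.I_l_closed)
  qed
  let ?N = "image_module R (ring_module R (carrier R)) p"
  let ?N' = "image_module R (function_module R) (residues_mod R Q)"
  have hom: "(\<lambda>A. A) \<in> module_hom R ?N ?N'"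
  proof (rule module_homI)
    fix A assume "A \<in> carrier ?N"
    then obtain r where r: "r \<in> carrier R" "A = p r" by (auto simp: c.image_simps)
    then show "A \<in> carrier ?N'" by (auto simp: c'.image_simps p_def)
    fix B assume "B \<in> carrier ?N"
    then obtain s where s: "s \<in> carrier R" "B = p s" by (auto simp: c.image_simps)
    have "A \<oplus>\<^bsub>?N\<^esub> B = p (r \<oplus> s)" using r s c.image_add[of r s] by simp
    also have "\<dots> = A \<oplus>\<^bsub>?N'\<^esub> B"
      using r s c'.image_add[of "\<lambda>j. r \<otimes> gen j" "\<lambda>j. s \<otimes> gen j"] by (simp add: p_def l_distr)
    finally show "A \<oplus>\<^bsub>?N\<^esub> B = A \<oplus>\<^bsub>?N'\<^esub> B" .
  next
    fix a A assume a: "a \<in> carrier R" "A \<in> carrier ?N"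
    then obtain r where r: "r \<in> carrier R" "A = p r" by (auto simp: c.image_simps)
    have "a \<odot>\<^bsub>?N\<^esub> A = p (a \<otimes> r)" using a r c.image_smult[of a r] by simp
    also have "\<dots> = a \<odot>\<^bsub>?N'\<^esub> A"
      using a r c'.image_smult[of a "\<lambda>j. r \<otimes> gen j"] by (simp add: p_def m_assoc)
    finally show "a \<odot>\<^bsub>?N\<^esub> A = a \<odot>\<^bsub>?N'\<^esub> A" .
  qed
  interpret T: tensor_pair R ?N "ring_module R I"
    by (rule tensor_pair.intro[OF c.module_image module_ring_module[OF I]])
  interpret T': tensor_pair R ?N' "ring_module R I"
    by (rule tensor_pair.intro[OF c'.module_image module_ring_module[OF I]])
  let ?K' = "tensor_kernel R ?N' (ring_module R I)"
  have "frag_of (residues_mod R Q (\<lambda>j. if j < k then gen j else \<zero>), q) \<in> ?K'" for k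
  proof (induction k)
    case 0
    then show ?case using T'.tensor_kernel_zero_left[of q] q by (simp add: c'.image_simps)
  next
    case (Suc k)
    define E where "E = (\<lambda>j. if j = k then \<one> else \<zero>)"
    have ER [simp]: "E j \<in> carrier R" for j by (simp add: E_def)
    let ?r = "residues_mod R Q"
    let ?Y = "\<lambda>j. if j < k then gen j else \<zero>"
    have rc: "?r g \<in> carrier ?N'" if "\<And>j. g j \<in> carrier R" for g using that by (auto simp: c'.image_simps)
    have "?r (\<lambda>j. q \<otimes> E j) = \<zero>\<^bsub>?N'\<^esub>"
    proof -
      have "q \<otimes> E j \<ominus> \<zero> = q \<otimes> E j" for j using qR ER[of j] by (simp add: minus_eq)
      moreover have "q \<otimes> E j \<in> Q" for j unfolding Q_def using ER[of j] by blast
      ultimately have "q \<otimes> E j \<ominus> \<zero> \<in> Q" for j by simp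
      then show ?thesis using qR by (simp add: c'.image_simps residues_mod_eq_iff[OF Q])
    qed
    then have 1: "frag_of (?r (\<lambda>j. q \<otimes> E j), gen k) \<in> ?K'"
      using T'.tensor_kernel_zero_left gen_I by simp
    have 2: "frag_of (?r (\<lambda>j. q \<otimes> E j), gen k) - frag_of (?r E, q \<otimes> gen k) \<in> ?K'"
      using T'.tensor_kernel_smult[of q "?r E" "gen k"] qR gen_I rc c'.image_smult[of q E] by simp
    have 3: "frag_of (?r (\<lambda>j. gen k \<otimes> E j), q) - frag_of (?r E, q \<otimes> gen k) \<in> ?K'"
      using T'.tensor_kernel_smult[of "gen k" "?r E" q] q qR rc c'.image_smult[of "gen k" E] by (simp add: m_comm)
    have 4: "frag_of (?r (\<lambda>j. gen k \<otimes> E j), q) \<in> ?K'"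
      using 1 2 3 T'.tensor_kernel_congr by blast
    have "(\<lambda>j. if j < Suc k then gen j else \<zero>) = (\<lambda>j. ?Y j \<oplus> gen k \<otimes> E j)"
      by (auto simp: E_def less_Suc_eq)
    then have "frag_of (?r (\<lambda>j. if j < Suc k then gen j else \<zero>), q) - frag_of (?r ?Y, q)
        - frag_of (?r (\<lambda>j. gen k \<otimes> E j), q) \<in> ?K'"
      using T'.tensor_kernel_add_left[of "?r ?Y" "?r (\<lambda>j. gen k \<otimes> E j)" q] q rc
        c'.image_add[of ?Y "\<lambda>j. gen k \<otimes> E j"] by simp
    from T'.tensor_kernel_add[OF T'.tensor_kernel_add[OF this Suc] 4] show ?case by simp
  qed
  moreover have "p \<one> = residues_mod R Q (\<lambda>j. if j < length xs then gen j else \<zero>)"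
    unfolding p_def by (rule arg_cong[where f = "residues_mod R Q"]) (use gen_zero in \<open>auto simp: fun_eq_iff\<close>)
  ultimately have "frag_of (p \<one>, q) \<in> ?K'" by simp
  then have z: "frag_of (p \<one>, q) \<in> tensor_kernel R ?N (ring_module R I)"
    using flat[unfolded flat_module_iff, THEN conjunct2, rule_format, of ?N ?N' "\<lambda>A. A" "frag_of (p \<one>, q)"]
      c.module_image c'.module_image hom q by (auto simp: c.image_simps)
  let ?W = "I \<cdot> ?V"
  have W: "ideal ?W R" by (rule ideal_prod_is_ideal[OF I V])
  interpret W: ideal ?W R by (rule W)
  \<comment> \<open>The product \<open>rep A \<otimes> y\<close> is not bilinear in \<open>A\<close>
    and \<open>y\<close>, since the choice \<open>rep\<close> is not linear; but its errors lie in
    \<open>(q : I)\<close>, so it is bilinear modulo \<open>?W\<close>. The vanishing of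
    \<open>p \<one> \<otimes> q\<close> then puts \<open>rep (p \<one>) \<otimes> q\<close> into
    \<open>?W\<close>, and \<open>rep (p \<one>)\<close> differs from \<open>\<one>\<close> by a
    member of \<open>(q : I)\<close>.\<close>
  define rep where "rep A = inv_into (carrier R) p A" for A
  have rep: "rep A \<in> carrier R" "p (rep A) = A" if "A \<in> carrier ?N" for A
    using that unfolding rep_def by (auto simp: c.image_simps inv_into_into f_inv_into_f)
  obtain h where h: "\<And>A y. A \<in> carrier ?N \<Longrightarrow> y \<in> I \<Longrightarrow> h (frag_of (A, y)) = rep A \<otimes> y"
      "h 0 = \<zero>"
      "\<And>z w. Poly_Mapping.keys z \<subseteq> carrier ?N \<times> I \<Longrightarrow> Poly_Mapping.keys w \<subseteq> carrier ?N \<times> I \<Longrightarrow>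
        h (z - w) = h z \<ominus> h w"
      "\<And>z. Poly_Mapping.keys z \<subseteq> carrier ?N \<times> I \<Longrightarrow> h z \<in> carrier R"
    by (rule T.bilinear_lift[OF abelian_group_axioms, of "\<lambda>A y. rep A \<otimes> y", simplified])
      (use rep in auto)
  have W_mem: "v \<otimes> y \<in> ?W" if "v \<in> ?V" "y \<in> I" for v y
    using ideal_prod.prod[of y I v ?V R] that m_comm by (simp add: V.Icarr I.Icarr)
  have "h (frag_of (p \<one>, q)) \<in> ?W"
  proof (rule T.bilinear_kernel[where f = "\<lambda>A y. rep A \<otimes> y", OF _ abelian_group_axioms _ _ _ _ _ _ z])
    show "additive_subgroup ?W R" ..
  next
    fix A B y assume A: "A \<in> carrier ?N" and B: "B \<in> carrier ?N" and y: "y \<in> carrier (ring_module R I)"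
    have AB: "A \<oplus>\<^bsub>?N\<^esub> B = p (rep A \<oplus> rep B)"
      using c.image_add[of "rep A" "rep B"] rep A B by simp
    then have ABc: "A \<oplus>\<^bsub>?N\<^esub> B \<in> carrier ?N" using rep A B by (simp add: c.image_simps)
    then have "rep (A \<oplus>\<^bsub>?N\<^esub> B) \<ominus> (rep A \<oplus> rep B) \<in> ?V"
      using rep[OF ABc] rep A B AB by (subst p_eq[symmetric]) auto
    moreover have "rep (A \<oplus>\<^bsub>?N\<^esub> B) \<otimes> y \<ominus> rep A \<otimes> y \<ominus> rep B \<otimes> y =
        (rep (A \<oplus>\<^bsub>?N\<^esub> B) \<ominus> (rep A \<oplus> rep B)) \<otimes> y"
      using rep(1)[OF A] rep(1)[OF B] rep(1)[OF ABc] I.Icarr[OF y[simplified]] by algebra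
    ultimately show "rep (A \<oplus>\<^bsub>?N\<^esub> B) \<otimes> y \<ominus> rep A \<otimes> y \<ominus> rep B \<otimes> y \<in> ?W"
      using W_mem y by simp
  next
    fix A y y' assume "A \<in> carrier ?N" "y \<in> carrier (ring_module R I)" "y' \<in> carrier (ring_module R I)"
    then show "rep A \<otimes> (y \<oplus>\<^bsub>ring_module R I\<^esub> y') \<ominus> rep A \<otimes> y \<ominus> rep A \<otimes> y' \<in> ?W"
      using rep I.Icarr by (simp add: r_distr add_diff_self)
  next
    fix a A y assume a: "a \<in> carrier R" and A: "A \<in> carrier ?N" and y: "y \<in> carrier (ring_module R I)"
    have aA: "a \<odot>\<^bsub>?N\<^esub> A = p (a \<otimes> rep A)"
      using c.image_smult[of a "rep A"] rep A a by simp
    then have aAc: "a \<odot>\<^bsub>?N\<^esub> A \<in> carrier ?N" using rep A a by (simp add: c.image_simps)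
    then have "rep (a \<odot>\<^bsub>?N\<^esub> A) \<ominus> a \<otimes> rep A \<in> ?V"
      using rep[OF aAc] rep A a aA by (subst p_eq[symmetric]) auto
    moreover have "rep (a \<odot>\<^bsub>?N\<^esub> A) \<otimes> y \<ominus> rep A \<otimes> (a \<otimes> y) = (rep (a \<odot>\<^bsub>?N\<^esub> A) \<ominus> a \<otimes> rep A) \<otimes> y"
      using rep(1)[OF A] rep(1)[OF aAc] I.Icarr[OF y[simplified]] a by algebra
    ultimately show "rep (a \<odot>\<^bsub>?N\<^esub> A) \<otimes> y \<ominus> rep A \<otimes> (a \<odot>\<^bsub>ring_module R I\<^esub> y) \<in> ?W"
      using W_mem y by simp
  qed (use h in auto)
  moreover have p1: "p \<one> \<in> carrier ?N" by (simp add: c.image_simps)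
  ultimately have "rep (p \<one>) \<otimes> q \<in> ?W" using h q by simp
  moreover have "(rep (p \<one>) \<ominus> \<one>) \<otimes> q \<in> ?W"
    using p_eq[of "rep (p \<one>)" \<one>] rep[OF p1] q by (intro W_mem) auto
  ultimately have "rep (p \<one>) \<otimes> q \<ominus> (rep (p \<one>) \<ominus> \<one>) \<otimes> q \<in> ?W"
    by (rule W.closed_simps(3))
  moreover have "rep (p \<one>) \<otimes> q \<ominus> (rep (p \<one>) \<ominus> \<one>) \<otimes> q = q"
    using rep(1)[OF p1] qR by algebra
  ultimately show ?thesis by simp
qed

end

section \<open>Invertible ideals and generalized GCD rings\<close>

text \<open>Divided by \<open>q\<close>, the last condition says that \<open>\<one>\<close> lies in
  the product of \<open>I\<close> and its inverse. Demanding it for one regular \<open>q\<close>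
  suffices: \<open>invertible_ideal_any\<close> extends it to all members of
  \<open>I\<close>.\<close>

definition invertible_ideal :: "('a, 'm) ring_scheme \<Rightarrow> 'a set \<Rightarrow> bool" where
  "invertible_ideal R I \<longleftrightarrow>
     ideal I R \<and> (\<exists>q\<in>I. non_zero_divisor R q \<and> q \<in> I \<cdot>\<^bsub>R\<^esub> colon R q I)"

text \<open>The annihilator of \<open>a\<close> is generated by the complement of \<open>e\<close>:
  this complement kills \<open>a\<close>, and an \<open>x\<close> killed by \<open>a\<close> is
  killed by \<open>e\<close>, hence fixed by the complement.\<close>

definition rickart_ring :: "('a, 'm) ring_scheme \<Rightarrow> bool" where
  "rickart_ring R \<longleftrightarrow> cring R \<and> (\<forall>a\<in>carrier R. \<exists>e\<in>carrier R. e \<otimes>\<^bsub>R\<^esub> e = e \<and> e \<otimes>\<^bsub>R\<^esub> a = a \<and>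
     (\<forall>x\<in>carrier R. a \<otimes>\<^bsub>R\<^esub> x = \<zero>\<^bsub>R\<^esub> \<longrightarrow> e \<otimes>\<^bsub>R\<^esub> x = \<zero>\<^bsub>R\<^esub>))"

lemma ideal_prod_map:
  assumes "w \<in> I \<cdot>\<^bsub>R\<^esub> J"
    and "\<And>i j. i \<in> I \<Longrightarrow> j \<in> J \<Longrightarrow> f (i \<otimes>\<^bsub>R\<^esub> j) \<in> I' \<cdot>\<^bsub>R'\<^esub> J'"
    and "\<And>a b. a \<in> I \<cdot>\<^bsub>R\<^esub> J \<Longrightarrow> b \<in> I \<cdot>\<^bsub>R\<^esub> J \<Longrightarrow> f (a \<oplus>\<^bsub>R\<^esub> b) = f a \<oplus>\<^bsub>R'\<^esub> f b"
  shows "f w \<in> I' \<cdot>\<^bsub>R'\<^esub> J'"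
  using assms(1) by induction (simp_all add: assms(2,3) ideal_prod.sum)

context cring begin

lemma nonzero_divisor_carrier: "non_zero_divisor R c \<Longrightarrow> c \<in> carrier R"
  by (simp add: non_zero_divisor_def)

lemma nonzero_divisor_cancel:
  assumes c: "non_zero_divisor R c" and x: "x \<in> carrier R" "y \<in> carrier R" "c \<otimes> x = c \<otimes> y"
  shows "x = y"
proof -
  have cR: "c \<in> carrier R" using c by (rule nonzero_divisor_carrier)
  have "c \<otimes> (x \<ominus> y) = c \<otimes> x \<ominus> c \<otimes> y" using cR x(1,2) by algebra
  then have "c \<otimes> (x \<ominus> y) = \<zero>" using x cR by (simp add: minus_eq r_neg)
  moreover have "x \<ominus> y \<in> carrier R" using x by simp
  ultimately have "x \<ominus> y = \<zero>" using c unfolding non_zero_divisor_def by blast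
  then show ?thesis using x by (simp add: r_right_minus_eq)
qed

lemma nonzero_divisor_mult:
  assumes "non_zero_divisor R a" "non_zero_divisor R b" shows "non_zero_divisor R (a \<otimes> b)"
  unfolding non_zero_divisor_def
proof (intro conjI ballI impI)
  have c: "a \<in> carrier R" "b \<in> carrier R" using assms nonzero_divisor_carrier by auto
  then show "a \<otimes> b \<in> carrier R" by simp
  fix x assume x: "x \<in> carrier R" "a \<otimes> b \<otimes> x = \<zero>"
  then have "a \<otimes> (b \<otimes> x) = \<zero>" using c by (simp add: m_assoc)
  then have "b \<otimes> x = \<zero>" using assms(1) c x unfolding non_zero_divisor_def by blast
  then show "x = \<zero>" using assms(2) x unfolding non_zero_divisor_def by blast
qed

lemma nonzero_divisor_factor:
  assumes "non_zero_divisor R (a \<otimes> b)" "a \<in> carrier R" "b \<in> carrier R" shows "non_zero_divisor R b"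
  unfolding non_zero_divisor_def
proof (intro conjI ballI impI)
  fix x assume x: "x \<in> carrier R" "b \<otimes> x = \<zero>"
  then have "a \<otimes> b \<otimes> x = \<zero>" using assms(2,3) by (simp add: m_assoc)
  then show "x = \<zero>" using assms(1) x unfolding non_zero_divisor_def by blast
qed (rule assms(3))

lemma invertible_idealI:
  "ideal I R \<Longrightarrow> q \<in> I \<Longrightarrow> non_zero_divisor R q \<Longrightarrow> q \<in> I \<cdot> colon R q I \<Longrightarrow> invertible_ideal R I"
  by (auto simp: invertible_ideal_def)

lemma ideal_prod_colon_multiple:
  assumes I: "ideal I R" and q: "q \<in> carrier R" and w: "w \<in> I \<cdot> colon R q I"
  shows "\<exists>t\<in>carrier R. w = q \<otimes> t"
  using w
proof induction
  case (prod i j)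
  interpret I: ideal I R by fact
  obtain t where "t \<in> carrier R" "j \<otimes> i = q \<otimes> t" using prod(2,1) by (rule colonE)
  then show ?case using prod m_comm[of i j] colon_carrier[OF prod(2)] I.Icarr by metis
next
  case (sum s1 s2)
  then obtain t u where "t \<in> carrier R" "s1 = q \<otimes> t" "u \<in> carrier R" "s2 = q \<otimes> u" by blast
  then show ?case using q by (intro bexI[of _ "t \<oplus> u"]) (simp_all add: r_distr)
qed

text \<open>A cofactor \<open>j\<close> in \<open>(q : I)\<close> gives the linear form
  \<open>y \<mapsto> j y / q\<close>, whose value at \<open>i\<close> is \<open>i j / q\<close>.
  Regularity of \<open>q\<close> makes the quotient unique, so the choice in \<open>\<phi>\<close>
  is linear and a sum can be divided term by term.\<close>

lemma trace_ideal_if_prod_colon: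
  assumes I: "ideal I R" and q: "non_zero_divisor R q" and w: "p \<in> I \<cdot> colon R q I"
    "w \<in> carrier R" "p = q \<otimes> w"
  shows "w \<in> trace_ideal R I"
  using w
proof (induction arbitrary: w)
  case (prod i j)
  interpret I: ideal I R by fact
  have qR: "q \<in> carrier R" using q by (rule nonzero_divisor_carrier)
  have jR: "j \<in> carrier R" using prod(2) by (rule colon_carrier)
  define \<phi> where "\<phi> y = (SOME t. t \<in> carrier R \<and> j \<otimes> y = q \<otimes> t)" for y
  have \<phi>: "\<phi> y \<in> carrier R \<and> j \<otimes> y = q \<otimes> \<phi> y" if y: "y \<in> I" for y
    unfolding \<phi>_def
  proof (rule someI_ex)
    obtain t where "t \<in> carrier R" "j \<otimes> y = q \<otimes> t" using prod(2) y by (rule colonE)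
    then show "\<exists>t. t \<in> carrier R \<and> j \<otimes> y = q \<otimes> t" by blast
  qed
  have \<phi>_eq: "\<phi> y = t" if "y \<in> I" "t \<in> carrier R" "j \<otimes> y = q \<otimes> t" for y t
    by (rule nonzero_divisor_cancel[OF q]) (use \<phi>[OF that(1)] that in simp_all)
  have "\<phi> \<in> module_hom R (ring_module R I) (ring_module R (carrier R))"
  proof (rule module_homI)
    fix x y assume "x \<in> carrier (ring_module R I)" "y \<in> carrier (ring_module R I)"
    then have xy: "x \<in> I" "y \<in> I" by auto
    show "\<phi> (x \<oplus>\<^bsub>ring_module R I\<^esub> y) = \<phi> x \<oplus>\<^bsub>ring_module R (carrier R)\<^esub> \<phi> y"
      using xy \<phi>[OF xy(1)] \<phi>[OF xy(2)] I.Icarr jR qR by (auto simp: r_distr intro!: \<phi>_eq)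
  next
    fix a x assume "a \<in> carrier R" "x \<in> carrier (ring_module R I)"
    then have ax: "a \<in> carrier R" "x \<in> I" by auto
    have "j \<otimes> (a \<otimes> x) = a \<otimes> (j \<otimes> x)" using ax jR I.Icarr by (simp add: m_lcomm)
    also have "\<dots> = q \<otimes> (a \<otimes> \<phi> x)" using ax qR \<phi>[OF ax(2)] by (simp add: m_lcomm)
    finally show "\<phi> (a \<odot>\<^bsub>ring_module R I\<^esub> x) = a \<odot>\<^bsub>ring_module R (carrier R)\<^esub> \<phi> x"
      using ax \<phi>[OF ax(2)] by (auto intro!: \<phi>_eq I.I_l_closed)
  qed (use \<phi> in auto)
  from trace_ideal.value_in[OF this prod(1)]
  show ?case using \<phi>_eq[of i w] prod m_comm[of i j] I.Icarr jR by simp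
next
  case (sum s1 s2)
  have qR: "q \<in> carrier R" using q by (rule nonzero_divisor_carrier)
  obtain t u where t: "t \<in> carrier R" "s1 = q \<otimes> t" and u: "u \<in> carrier R" "s2 = q \<otimes> u"
    using ideal_prod_colon_multiple[OF I qR] sum(1,2) by meson
  have "t \<oplus> u = w"
    by (rule nonzero_divisor_cancel[OF q]) (use t u sum qR in \<open>auto simp: r_distr\<close>)
  then show ?case using trace_ideal.add_in[OF sum(3)[OF t] sum(4)[OF u]] by simp
qed

lemma one_in_trace_ideal:
  assumes "invertible_ideal R I" shows "\<one> \<in> trace_ideal R I"
proof -
  obtain q where "ideal I R" "q \<in> I" "non_zero_divisor R q" "q \<in> I \<cdot> colon R q I"
    using assms by (auto simp: invertible_ideal_def)
  then show ?thesis
    using trace_ideal_if_prod_colon[of I q q \<one>] nonzero_divisor_carrier by simp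
qed

lemma ideal_scale:
  assumes "ideal I R" "s \<in> carrier R" shows "ideal ((\<lambda>x. s \<otimes> x) ` I) R"
proof -
  interpret I: ideal I R by fact
  show ?thesis
  proof (rule idealI')
    show "\<zero> \<in> (\<lambda>x. s \<otimes> x) ` I" using assms(2) by (intro image_eqI[of _ _ \<zero>]) auto
  next
    fix x y assume "x \<in> (\<lambda>x. s \<otimes> x) ` I" "y \<in> (\<lambda>x. s \<otimes> x) ` I"
    then obtain x' y' where "x' \<in> I" "y' \<in> I" "x = s \<otimes> x'" "y = s \<otimes> y'" by blast
    then show "x \<oplus> y \<in> (\<lambda>x. s \<otimes> x) ` I"
      using assms(2) I.Icarr by (intro image_eqI[of _ _ "x' \<oplus> y'"]) (auto simp: r_distr)
  next
    fix a x assume "a \<in> carrier R" "x \<in> (\<lambda>x. s \<otimes> x) ` I"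
    then obtain x' where "x' \<in> I" "x = s \<otimes> x'" "a \<in> carrier R" by blast
    then show "a \<otimes> x \<in> (\<lambda>x. s \<otimes> x) ` I"
      using assms(2) I.Icarr I.I_l_closed by (intro image_eqI[of _ _ "a \<otimes> x'"]) (auto simp: m_lcomm)
  qed (use assms I.Icarr in auto)
qed

text \<open>The ideal \<open>s I\<close> lies inside \<open>I\<close>, so a linear form on
  \<open>I\<close> restricts to it, and at \<open>s x\<close> it takes the value
  \<open>s \<phi> x\<close>.\<close>

lemma trace_ideal_scale:
  assumes I: "ideal I R" and s: "s \<in> carrier R" and w: "w \<in> trace_ideal R I"
  shows "s \<otimes> w \<in> trace_ideal R ((\<lambda>x. s \<otimes> x) ` I)"
  using w
proof induction
  case (value_in \<phi> x)
  interpret I: ideal I R by fact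
  have "\<phi> \<in> module_hom R (ring_module R ((\<lambda>x. s \<otimes> x) ` I)) (ring_module R (carrier R))"
  proof -
    have "x \<in> I" if "x \<in> (\<lambda>x. s \<otimes> x) ` I" for x using that s I.I_l_closed by blast
    then show ?thesis using module_homD[OF value_in(1)] by (intro module_homI) simp_all
  qed
  from trace_ideal.value_in[OF this imageI[OF value_in(2)]]
  show ?case using module_homD(3)[OF value_in(1), of s x] s value_in(2) by simp
next
  case (add_in v w)
  then show ?case
    using trace_ideal.add_in[OF add_in(3,4)] s trace_ideal_carrier[OF I] by (simp add: r_distr)
qed

text \<open>The idempotent lies in the trace ideal of \<open>e I\<close>, because
  \<open>\<one>\<close> lies in that of \<open>I\<close>, and it acts on \<open>e I\<close> as the
  identity. Through these ideals, which need not contain regular elements, flat ideals are recovered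
  from invertible ones.\<close>

lemma idempotent_scale_flat:
  assumes I: "invertible_ideal R I" and e: "e \<in> carrier R" "e \<otimes> e = e"
  shows "finitely_generated_ideal R ((\<lambda>x. e \<otimes> x) ` I)"
    and "flat_module R (ring_module R ((\<lambda>x. e \<otimes> x) ` I))"
proof -
  have id: "ideal I R" using I by (simp add: invertible_ideal_def)
  interpret I: ideal I R by (rule id)
  have "e \<in> trace_ideal R ((\<lambda>x. e \<otimes> x) ` I)"
    using trace_ideal_scale[OF id e(1) one_in_trace_ideal[OF I]] e by simp
  moreover have "e \<otimes> y = y" if "y \<in> (\<lambda>x. e \<otimes> x) ` I" for y
    using that e I.Icarr by (auto simp: m_assoc[symmetric])
  ultimately show "finitely_generated_ideal R ((\<lambda>x. e \<otimes> x) ` I)"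
    and "flat_module R (ring_module R ((\<lambda>x. e \<otimes> x) ` I))"
    using finitely_generated_if_trace flat_if_trace ideal_scale[OF id e(1)] by blast+
qed

lemma invertible_flat:
  assumes I: "invertible_ideal R I"
  shows "finitely_generated_ideal R I" and "flat_module R (ring_module R I)"
proof -
  have "ideal I R" using I by (simp add: invertible_ideal_def)
  then interpret I: ideal I R .
  have "(\<lambda>x. \<one> \<otimes> x) ` I = I" using I.Icarr by (force simp: image_iff)
  then show "finitely_generated_ideal R I" and "flat_module R (ring_module R I)"
    using idempotent_scale_flat[OF I one_closed] by simp_all
qed

text \<open>The detour through flatness is the point: the flatness test asks no regularity of
  \<open>p\<close>, so the witness may be exchanged for any element of the ideal.\<close>

lemma invertible_ideal_any:
  assumes I: "invertible_ideal R I" and p: "p \<in> I"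
  shows "p \<in> I \<cdot> colon R p I"
proof -
  have "ideal I R" using I by (simp add: invertible_ideal_def)
  then interpret I: ideal I R .
  show ?thesis
    by (rule colon_prod_if_flat[OF invertible_flat(2,1)[OF I] p])
qed

text \<open>Scaling \<open>q\<close> and \<open>I\<close> by the same regular \<open>s\<close>
  leaves \<open>(q : I)\<close> unchanged, so decompositions of \<open>q\<close> and of
  \<open>s q\<close> correspond. This takes the place of calculations with fractional
  ideals.\<close>

lemma invertible_ideal_scale_iff:
  assumes I: "ideal I R" and s: "non_zero_divisor R s"
  shows "invertible_ideal R ((\<lambda>x. s \<otimes> x) ` I) \<longleftrightarrow> invertible_ideal R I"
proof -
  interpret I: ideal I R by (rule I)
  let ?sI = "(\<lambda>x. s \<otimes> x) ` I"
  have sR: "s \<in> carrier R" using s by (rule nonzero_divisor_carrier)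
  have colon_eq: "colon R (s \<otimes> q) ?sI = colon R q I" if q: "q \<in> I" for q
  proof (intro equalityI subsetI)
    fix v assume v: "v \<in> colon R q I"
    show "v \<in> colon R (s \<otimes> q) ?sI"
    proof (rule colonI)
      fix x assume "x \<in> ?sI"
      then obtain y where y: "y \<in> I" "x = s \<otimes> y" by blast
      obtain t where t: "t \<in> carrier R" "v \<otimes> y = q \<otimes> t" using v y(1) by (rule colonE)
      then show "\<exists>t\<in>carrier R. v \<otimes> x = s \<otimes> q \<otimes> t"
        using y sR q I.Icarr colon_carrier[OF v] by (intro bexI[of _ t]) (auto simp: m_assoc m_lcomm[of v])
    qed (rule colon_carrier[OF v])
  next
    fix v assume v: "v \<in> colon R (s \<otimes> q) ?sI"
    have vR: "v \<in> carrier R" using v by (rule colon_carrier)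
    show "v \<in> colon R q I"
    proof (rule colonI)
      fix y assume y: "y \<in> I"
      obtain t where t: "t \<in> carrier R" "v \<otimes> (s \<otimes> y) = (s \<otimes> q) \<otimes> t" using v imageI[OF y] by (rule colonE)
      have "s \<otimes> (v \<otimes> y) = s \<otimes> (q \<otimes> t)" using t y q vR sR I.Icarr by (simp add: m_assoc m_lcomm[of v])
      then have "v \<otimes> y = q \<otimes> t"
        by (rule nonzero_divisor_cancel[OF s, rotated 2]) (use t y q vR I.Icarr in auto)
      then show "\<exists>t\<in>carrier R. v \<otimes> y = q \<otimes> t" using t by blast
    qed (rule vR)
  qed
  have colon_id: "ideal (colon R q I) R" if "q \<in> I" for q
    using colon_ideal[OF I.a_subset I.Icarr[OF that]] .
  show ?thesis
  proof
    assume inv: "invertible_ideal R I"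
    then obtain q where q: "q \<in> I" "non_zero_divisor R q" "q \<in> I \<cdot> colon R q I"
      by (auto simp: invertible_ideal_def)
    have "s \<otimes> q \<in> ?sI \<cdot> colon R (s \<otimes> q) ?sI"
      unfolding colon_eq[OF q(1)]
    proof (rule ideal_prod_map[where f = "\<lambda>x. s \<otimes> x", OF q(3)])
      fix i j assume ij: "i \<in> I" "j \<in> colon R q I"
      then show "s \<otimes> (i \<otimes> j) \<in> ?sI \<cdot> colon R q I"
        using ideal_prod.prod[OF imageI[OF ij(1), of "\<lambda>x. s \<otimes> x"] ij(2), of R] sR I.Icarr
          colon_carrier[OF ij(2)] by (simp add: m_assoc)
    next
      fix a b assume "a \<in> I \<cdot> colon R q I" "b \<in> I \<cdot> colon R q I"
      then have "a \<in> carrier R" "b \<in> carrier R"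
        using ideal_prod_in_carrier[OF I colon_id[OF q(1)]] by blast+
      then show "s \<otimes> (a \<oplus> b) = s \<otimes> a \<oplus> s \<otimes> b" using sR by (simp add: r_distr)
    qed
    then show "invertible_ideal R ?sI"
      using invertible_idealI[OF ideal_scale[OF I sR], of "s \<otimes> q"] q nonzero_divisor_mult[OF s q(2)] by blast
  next
    assume "invertible_ideal R ?sI"
    then obtain q' where "q' \<in> ?sI" and q': "non_zero_divisor R q'" "q' \<in> ?sI \<cdot> colon R q' ?sI"
      by (auto simp: invertible_ideal_def)
    then obtain q where q: "q \<in> I" "q' = s \<otimes> q" by blast
    have nq: "non_zero_divisor R q" using nonzero_divisor_factor q' q sR I.Icarr by blast
    have *: "\<exists>w'. w' \<in> I \<cdot> colon R q I \<and> w = s \<otimes> w'" if "w \<in> ?sI \<cdot> colon R q' ?sI" for w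
      using that
    proof induction
      case (prod i j)
      then obtain i' where i': "i' \<in> I" "i = s \<otimes> i'" by blast
      have "i' \<otimes> j \<in> I \<cdot> colon R q I"
        using i' prod(2) unfolding q(2) colon_eq[OF q(1)] by (intro ideal_prod.prod)
      then show ?case using i' sR I.Icarr colon_carrier[OF prod(2)] by (intro exI[of _ "i' \<otimes> j"]) (simp add: m_assoc)
    next
      case (sum s1 s2)
      then obtain w1 w2 where w: "w1 \<in> I \<cdot> colon R q I" "s1 = s \<otimes> w1" "w2 \<in> I \<cdot> colon R q I" "s2 = s \<otimes> w2"
        by blast
      have "w1 \<in> carrier R" "w2 \<in> carrier R"
        using w ideal_prod_in_carrier[OF I colon_id[OF q(1)]] by blast+
      then show ?case
        using ideal_prod.sum[OF w(1,3)] w sR by (intro exI[of _ "w1 \<oplus> w2"]) (simp add: r_distr)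
    qed
    obtain w' where w'_in: "w' \<in> I \<cdot> colon R q I" and "q' = s \<otimes> w'"
      using *[OF q'(2)] by (elim exE conjE)
    with q(2) have w': "w' \<in> I \<cdot> colon R q I" "s \<otimes> q = s \<otimes> w'" by auto
    have "q = w'"
      by (rule nonzero_divisor_cancel[OF s _ _ w'(2)])
        (use q w' I.Icarr ideal_prod_in_carrier[OF I colon_id[OF q(1)]] in auto)
    then show "invertible_ideal R I" using invertible_idealI[OF I q(1) nq] w'(1) by simp
  qed
qed

section \<open>Idempotents and ideals supported on a factor\<close>

lemma idempotent_complement:
  assumes e: "e \<in> carrier R" "e \<otimes> e = e"
  shows "e \<otimes> (\<one> \<ominus> e) = \<zero>" "(\<one> \<ominus> e) \<otimes> (\<one> \<ominus> e) = \<one> \<ominus> e"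
proof -
  have "e \<otimes> (\<one> \<ominus> e) = e \<ominus> e \<otimes> e" "(\<one> \<ominus> e) \<otimes> (\<one> \<ominus> e) = \<one> \<ominus> e \<ominus> (e \<ominus> e \<otimes> e)"
    using e(1) by algebra+
  then show "e \<otimes> (\<one> \<ominus> e) = \<zero>" "(\<one> \<ominus> e) \<otimes> (\<one> \<ominus> e) = \<one> \<ominus> e"
    using e by (simp_all add: minus_eq r_neg)
qed

text \<open>Multiplying by \<open>e\<close> and by its complement separates two parts: on the factor
  of \<open>e\<close> the element acts as \<open>q\<close>, whose annihilator \<open>e\<close>
  kills, and on the complementary factor as the identity.\<close>

lemma nonzero_divisor_complement:
  assumes e: "e \<in> carrier R" "e \<otimes> e = e" and qR: "q \<in> carrier R"
    and ann: "\<And>x. x \<in> carrier R \<Longrightarrow> q \<otimes> x = \<zero> \<Longrightarrow> e \<otimes> x = \<zero>"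
  shows "non_zero_divisor R (e \<otimes> q \<oplus> (\<one> \<ominus> e))"
  unfolding non_zero_divisor_def
proof (intro conjI ballI impI)
  let ?f = "\<one> \<ominus> e"
  have f: "?f \<in> carrier R" using e by simp
  fix x assume x: "x \<in> carrier R" "(e \<otimes> q \<oplus> ?f) \<otimes> x = \<zero>"
  have "q \<otimes> (e \<otimes> x) = e \<otimes> ((e \<otimes> q \<oplus> ?f) \<otimes> x)"
  proof -
    have "e \<otimes> ((e \<otimes> q \<oplus> ?f) \<otimes> x) = (e \<otimes> e) \<otimes> q \<otimes> x \<oplus> (e \<otimes> ?f) \<otimes> x" using e(1) qR x(1) f by algebra
    then show ?thesis using e qR x(1) idempotent_complement[OF e] by (simp add: m_ac)
  qed
  then have "e \<otimes> (e \<otimes> x) = \<zero>" using ann[of "e \<otimes> x"] x e by simp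
  then have 1: "e \<otimes> x = \<zero>" using e x by (simp add: m_assoc[symmetric])
  have "?f \<otimes> ((e \<otimes> q \<oplus> ?f) \<otimes> x) = (e \<otimes> ?f) \<otimes> q \<otimes> x \<oplus> (?f \<otimes> ?f) \<otimes> x" using e(1) qR x(1) f by algebra
  then have "?f \<otimes> x = \<zero>" using x e qR f idempotent_complement[OF e] by simp
  moreover have "x = e \<otimes> x \<oplus> ?f \<otimes> x" using e(1) x(1) by algebra
  ultimately show "x = \<zero>" using 1 by simp
qed (use e qR in simp)

text \<open>With \<open>q' = e q + (1 - e)\<close>, a decomposition \<open>q = \<Sum> x\<^sub>i v\<^sub>i\<close> gives
  \<open>q' = \<Sum> (e x\<^sub>i) (e v\<^sub>i) + (1 - e) (1 - e)\<close>.\<close>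

lemma invertible_ideal_extend:
  assumes I: "ideal I R" and e: "e \<in> carrier R" "e \<otimes> e = e" and q: "q \<in> I" "q \<in> I \<cdot> colon R q I"
    and ann: "\<And>x. x \<in> carrier R \<Longrightarrow> q \<otimes> x = \<zero> \<Longrightarrow> e \<otimes> x = \<zero>"
  shows "invertible_ideal R {a \<in> carrier R. e \<otimes> a \<in> I}"
proof -
  interpret I: ideal I R by (rule I)
  let ?Y = "{a \<in> carrier R. e \<otimes> a \<in> I}"
  define f where "f = \<one> \<ominus> e"
  have f: "f \<in> carrier R" using e by (simp add: f_def)
  have ef: "e \<otimes> f = \<zero>" "f \<otimes> f = f" unfolding f_def by (rule idempotent_complement[OF e])+
  have qR: "q \<in> carrier R" using q I.Icarr by simp
  define q' where "q' = e \<otimes> q \<oplus> f"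
  have q'R: "q' \<in> carrier R" using e qR f by (simp add: q'_def)
  have fq': "q' \<otimes> f = f" and eq': "e \<otimes> q' = e \<otimes> q"
  proof -
    have "q' \<otimes> f = q \<otimes> (e \<otimes> f) \<oplus> f \<otimes> f" "e \<otimes> q' = (e \<otimes> e) \<otimes> q \<oplus> e \<otimes> f"
      unfolding q'_def using e(1) qR f by algebra+
    then show "q' \<otimes> f = f" "e \<otimes> q' = e \<otimes> q" using ef e qR f by simp_all
  qed
  have nq': "non_zero_divisor R q'"
    unfolding q'_def f_def by (rule nonzero_divisor_complement[OF e qR ann])
  have Y: "ideal ?Y R"
    by (rule idealI') (use e in \<open>auto simp: r_distr I.I_l_closed m_lcomm[of e]\<close>)
  have V: "ideal (colon R q I) R" "ideal (colon R q' ?Y) R"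
    using colon_ideal[of I q] colon_ideal[of ?Y q'] qR q'R I.a_subset by auto
  have fY: "f \<in> ?Y" using f ef by simp
  have q'Y: "q' \<in> ?Y" using q'R eq' q(1) e(1) I.I_l_closed by simp
  have ev: "e \<otimes> v \<in> colon R q' ?Y" if v: "v \<in> colon R q I" for v
  proof (rule colonI)
    fix y assume y: "y \<in> ?Y"
    have vR: "v \<in> carrier R" using v by (rule colon_carrier)
    obtain t where t: "t \<in> carrier R" "v \<otimes> (e \<otimes> y) = q \<otimes> t" using v y by (auto elim: colonE)
    have "e \<otimes> v \<otimes> y = (e \<otimes> e) \<otimes> v \<otimes> y" using e by simp
    also have "\<dots> = e \<otimes> (v \<otimes> (e \<otimes> y))" using e(1) vR y by simp algebra
    also have "\<dots> = (e \<otimes> q) \<otimes> t" using e(1) qR t by (simp add: m_assoc)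
    also have "\<dots> = q' \<otimes> (e \<otimes> t)" unfolding eq'[symmetric] using e(1) q'R t(1) by algebra
    finally show "\<exists>t\<in>carrier R. e \<otimes> v \<otimes> y = q' \<otimes> t" using e t by blast
  qed (use e colon_carrier[OF v] in simp)
  have fV: "f \<in> colon R q' ?Y"
  proof (rule colonI)
    fix y assume y: "y \<in> ?Y"
    have "f \<otimes> y = q' \<otimes> (f \<otimes> y)" using fq' f y q'R by (simp add: m_assoc[symmetric])
    then show "\<exists>t\<in>carrier R. f \<otimes> y = q' \<otimes> t" using f y by blast
  qed (rule f)
  have "e \<otimes> q \<in> ?Y \<cdot> colon R q' ?Y"
  proof (rule ideal_prod_map[where f = "\<lambda>x. e \<otimes> x", OF q(2)])
    fix i j assume ij: "i \<in> I" "j \<in> colon R q I"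
    have R: "i \<in> carrier R" "j \<in> carrier R" using ij I.Icarr colon_carrier by auto
    have "e \<otimes> i \<in> ?Y" using e ij R I.I_l_closed by (simp add: m_assoc[symmetric])
    from ideal_prod.prod[OF this ev[OF ij(2)], of R]
    show "e \<otimes> (i \<otimes> j) \<in> ?Y \<cdot> colon R q' ?Y"
    proof -
      have "e \<otimes> i \<otimes> (e \<otimes> j) = (e \<otimes> e) \<otimes> (i \<otimes> j)" using e(1) R by algebra
      then show ?thesis using e \<open>e \<otimes> i \<otimes> (e \<otimes> j) \<in> _\<close> by simp
    qed
  next
    fix a b assume "a \<in> I \<cdot> colon R q I" "b \<in> I \<cdot> colon R q I"
    then have "a \<in> carrier R" "b \<in> carrier R"
      using ideal_prod_in_carrier[OF I V(1)] by blast+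
    then show "e \<otimes> (a \<oplus> b) = e \<otimes> a \<oplus> e \<otimes> b" using e by (simp add: r_distr)
  qed
  moreover have "f \<in> ?Y \<cdot> colon R q' ?Y"
    using ideal_prod.prod[OF fY fV, of R] ef by simp
  ultimately have "q' \<in> ?Y \<cdot> colon R q' ?Y"
    unfolding q'_def by (rule ideal_prod.sum)
  then show ?thesis by (rule invertible_idealI[OF Y q'Y nq'])
qed

end

text \<open>The ideal is \<open>I\<close> on the factor of \<open>e\<close> and everything on the
  complementary factor. A regular \<open>q\<close> kills only zero, so the annihilator condition of
  \<open>invertible_ideal_extend\<close> holds for every idempotent.\<close>

lemma (in cring) invertible_ideal_idempotent:
  assumes I: "invertible_ideal R I" and e: "e \<in> carrier R" "e \<otimes> e = e"
  shows "invertible_ideal R {a \<in> carrier R. e \<otimes> a \<in> I}"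
proof -
  obtain q where q: "ideal I R" "q \<in> I" "non_zero_divisor R q" "q \<in> I \<cdot> colon R q I"
    using I by (auto simp: invertible_ideal_def)
  have "e \<otimes> x = \<zero>" if "x \<in> carrier R" "q \<otimes> x = \<zero>" for x
    using q(3) that e by (auto simp: non_zero_divisor_def)
  then show ?thesis using invertible_ideal_extend[OF q(1) e q(2,4)] by blast
qed

text \<open>A finitely generated ideal need not contain a regular element, but it contains one that
  is as regular as the ideal permits: \<open>e\<close> fixes the generators and kills the
  annihilator of \<open>q\<close>. A new generator \<open>s\<close> contributes only its part
  outside the support found so far, so that annihilators can be treated separately.\<close>

lemma rickart_finite:
  fixes R (structure)
  assumes R: "rickart_ring R" and S: "finite S" "S \<subseteq> carrier R"
  shows "\<exists>e\<in>carrier R. \<exists>q\<in>Idl S. e \<otimes> e = e \<and> (\<forall>s\<in>S. e \<otimes> s = s) \<and>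
    (\<forall>x\<in>carrier R. q \<otimes> x = \<zero> \<longrightarrow> e \<otimes> x = \<zero>)"
proof -
  interpret cring R using R by (simp add: rickart_ring_def)
  show ?thesis
    using S
  proof (induction S rule: finite_induct)
    case empty
    interpret I: ideal "Idl {}" R by (rule genideal_ideal) simp
    show ?case by (intro bexI[of _ \<zero>]) auto
  next
    case (insert s S)
    then obtain e q where e: "e \<in> carrier R" "e \<otimes> e = e" "\<forall>s\<in>S. e \<otimes> s = s"
      and q: "q \<in> Idl S" "\<And>x. x \<in> carrier R \<Longrightarrow> q \<otimes> x = \<zero> \<Longrightarrow> e \<otimes> x = \<zero>" by auto
    have sR: "s \<in> carrier R" using insert by simp
    have "insert s S \<subseteq> carrier R" using insert by simp
    then interpret I: ideal "Idl (insert s S)" R by (rule genideal_ideal)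
    interpret IS: ideal "Idl S" R by (rule genideal_ideal) (use insert in simp)
    have qI: "q \<in> Idl (insert s S)"
      using subset_Idl_subset[of "insert s S" S] insert q by blast
    have sI: "s \<in> Idl (insert s S)" using genideal_self[of "insert s S"] insert by blast
    have qR: "q \<in> carrier R" using q(1) IS.Icarr by simp
    obtain g where g: "g \<in> carrier R" "g \<otimes> g = g" "g \<otimes> s = s"
      and gx: "\<And>x. x \<in> carrier R \<Longrightarrow> s \<otimes> x = \<zero> \<Longrightarrow> g \<otimes> x = \<zero>"
      using R sR unfolding rickart_ring_def by meson
    define f where "f = \<one> \<ominus> e"
    have f: "f \<in> carrier R" using e by (simp add: f_def)
    have ef: "e \<otimes> f = \<zero>" "f \<otimes> f = f" unfolding f_def by (rule idempotent_complement[OF e(1,2)])+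
    have decomp: "x = e \<otimes> x \<oplus> f \<otimes> x" if "x \<in> carrier R" for x
      unfolding f_def using e(1) that by algebra
    have "ideal {y \<in> carrier R. e \<otimes> y = y} R"
      by (rule idealI') (use e(1) in \<open>auto simp: r_distr m_lcomm[of e]\<close>)
    then have "Idl S \<subseteq> {y \<in> carrier R. e \<otimes> y = y}"
      by (rule genideal_minimal) (use insert e(3) in auto)
    then have eq: "e \<otimes> q = q" using q(1) by auto
    have fS: "f \<otimes> t = \<zero>" if "t \<in> carrier R" "e \<otimes> t = t" for t
    proof -
      have "f \<otimes> t = t \<ominus> e \<otimes> t" unfolding f_def using e(1) that(1) by algebra
      then show ?thesis using that by (simp add: minus_eq r_neg)
    qed
    \<comment> \<open>Both new terms carry the factor \<open>f\<close>, the complement of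
      \<open>e\<close>, and \<open>e \<otimes> f = \<zero>\<close>. Hence \<open>e'\<close> is
      idempotent, and from \<open>q' \<otimes> x = \<zero>\<close> multiplication by
      \<open>e\<close> and by \<open>f\<close> recovers \<open>q \<otimes> x = \<zero>\<close> and
      \<open>s \<otimes> (f \<otimes> x) = \<zero>\<close>.\<close>
    define e' where "e' = e \<oplus> f \<otimes> g"
    define q' where "q' = q \<oplus> f \<otimes> s"
    have R': "e' \<in> carrier R" "q' \<in> carrier R" using e f g q sR qR by (auto simp: e'_def q'_def)
    have 1: "e' \<otimes> e' = e'"
    proof -
      have "e' \<otimes> e' = e \<otimes> e \<oplus> (e \<otimes> f) \<otimes> (g \<oplus> g) \<oplus> (f \<otimes> f) \<otimes> (g \<otimes> g)"
        unfolding e'_def using e(1) f g(1) by algebra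
      then show ?thesis using e ef f g by (simp add: e'_def)
    qed
    have 2: "e' \<otimes> t = t" if "t \<in> insert s S" for t
    proof (cases "t = s")
      case True
      have "e' \<otimes> s = e \<otimes> s \<oplus> f \<otimes> (g \<otimes> s)" unfolding e'_def using e(1) f g(1) sR by algebra
      then show ?thesis using True g decomp[OF sR] by simp
    next
      case False
      then have t: "t \<in> carrier R" "e \<otimes> t = t" using that e(3) insert by auto
      have "e' \<otimes> t = e \<otimes> t \<oplus> g \<otimes> (f \<otimes> t)" unfolding e'_def using e(1) f g(1) t(1) by algebra
      then show ?thesis using t fS[OF t] g by simp
    qed
    have 3: "e' \<otimes> x = \<zero>" if x: "x \<in> carrier R" "q' \<otimes> x = \<zero>" for x
    proof -
      have "q \<otimes> x = e \<otimes> q \<otimes> x" by (simp add: eq)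
      also have "\<dots> = e \<otimes> (q' \<otimes> x) \<ominus> (e \<otimes> f) \<otimes> (s \<otimes> x)"
        unfolding q'_def using e(1) f qR sR x(1) by algebra
      finally have ex: "e \<otimes> x = \<zero>" using q(2)[of x] x ef e f sR by (simp add: minus_eq)
      have "s \<otimes> (f \<otimes> x) = (f \<otimes> f) \<otimes> s \<otimes> x" using ef f sR x(1) by simp algebra
      also have "\<dots> = f \<otimes> (q' \<otimes> x) \<ominus> f \<otimes> (q \<otimes> x)"
        unfolding q'_def using f qR sR x(1) by algebra
      also have "f \<otimes> (q \<otimes> x) = (e \<otimes> f) \<otimes> (q \<otimes> x)"
      proof -
        have "(e \<otimes> f) \<otimes> (q \<otimes> x) = f \<otimes> ((e \<otimes> q) \<otimes> x)" using e(1) f qR x(1) by algebra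
        then show ?thesis by (simp add: eq)
      qed
      finally have "g \<otimes> (f \<otimes> x) = \<zero>" using gx[of "f \<otimes> x"] x ef f qR by (simp add: minus_eq)
      moreover have "e' \<otimes> x = e \<otimes> x \<oplus> g \<otimes> (f \<otimes> x)" unfolding e'_def using e(1) f g(1) x(1) by algebra
      ultimately show ?thesis using ex by simp
    qed
    have "q' \<in> Idl (insert s S)" unfolding q'_def using qI sI f I.I_l_closed by auto
    with 1 2 3 R' show ?case by blast
  qed
qed

text \<open>The map \<open>r a \<mapsto> r e\<close> identifies \<open>R a\<close> with the direct
  summand \<open>R e\<close>, because \<open>e\<close> kills the annihilator of \<open>a\<close>. In
  the lifting problem the coefficient \<open>c y\<close> is determined only up to that annihilator,
  and the factor \<open>e\<close> removes the ambiguity.\<close>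

lemma (in cring) principal_projective:
  assumes a: "a \<in> carrier R" and e: "e \<in> carrier R" "e \<otimes> a = a"
    and ann: "\<And>x. x \<in> carrier R \<Longrightarrow> a \<otimes> x = \<zero> \<Longrightarrow> e \<otimes> x = \<zero>"
  shows "projective_module R (ring_module R (PIdl a))"
  unfolding projective_module_def
proof (intro conjI allI impI, goal_cases)
  case 1 show ?case by (rule module_ring_module[OF cgenideal_ideal[OF a]])
next
  case (2 N N' g h)
  then have N: "module R N" and N': "module R N'" and g: "g \<in> module_hom R N N'"
    and surj: "g ` carrier N = carrier N'" and h: "h \<in> module_hom R (ring_module R (PIdl a)) N'" by auto
  interpret N: module R N by fact
  interpret I: ideal "PIdl a" R by (rule cgenideal_ideal[OF a])
  define c where "c y = (SOME r. r \<in> carrier R \<and> y = r \<otimes> a)" for y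
  have c: "c y \<in> carrier R" "y = c y \<otimes> a" if "y \<in> PIdl a" for y
  proof -
    have "c y \<in> carrier R \<and> y = c y \<otimes> a"
      unfolding c_def by (rule someI_ex) (use that in \<open>unfold cgenideal_def, blast\<close>)
    then show "c y \<in> carrier R" "y = c y \<otimes> a" by auto
  qed
  have c_eq: "e \<otimes> c y = e \<otimes> r" if "y \<in> PIdl a" "r \<in> carrier R" "y = r \<otimes> a" for y r
  proof -
    have "a \<otimes> (c y \<ominus> r) = c y \<otimes> a \<ominus> r \<otimes> a" using a c(1)[OF that(1)] that(2) by algebra
    also have "\<dots> = \<zero>" using c[OF that(1)] that a by (metis m_closed minus_eq r_neg)
    finally have "e \<otimes> (c y \<ominus> r) = \<zero>" using ann c(1)[OF that(1)] that(2) by simp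
    moreover have "e \<otimes> (c y \<ominus> r) = e \<otimes> c y \<ominus> e \<otimes> r" using e(1) c(1)[OF that(1)] that(2) by algebra
    ultimately show ?thesis using e(1) c(1)[OF that(1)] that(2) by (simp add: r_right_minus_eq)
  qed
  have aI: "a \<in> PIdl a" by (rule cgenideal_self[OF a])
  then have "h a \<in> g ` carrier N" using module_homD(1)[OF h] surj by simp
  then obtain n where n: "n \<in> carrier N" "g n = h a" by auto
  show ?case
  proof (intro bexI[of _ "\<lambda>y. (e \<otimes> c y) \<odot>\<^bsub>N\<^esub> n"] ballI)
    fix y assume "y \<in> carrier (ring_module R (PIdl a))"
    then have y: "y \<in> PIdl a" by simp
    have "g ((e \<otimes> c y) \<odot>\<^bsub>N\<^esub> n) = (e \<otimes> c y) \<odot>\<^bsub>N'\<^esub> h a"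
      using module_homD(3)[OF g, of "e \<otimes> c y" n] n e c(1)[OF y] by simp
    also have "\<dots> = h (e \<otimes> c y \<otimes> a)"
      using module_homD(3)[OF h, of "e \<otimes> c y" a] aI e c(1)[OF y] by simp
    also have "e \<otimes> c y \<otimes> a = c y \<otimes> (e \<otimes> a)" using e(1) a c(1)[OF y] by algebra
    finally show "g ((e \<otimes> c y) \<odot>\<^bsub>N\<^esub> n) = h y" using c(2)[OF y] e by simp
  next
    show "(\<lambda>y. (e \<otimes> c y) \<odot>\<^bsub>N\<^esub> n) \<in> module_hom R (ring_module R (PIdl a)) N"
    proof (rule module_homI)
      fix x y assume "x \<in> carrier (ring_module R (PIdl a))" "y \<in> carrier (ring_module R (PIdl a))"
      then have xy: "x \<in> PIdl a" "y \<in> PIdl a" by auto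
      have "x \<oplus> y = (c x \<oplus> c y) \<otimes> a" using c[OF xy(1)] c[OF xy(2)] a by (metis l_distr)
      then have "e \<otimes> c (x \<oplus> y) = e \<otimes> c x \<oplus> e \<otimes> c y"
        using c_eq[OF I.a_closed[OF xy], of "c x \<oplus> c y"] c(1)[OF xy(1)] c(1)[OF xy(2)] e(1) by (simp add: r_distr)
      then show "(e \<otimes> c (x \<oplus>\<^bsub>ring_module R (PIdl a)\<^esub> y)) \<odot>\<^bsub>N\<^esub> n = (e \<otimes> c x) \<odot>\<^bsub>N\<^esub> n \<oplus>\<^bsub>N\<^esub> (e \<otimes> c y) \<odot>\<^bsub>N\<^esub> n"
        using N.smult_l_distr[of "e \<otimes> c x" "e \<otimes> c y" n] xy c(1) e n by simp
    next
      fix r x assume "r \<in> carrier R" "x \<in> carrier (ring_module R (PIdl a))"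
      then have r: "r \<in> carrier R" "x \<in> PIdl a" by auto
      have "r \<otimes> x = (r \<otimes> c x) \<otimes> a" using c[OF r(2)] a r(1) by (metis m_assoc)
      then have "e \<otimes> c (r \<otimes> x) = r \<otimes> (e \<otimes> c x)"
        using c_eq[OF I.I_l_closed[OF r(2,1)], of "r \<otimes> c x"] r(1) c(1)[OF r(2)] e(1) by (simp add: m_lcomm)
      then show "(e \<otimes> c (r \<odot>\<^bsub>ring_module R (PIdl a)\<^esub> x)) \<odot>\<^bsub>N\<^esub> n = r \<odot>\<^bsub>N\<^esub> ((e \<otimes> c x) \<odot>\<^bsub>N\<^esub> n)"
        using N.smult_assoc1[of r "e \<otimes> c x" n] r c(1) e n by simp
    qed (use c e n in auto)
  qed
qed

text \<open>A finitely generated flat ideal is invertible on the factor of its support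
  \<open>e\<close>; filling the complementary factor with the whole ring gives an invertible ideal,
  from which \<open>I\<close> is recovered as its multiple by \<open>e\<close>.\<close>

lemma rickart_flat_extend:
  fixes R (structure)
  assumes R: "rickart_ring R" and fg: "finitely_generated_ideal R I" and flat: "flat_module R (ring_module R I)"
  obtains e where "e \<in> carrier R" "e \<otimes> e = e" "\<And>y. y \<in> I \<Longrightarrow> e \<otimes> y = y"
    "invertible_ideal R {a \<in> carrier R. e \<otimes> a \<in> I}"
proof -
  interpret cring R using R by (simp add: rickart_ring_def)
  obtain S where S: "S \<subseteq> carrier R" "finite S" "I = Idl S"
    using fg unfolding finitely_generated_ideal_def by auto
  have I: "ideal I R" unfolding S(3) by (rule genideal_ideal[OF S(1)])
  obtain e q where e: "e \<in> carrier R" "e \<otimes> e = e" "\<forall>s\<in>S. e \<otimes> s = s"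
    and q: "q \<in> I" "\<And>x. x \<in> carrier R \<Longrightarrow> q \<otimes> x = \<zero> \<Longrightarrow> e \<otimes> x = \<zero>"
    using rickart_finite[OF R S(2,1)] S(3) by auto
  have "ideal {y \<in> carrier R. e \<otimes> y = y} R"
    by (rule idealI') (use e(1) in \<open>auto simp: r_distr m_lcomm[of e]\<close>)
  then have "I \<subseteq> {y \<in> carrier R. e \<otimes> y = y}"
    unfolding S(3) by (rule genideal_minimal) (use S e(3) in auto)
  moreover have "invertible_ideal R {a \<in> carrier R. e \<otimes> a \<in> I}"
    by (rule invertible_ideal_extend[OF I e(1,2) q(1) colon_prod_if_flat[OF flat fg q(1)] q(2)])
  ultimately show thesis using that[OF e(1,2)] by blast
qed

text \<open>From left to right, \<open>q \<otimes> p\<close> is a regular element of the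
  intersection, and the flatness test makes it a witness. From right to left, principal ideals are
  projective by the annihilator condition alone, and finitely generated flat ideals are replaced by
  their invertible extensions; both idempotents fix \<open>I \<inter> J\<close>, so multiplying by
  \<open>e \<otimes> f\<close> returns to it.\<close>

lemma generalized_gcd_ring_iff:
  fixes R (structure)
  assumes R: "rickart_ring R"
  shows "generalized_gcd_ring R \<longleftrightarrow>
    (\<forall>I J. invertible_ideal R I \<and> invertible_ideal R J \<longrightarrow> invertible_ideal R (I \<inter> J))"
proof
  interpret cring R using R by (simp add: rickart_ring_def)
  assume gcd: "generalized_gcd_ring R"
  show "\<forall>I J. invertible_ideal R I \<and> invertible_ideal R J \<longrightarrow> invertible_ideal R (I \<inter> J)"
  proof (intro allI impI, elim conjE)
    fix I J assume IJ: "invertible_ideal R I" "invertible_ideal R J"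
    then obtain q p where I: "ideal I R" "q \<in> I" "non_zero_divisor R q"
      and J: "ideal J R" "p \<in> J" "non_zero_divisor R p"
      by (auto simp: invertible_ideal_def)
    interpret I: ideal I R by fact
    interpret J: ideal J R by fact
    have fl: "finitely_generated_ideal R (I \<inter> J)" "flat_module R (ring_module R (I \<inter> J))"
      using gcd invertible_flat[OF IJ(1)] invertible_flat[OF IJ(2)] unfolding generalized_gcd_ring_def by blast+
    have qp: "q \<otimes> p \<in> I \<inter> J" using I J I.I_r_closed J.I_l_closed by auto
    show "invertible_ideal R (I \<inter> J)"
      by (rule invertible_idealI[OF i_intersect[OF I(1) J(1)] qp nonzero_divisor_mult[OF I(3) J(3)]
            colon_prod_if_flat[OF fl(2,1) qp]])
  qed
next
  interpret cring R using R by (simp add: rickart_ring_def)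
  assume inter: "\<forall>I J. invertible_ideal R I \<and> invertible_ideal R J \<longrightarrow> invertible_ideal R (I \<inter> J)"
  show "generalized_gcd_ring R"
    unfolding generalized_gcd_ring_def
  proof (intro conjI allI impI is_cring)
    fix I assume I: "principalideal I R"
    then obtain a where a: "a \<in> carrier R" "I = PIdl a"
      using principalideal.generate[OF I] cgenideal_eq_genideal by auto
    obtain e where "e \<in> carrier R" "e \<otimes> a = a" "\<And>x. x \<in> carrier R \<Longrightarrow> a \<otimes> x = \<zero> \<Longrightarrow> e \<otimes> x = \<zero>"
      using R a(1) unfolding rickart_ring_def by meson
    then show "projective_module R (ring_module R I)"
      unfolding a(2) by (rule principal_projective[OF a(1)])
  next
    fix I J assume "finitely_generated_ideal R I \<and> flat_module R (ring_module R I) \<and>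
      finitely_generated_ideal R J \<and> flat_module R (ring_module R J)"
    then have I: "finitely_generated_ideal R I" "flat_module R (ring_module R I)"
      and J: "finitely_generated_ideal R J" "flat_module R (ring_module R J)" by auto
    have "ideal I R" "ideal J R"
      using I(1) J(1) genideal_ideal unfolding finitely_generated_ideal_def by auto
    then interpret I: ideal I R + J: ideal J R .
    obtain e where e: "e \<in> carrier R" "e \<otimes> e = e" "\<And>y. y \<in> I \<Longrightarrow> e \<otimes> y = y"
      "invertible_ideal R {a \<in> carrier R. e \<otimes> a \<in> I}" by (rule rickart_flat_extend[OF R I], rule that)
    obtain f where f: "f \<in> carrier R" "f \<otimes> f = f" "\<And>y. y \<in> J \<Longrightarrow> f \<otimes> y = y"
      "invertible_ideal R {a \<in> carrier R. f \<otimes> a \<in> J}" by (rule rickart_flat_extend[OF R J], rule that)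
    let ?K = "{a \<in> carrier R. e \<otimes> a \<in> I} \<inter> {a \<in> carrier R. f \<otimes> a \<in> J}"
    have "(\<lambda>x. (e \<otimes> f) \<otimes> x) ` ?K = I \<inter> J"
    proof (intro equalityI subsetI)
      fix y assume "y \<in> (\<lambda>x. (e \<otimes> f) \<otimes> x) ` ?K"
      then obtain x where x: "x \<in> carrier R" "e \<otimes> x \<in> I" "f \<otimes> x \<in> J" "y = e \<otimes> f \<otimes> x" by blast
      have y: "y = f \<otimes> (e \<otimes> x)" "y = e \<otimes> (f \<otimes> x)"
        unfolding x(4) using e(1) f(1) x(1) by algebra+
      have "f \<otimes> (e \<otimes> x) \<in> I" "e \<otimes> (f \<otimes> x) \<in> J"
        using x I.I_l_closed J.I_l_closed e(1) f(1) by blast+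
      then show "y \<in> I \<inter> J" using y by (metis IntI)
    next
      fix y assume y: "y \<in> I \<inter> J"
      then have yR: "y \<in> carrier R" using I.Icarr by auto
      have "y = e \<otimes> f \<otimes> y" using y e(1) f(1) yR e(3)[of y] f(3)[of y] by (simp add: m_assoc)
      moreover have "y \<in> ?K" using y yR e(3)[of y] f(3)[of y] by auto
      ultimately show "y \<in> (\<lambda>x. (e \<otimes> f) \<otimes> x) ` ?K" by blast
    qed
    moreover have "(e \<otimes> f) \<otimes> (e \<otimes> f) = e \<otimes> f"
    proof -
      have "(e \<otimes> f) \<otimes> (e \<otimes> f) = (e \<otimes> e) \<otimes> (f \<otimes> f)" using e(1) f(1) by algebra
      then show ?thesis using e f by simp
    qed
    moreover have "invertible_ideal R ?K" using inter e(4) f(4) by blast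
    ultimately show "finitely_generated_ideal R (I \<inter> J)" "flat_module R (ring_module R (I \<inter> J))"
      using idempotent_scale_flat[of ?K "e \<otimes> f"] e(1) f(1) by simp_all
  qed
qed

section \<open>Two-generated ideals along a conductor\<close>

locale overring = cring T for T (structure) +
  fixes R :: "('a, 'm) ring_scheme"
  assumes subcring_R: "subcring (carrier R) T"
    and R_add: "\<And>x y. x \<oplus>\<^bsub>R\<^esub> y = x \<oplus> y" and R_mult: "\<And>x y. x \<otimes>\<^bsub>R\<^esub> y = x \<otimes> y"
    and R_zero: "\<zero>\<^bsub>R\<^esub> = \<zero>" and R_one: "\<one>\<^bsub>R\<^esub> = \<one>"
    and cring_R: "cring R"
begin

lemmas R_ops [simp] = R_add R_mult R_zero R_one

sublocale R: cring R by (rule cring_R)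

lemma R_carrier [simp]: "x \<in> carrier R \<Longrightarrow> x \<in> carrier T"
  using subcringE(1)[OF subcring_R] by auto

lemma R_closed [simp]:
  "\<zero> \<in> carrier R" "\<one> \<in> carrier R" "x \<in> carrier R \<Longrightarrow> \<ominus> x \<in> carrier R"
  "x \<in> carrier R \<Longrightarrow> y \<in> carrier R \<Longrightarrow> x \<oplus> y \<in> carrier R"
  "x \<in> carrier R \<Longrightarrow> y \<in> carrier R \<Longrightarrow> x \<ominus> y \<in> carrier R"
  "x \<in> carrier R \<Longrightarrow> y \<in> carrier R \<Longrightarrow> x \<otimes> y \<in> carrier R"
  using subcringE(2,3,5,6,7)[OF subcring_R] by (auto simp: a_minus_def)

lemma R_uminus: "x \<in> carrier R \<Longrightarrow> \<ominus>\<^bsub>R\<^esub> x = \<ominus> x"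
  using R.minus_equality[of "\<ominus> x" x] by (simp add: l_neg)

lemma R_minus: "x \<in> carrier R \<Longrightarrow> y \<in> carrier R \<Longrightarrow> x \<ominus>\<^bsub>R\<^esub> y = x \<ominus> y"
  by (simp add: a_minus_def R_uminus)

lemma R_idealD:
  assumes "ideal U R"
  shows "x \<in> U \<Longrightarrow> x \<in> carrier R" "\<zero> \<in> U" "x \<in> U \<Longrightarrow> y \<in> U \<Longrightarrow> x \<oplus> y \<in> U"
    "x \<in> U \<Longrightarrow> y \<in> U \<Longrightarrow> x \<ominus> y \<in> U" "a \<in> carrier R \<Longrightarrow> x \<in> U \<Longrightarrow> a \<otimes> x \<in> U"
    "a \<in> carrier R \<Longrightarrow> x \<in> U \<Longrightarrow> x \<otimes> a \<in> U"
proof -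
  interpret U: ideal U R by fact
  show "x \<in> U \<Longrightarrow> x \<in> carrier R" by (rule U.Icarr)
  show "\<zero> \<in> U" using U.closed_simps(1) by simp
  show "x \<in> U \<Longrightarrow> y \<in> U \<Longrightarrow> x \<oplus> y \<in> U" using U.closed_simps(2)[of x y] by simp
  show "x \<in> U \<Longrightarrow> y \<in> U \<Longrightarrow> x \<ominus> y \<in> U"
    using U.closed_simps(3)[of x y] R_minus[of x y] U.Icarr by simp
  show "a \<in> carrier R \<Longrightarrow> x \<in> U \<Longrightarrow> a \<otimes> x \<in> U" using U.closed_simps(5)[of a x] by simp
  show "a \<in> carrier R \<Longrightarrow> x \<in> U \<Longrightarrow> x \<otimes> a \<in> U" using U.closed_simps(6)[of a x] by simp
qed

lemma R_idealI:
  assumes "I \<subseteq> carrier R" "\<zero> \<in> I" "\<And>x y. x \<in> I \<Longrightarrow> y \<in> I \<Longrightarrow> x \<oplus> y \<in> I"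
    and "\<And>a x. a \<in> carrier R \<Longrightarrow> x \<in> I \<Longrightarrow> a \<otimes> x \<in> I"
  shows "ideal I R"
  by (rule R.idealI') (use assms in auto)

text \<open>The units of \<open>T\<close> that lie in \<open>R\<close>; the inverse may lie outside
  \<open>R\<close>. By \<open>denominator\<close>, \<open>T\<close> is the localization of
  \<open>R\<close> at this set.\<close>

definition inner_units :: "'a set" where
  "inner_units = {s \<in> carrier R. \<exists>t\<in>carrier T. s \<otimes> t = \<one>}"

lemma inner_unitE:
  assumes "s \<in> inner_units" obtains t where "t \<in> carrier T" "s \<otimes> t = \<one>" "s \<in> carrier R"
  using assms by (auto simp: inner_units_def)

lemma inner_unitI: "s \<in> carrier R \<Longrightarrow> t \<in> carrier T \<Longrightarrow> s \<otimes> t = \<one> \<Longrightarrow> s \<in> inner_units"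
  by (auto simp: inner_units_def)

lemma inner_units_carrier: "s \<in> inner_units \<Longrightarrow> s \<in> carrier R"
  by (simp add: inner_units_def)

lemma inner_units_mult:
  assumes "s \<in> inner_units" "s' \<in> inner_units" shows "s \<otimes> s' \<in> inner_units"
proof -
  obtain t where t: "t \<in> carrier T" "s \<otimes> t = \<one>" "s \<in> carrier R" using assms(1) by (rule inner_unitE)
  obtain t' where t': "t' \<in> carrier T" "s' \<otimes> t' = \<one>" "s' \<in> carrier R" using assms(2) by (rule inner_unitE)
  have "s \<otimes> s' \<otimes> (t \<otimes> t') = (s \<otimes> t) \<otimes> (s' \<otimes> t')" using t(1,3) t'(1,3) R_carrier by algebra
  then show ?thesis using t t' by (intro inner_unitI[of _ "t \<otimes> t'"]) auto
qed

lemma unit_cancel: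
  assumes "u \<in> carrier T" "v \<in> carrier T" "u \<otimes> v = \<one>" "x \<in> carrier T" "y \<in> carrier T" "u \<otimes> x = u \<otimes> y"
  shows "x = y"
proof -
  have "x = v \<otimes> (u \<otimes> x)" "y = v \<otimes> (u \<otimes> y)"
    using assms(1-5) by (simp_all add: m_assoc[symmetric] m_comm[of v u])
  then show ?thesis using assms(6) by simp
qed

end

locale conductor_two_generated = overring T R for T (structure) and R +
  fixes C :: "'a set" and c :: 'a
  assumes C_R: "ideal C R" and C_T: "ideal C T" and T_nonzero: "\<one> \<noteq> \<zero>"
    and c: "c \<in> C" "non_zero_divisor T c"
    and C_principal: "principalideal C T"
    and two_gen: "\<And>I. two_generated_ideal R I \<Longrightarrow> I \<noteq> {\<zero>\<^bsub>R\<^esub>} \<Longrightarrow>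
      (\<exists>r\<in>carrier R. \<exists>s\<in>carrier R. \<exists>U. ideal U R \<and>
         U \<cdot>\<^bsub>T\<^esub> carrier T = carrier T \<and> PIdl\<^bsub>T\<^esub> r = carrier T \<and>
         r <#\<^bsub>R\<^esub> I = s <#\<^bsub>R\<^esub> U \<and>
         (\<lambda>x. r \<otimes>\<^bsub>R\<^esub> x) \<in> module_iso R (ring_module R I) (ring_module R (r <#\<^bsub>R\<^esub> I)) \<and>
         (\<lambda>x. s \<otimes>\<^bsub>R\<^esub> x) \<in> module_iso R (ring_module R U) (ring_module R (s <#\<^bsub>R\<^esub> U)))"
begin

sublocale C: ideal C T by (rule C_T)

lemma C_in_R: "x \<in> C \<Longrightarrow> x \<in> carrier R"
  using R_idealD(1)[OF C_R] .

lemma c_in: "c \<in> carrier T" "c \<in> carrier R"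
  using c C_in_R by auto

lemma c_mult_in: "t \<in> carrier T \<Longrightarrow> t \<otimes> c \<in> C"
  using c C.I_l_closed by simp

lemma c_cancel: "x \<in> carrier T \<Longrightarrow> y \<in> carrier T \<Longrightarrow> c \<otimes> x = c \<otimes> y \<Longrightarrow> x = y"
  by (rule nonzero_divisor_cancel[OF c(2)])

text \<open>In \<open>T\<close> the element \<open>s\<close> is a gcd of \<open>a\<close> and
  \<open>b\<close>: it divides both because \<open>r\<close> is a unit, and it is a combination of
  both because \<open>U T = T\<close>. The lemma states what is left of the condition on ideals once
  \<open>I\<close> and \<open>U\<close> are forgotten.\<close>

lemma normalize_pair:
  assumes a: "a \<in> carrier R" and b: "b \<in> carrier R" and ab: "a \<noteq> \<zero> \<or> b \<noteq> \<zero>"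
  obtains r r' s u v x y where "r \<in> carrier R" "r' \<in> carrier T" "r \<otimes> r' = \<one>" "s \<in> carrier R"
    "u \<in> carrier R" "v \<in> carrier R" "r \<otimes> a = s \<otimes> u" "r \<otimes> b = s \<otimes> v"
    "x \<in> carrier T" "y \<in> carrier T" "s = a \<otimes> x \<oplus> b \<otimes> y" "non_zero_divisor T s"
proof -
  define I where "I = Idl\<^bsub>R\<^esub> {a, b}"
  have ab_I: "a \<in> I" "b \<in> I" unfolding I_def using R.genideal_self[of "{a, b}"] a b by auto
  have I2: "two_generated_ideal R I" unfolding two_generated_ideal_def I_def using a b by blast
  have "I \<noteq> {\<zero>\<^bsub>R\<^esub>}" using ab_I ab by auto
  from two_gen[OF I2 this] obtain r s U where r: "r \<in> carrier R" and s: "s \<in> carrier R"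
    and U: "ideal U R" and UT: "U \<cdot>\<^bsub>T\<^esub> carrier T = carrier T" and rT: "PIdl r = carrier T"
    and rI: "r <#\<^bsub>R\<^esub> I = s <#\<^bsub>R\<^esub> U"
    and iso: "(\<lambda>x. s \<otimes>\<^bsub>R\<^esub> x) \<in> module_iso R (ring_module R U) (ring_module R (s <#\<^bsub>R\<^esub> U))"
    by auto
  have inj: "inj_on (\<lambda>x. s \<otimes> x) U"
    using iso by (auto simp: module_iso_def bij_betw_def)
  obtain r' where r': "r' \<in> carrier T" "r \<otimes> r' = \<one>"
  proof -
    have "\<one> \<in> PIdl r" using rT by simp
    then obtain r' where "r' \<in> carrier T" "\<one> = r' \<otimes> r" unfolding cgenideal_def by blast
    then show ?thesis using that[of r'] r m_comm[of r' r] by simp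
  qed
  have "I \<subseteq> {a \<otimes> x \<oplus> b \<otimes> y |x y. x \<in> carrier R \<and> y \<in> carrier R}" (is "_ \<subseteq> ?J")
    unfolding I_def
  proof (rule R.genideal_minimal)
    show "ideal ?J R"
    proof (rule R_idealI)
      show "?J \<subseteq> carrier R" using a b by auto
      have "\<zero> = a \<otimes> \<zero> \<oplus> b \<otimes> \<zero>" using a b by simp
      then show "\<zero> \<in> ?J" using R_closed(1) by blast
    next
      fix x y assume "x \<in> ?J" "y \<in> ?J"
      then obtain x1 x2 y1 y2 where xy: "x1 \<in> carrier R" "x2 \<in> carrier R" "y1 \<in> carrier R" "y2 \<in> carrier R"
        "x = a \<otimes> x1 \<oplus> b \<otimes> x2" "y = a \<otimes> y1 \<oplus> b \<otimes> y2" by blast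
      have "x \<oplus> y = a \<otimes> (x1 \<oplus> y1) \<oplus> b \<otimes> (x2 \<oplus> y2)"
        unfolding xy(5,6) using xy(1-4)[THEN R_carrier] a[THEN R_carrier] b[THEN R_carrier] by algebra
      then show "x \<oplus> y \<in> ?J" using xy R_closed(4) by blast
    next
      fix w x assume w: "w \<in> carrier R" and "x \<in> ?J"
      then obtain x1 x2 where x: "x1 \<in> carrier R" "x2 \<in> carrier R" "x = a \<otimes> x1 \<oplus> b \<otimes> x2" by blast
      have "w \<otimes> x = a \<otimes> (w \<otimes> x1) \<oplus> b \<otimes> (w \<otimes> x2)"
        unfolding x(3) using x(1,2)[THEN R_carrier] w[THEN R_carrier] a[THEN R_carrier] b[THEN R_carrier]
        by algebra
      then show "w \<otimes> x \<in> ?J" using x w R_closed(6) by blast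
    qed
    have "a = a \<otimes> \<one> \<oplus> b \<otimes> \<zero>" "b = a \<otimes> \<zero> \<oplus> b \<otimes> \<one>" using a b by simp_all
    then show "{a, b} \<subseteq> ?J" using R_closed(1,2) by blast
  qed
  note I_form = this
  have lc: "s <#\<^bsub>R\<^esub> U = (\<lambda>x. s \<otimes> x) ` U" "r <#\<^bsub>R\<^esub> I = (\<lambda>x. r \<otimes> x) ` I"
    by (auto simp: l_coset_def)
  have "r \<otimes> a \<in> (\<lambda>x. s \<otimes> x) ` U" "r \<otimes> b \<in> (\<lambda>x. s \<otimes> x) ` U"
    using ab_I unfolding lc(1)[symmetric] rI[symmetric] lc(2) by blast+
  then obtain u v where u: "u \<in> U" "r \<otimes> a = s \<otimes> u" and v: "v \<in> U" "r \<otimes> b = s \<otimes> v" by blast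
  have UR: "u \<in> carrier R" if "u \<in> U" for u using R_idealD(1)[OF U that] .
  \<comment> \<open>Since \<open>s U = r I\<close>, every \<open>s \<otimes> i\<close> with
    \<open>i\<close> in \<open>U\<close> is a combination of \<open>a\<close> and \<open>b\<close>;
    the case \<open>w = \<one>\<close> yields \<open>s\<close> itself.\<close>
  have sU: "\<exists>x\<in>carrier T. \<exists>y\<in>carrier T. s \<otimes> w = a \<otimes> x \<oplus> b \<otimes> y" if "w \<in> U \<cdot>\<^bsub>T\<^esub> carrier T" for w
    using that
  proof induction
    case (prod i j)
    have "s \<otimes> i \<in> (\<lambda>x. r \<otimes> x) ` I" using prod(1) unfolding lc(2)[symmetric] rI lc(1) by blast
    then obtain z where "z \<in> I" "s \<otimes> i = r \<otimes> z" by blast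
    then obtain x y where z: "x \<in> carrier R" "y \<in> carrier R" "s \<otimes> i = r \<otimes> (a \<otimes> x \<oplus> b \<otimes> y)"
      using I_form by blast
    have "s \<otimes> (i \<otimes> j) = (s \<otimes> i) \<otimes> j" using s UR[OF prod(1)] prod(2) by (simp add: m_assoc)
    also have "\<dots> = a \<otimes> (r \<otimes> x \<otimes> j) \<oplus> b \<otimes> (r \<otimes> y \<otimes> j)"
      unfolding z(3) using z(1,2)[THEN R_carrier] r[THEN R_carrier] a[THEN R_carrier] b[THEN R_carrier] prod(2)
      by algebra
    finally show ?case using z r prod(2) by (meson R_carrier m_closed)
  next
    case (sum s1 s2)
    then obtain x1 y1 x2 y2 where xy: "x1 \<in> carrier T" "y1 \<in> carrier T" "x2 \<in> carrier T" "y2 \<in> carrier T"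
      "s \<otimes> s1 = a \<otimes> x1 \<oplus> b \<otimes> y1" "s \<otimes> s2 = a \<otimes> x2 \<oplus> b \<otimes> y2" by blast
    have "s1 \<in> carrier T" "s2 \<in> carrier T" using sum(1,2) UT by auto
    then have "s \<otimes> (s1 \<oplus> s2) = (s \<otimes> s1) \<oplus> (s \<otimes> s2)" using s by (simp add: r_distr)
    also have "\<dots> = a \<otimes> (x1 \<oplus> x2) \<oplus> b \<otimes> (y1 \<oplus> y2)"
      unfolding xy(5,6) using xy(1-4) a[THEN R_carrier] b[THEN R_carrier] by algebra
    finally show ?case using xy by blast
  qed
  obtain x y where xy: "x \<in> carrier T" "y \<in> carrier T" "s = a \<otimes> x \<oplus> b \<otimes> y"
    using sU[of \<one>] UT s by auto
  have "non_zero_divisor T s"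
    unfolding non_zero_divisor_def
  proof (intro conjI ballI impI)
    fix x assume x: "x \<in> carrier T" "s \<otimes> x = \<zero>"
    have U0: "x \<otimes> u = \<zero>" if u: "u \<in> U" for u
    proof -
      have uR: "u \<in> carrier T" using UR[OF u] by simp
      \<comment> \<open>Injectivity of multiplication by \<open>s\<close> is available only on
        \<open>U\<close>, an ideal of \<open>R\<close>, whereas \<open>x\<close> lies in
        \<open>T\<close>. The factor \<open>c\<close> moves \<open>x\<close> into \<open>R\<close>
        and is cancelled afterwards.\<close>
      have xc: "x \<otimes> c \<in> carrier R" using C_in_R c_mult_in x by simp
      have "s \<otimes> (u \<otimes> (x \<otimes> c)) = (s \<otimes> x) \<otimes> (u \<otimes> c)"
        using s[THEN R_carrier] uR x(1) c_in(1) by algebra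
      also have "\<dots> = s \<otimes> \<zero>" using x uR c_in s by simp
      finally have "u \<otimes> (x \<otimes> c) = \<zero>"
        by (rule inj_onD[OF inj]) (use R_idealD[OF U] u xc in auto)
      then have "c \<otimes> (x \<otimes> u) = c \<otimes> \<zero>" using uR x(1) c_in(1) by (simp add: m_ac)
      then show ?thesis by (rule c_cancel[rotated 2]) (use x uR in auto)
    qed
    have "x \<otimes> w = \<zero>" if "w \<in> U \<cdot>\<^bsub>T\<^esub> carrier T" for w
      using that
    proof induction
      case (prod i j)
      have "x \<otimes> (i \<otimes> j) = (x \<otimes> i) \<otimes> j" using x UR[OF prod(1)] prod(2) by (simp add: m_assoc)
      then show ?case using U0[OF prod(1)] prod(2) by simp
    next
      case (sum s1 s2)
      moreover have "s1 \<in> carrier T" "s2 \<in> carrier T" using sum(1,2) UT by auto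
      ultimately show ?case using x by (simp add: r_distr)
    qed
    from this[of \<one>] show "x = \<zero>" using UT x by simp
  qed (use s in simp)
  then show thesis using that[OF r r' s UR[OF u(1)] UR[OF v(1)] u(2) v(2) xy] by blast
qed

text \<open>Every non-zero \<open>w\<close> divides a regular element: the pair with both entries
  \<open>w \<otimes> c\<close> lies in \<open>R\<close>, and its normal form gives a regular
  \<open>s\<close> in \<open>w T\<close>.\<close>

lemma T_domain: "domain T"
proof (intro domain.intro domain_axioms.intro is_cring T_nonzero)
  fix t w assume t: "t \<in> carrier T" and w: "w \<in> carrier T" and tw: "t \<otimes> w = \<zero>"
  show "t = \<zero> \<or> w = \<zero>"
  proof (rule disjCI)
    assume "w \<noteq> \<zero>"
    let ?a = "w \<otimes> c"
    have a: "?a \<in> carrier R" using C_in_R c_mult_in w by simp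
    have "?a \<noteq> \<zero>"
      using c_cancel[of w \<zero>] \<open>w \<noteq> \<zero>\<close> w c_in m_comm[of w c] by auto
    then obtain x y s where s: "x \<in> carrier T" "y \<in> carrier T" "s = ?a \<otimes> x \<oplus> ?a \<otimes> y" "non_zero_divisor T s"
      using normalize_pair[OF a a] by metis
    have "s \<otimes> t = (t \<otimes> w) \<otimes> (c \<otimes> (x \<oplus> y))" unfolding s(3) using s(1,2) t w c_in(1) by algebra
    then have "s \<otimes> t = \<zero>" using tw s c_in by simp
    then show "t = \<zero>" using s(4) t unfolding non_zero_divisor_def by blast
  qed
qed

sublocale domain T by (rule T_domain)

lemma c_nonzero: "c \<noteq> \<zero>"
  using c_cancel[of \<one> \<zero>] c_in by auto

text \<open>Normalizing the pair \<open>t c\<close>, \<open>c\<close> gives \<open>s = c w\<close>,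
  and cancelling \<open>c\<close> leaves \<open>r = w v\<close> and \<open>r t = w u\<close>. As
  \<open>r\<close> is a unit of \<open>T\<close>, so are \<open>w\<close> and \<open>v\<close>,
  whence \<open>v t = u\<close> and \<open>v\<close> is the denominator.\<close>

lemma denominator:
  assumes t: "t \<in> carrier T" shows "\<exists>s\<in>inner_units. s \<otimes> t \<in> carrier R"
proof -
  have tc: "t \<otimes> c \<in> carrier R" using C_in_R c_mult_in t by simp
  obtain r r' s u v x y where *: "r \<in> carrier R" "r' \<in> carrier T" "r \<otimes> r' = \<one>" "s \<in> carrier R"
    "u \<in> carrier R" "v \<in> carrier R" "r \<otimes> (t \<otimes> c) = s \<otimes> u" "r \<otimes> c = s \<otimes> v"
    "x \<in> carrier T" "y \<in> carrier T" "s = t \<otimes> c \<otimes> x \<oplus> c \<otimes> y" "non_zero_divisor T s"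
    by (rule normalize_pair[OF tc c_in(2)]) (use c_nonzero in blast, rule that)
  define w where "w = t \<otimes> x \<oplus> y"
  have w: "w \<in> carrier T" using * t by (simp add: w_def)
  have s: "s = c \<otimes> w" unfolding *(11) w_def using *(9,10) t c_in(1) by algebra
  have rT: "r \<in> carrier T" "u \<in> carrier T" "v \<in> carrier T" using * by simp_all
  have 1: "r = w \<otimes> v"
  proof (rule c_cancel)
    have "c \<otimes> r = r \<otimes> c" using rT c_in by (simp add: m_comm)
    also have "\<dots> = c \<otimes> (w \<otimes> v)" using *(8) s c_in w rT by (simp add: m_assoc)
    finally show "c \<otimes> r = c \<otimes> (w \<otimes> v)" .
  qed (use rT w in auto)
  have 2: "r \<otimes> t = w \<otimes> u"
  proof (rule c_cancel)
    have "c \<otimes> (r \<otimes> t) = r \<otimes> (t \<otimes> c)" using rT c_in t by (simp add: m_ac)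
    also have "\<dots> = c \<otimes> (w \<otimes> u)" using *(7) s c_in w rT by (simp add: m_assoc)
    finally show "c \<otimes> (r \<otimes> t) = c \<otimes> (w \<otimes> u)" .
  qed (use rT w t in auto)
  have w_unit: "w \<otimes> (v \<otimes> r') = \<one>" and v_unit: "v \<otimes> (w \<otimes> r') = \<one>"
    using *(3) unfolding 1 using w rT *(2) by (simp_all add: m_ac)
  have "v \<otimes> t = u"
  proof (rule unit_cancel[OF w _ w_unit])
    show "w \<otimes> (v \<otimes> t) = w \<otimes> u" using 2 unfolding 1 using w rT t by (simp add: m_assoc)
  qed (use w rT t *(2) in auto)
  then show ?thesis
    using inner_unitI[OF *(6) _ v_unit] * w by (intro bexI[of _ v]) auto
qed

text \<open>Multiplication by \<open>c\<close> moves \<open>a\<close> and \<open>b\<close> into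
  \<open>R\<close>, where \<open>normalize_pair\<close> applies; \<open>c\<close> then cancels from
  the gcd.\<close>

lemma bezout:
  assumes a: "a \<in> carrier T" and b: "b \<in> carrier T"
  obtains g a' b' x y where "g \<in> carrier T" "a' \<in> carrier T" "b' \<in> carrier T" "x \<in> carrier T" "y \<in> carrier T"
    "a = g \<otimes> a'" "b = g \<otimes> b'" "g = a \<otimes> x \<oplus> b \<otimes> y"
proof (cases "a = \<zero> \<and> b = \<zero>")
  case True
  show thesis by (rule that[of \<zero> \<zero> \<zero> \<zero> \<zero>]) (use True in auto)
next
  case False
  have ac: "a \<otimes> c \<in> carrier R" "b \<otimes> c \<in> carrier R" using C_in_R c_mult_in a b by simp_all
  have nz: "a \<otimes> c \<noteq> \<zero> \<or> b \<otimes> c \<noteq> \<zero>" using False a b c_in c_nonzero integral by blast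
  obtain r r' s u v x y where *: "r \<in> carrier R" "r' \<in> carrier T" "r \<otimes> r' = \<one>" "s \<in> carrier R"
    "u \<in> carrier R" "v \<in> carrier R" "r \<otimes> (a \<otimes> c) = s \<otimes> u" "r \<otimes> (b \<otimes> c) = s \<otimes> v"
    "x \<in> carrier T" "y \<in> carrier T" "s = a \<otimes> c \<otimes> x \<oplus> b \<otimes> c \<otimes> y" "non_zero_divisor T s"
    by (rule normalize_pair[OF ac nz], rule that)
  define g where "g = a \<otimes> x \<oplus> b \<otimes> y"
  have g: "g \<in> carrier T" using * a b by (simp add: g_def)
  have s: "s = c \<otimes> g" unfolding *(11) g_def using *(9,10) a b c_in(1) by algebra
  have T: "r \<in> carrier T" "u \<in> carrier T" "v \<in> carrier T" using * by simp_all
  have "t = g \<otimes> (w \<otimes> r')" if t: "t \<in> carrier T" "w \<in> carrier T" "r \<otimes> (t \<otimes> c) = s \<otimes> w" for t w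
  proof (rule c_cancel)
    have "c \<otimes> t = (r \<otimes> r') \<otimes> (t \<otimes> c)" using *(3) t c_in by (simp add: m_comm)
    also have "\<dots> = (r \<otimes> (t \<otimes> c)) \<otimes> r'" using T *(2) t(1) c_in by algebra
    also have "\<dots> = c \<otimes> (g \<otimes> (w \<otimes> r'))" unfolding t(3) s using t g *(2) c_in by (simp add: m_assoc)
    finally show "c \<otimes> t = c \<otimes> (g \<otimes> (w \<otimes> r'))" .
  qed (use t g * in auto)
  from this[OF a T(2) *(7)] this[OF b T(3) *(8)]
  show thesis using that[OF g _ _ *(9,10) _ _ g_def, of "u \<otimes> r'" "v \<otimes> r'"] T *(2) by blast
qed

lemma finite_bezout:
  assumes "finite S" "S \<subseteq> carrier T"
  shows "\<exists>g\<in>Idl S. \<forall>s\<in>S. \<exists>t\<in>carrier T. s = g \<otimes> t"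
  using assms
proof (induction S rule: finite_induct)
  case empty
  interpret I: ideal "Idl {}" T by (rule genideal_ideal) simp
  show ?case using I.closed_simps(1) by blast
next
  case (insert a S)
  then obtain b where b: "b \<in> Idl S" "\<forall>s\<in>S. \<exists>t\<in>carrier T. s = b \<otimes> t" by auto
  interpret IS: ideal "Idl S" T by (rule genideal_ideal) (use insert in simp)
  interpret I: ideal "Idl (insert a S)" T by (rule genideal_ideal) (use insert in simp)
  have a: "a \<in> carrier T" "a \<in> Idl (insert a S)"
    using insert(4) genideal_self[of "insert a S"] by blast+
  have b': "b \<in> carrier T" "b \<in> Idl (insert a S)"
    using b IS.Icarr subset_Idl_subset[of "insert a S" S] insert(4) by blast+
  obtain g a' b' x y where g: "g \<in> carrier T" "a' \<in> carrier T" "b' \<in> carrier T" "x \<in> carrier T" "y \<in> carrier T"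
    "a = g \<otimes> a'" "b = g \<otimes> b'" "g = a \<otimes> x \<oplus> b \<otimes> y" by (rule bezout[OF a(1) b'(1)], rule that)
  have "a \<otimes> x \<in> Idl (insert a S)" "b \<otimes> y \<in> Idl (insert a S)"
    using I.I_r_closed[OF a(2) g(4)] I.I_r_closed[OF b'(2) g(5)] by simp_all
  then have "g \<in> Idl (insert a S)" unfolding g(8) by (rule I.a_closed)
  moreover have "\<exists>t\<in>carrier T. s = g \<otimes> t" if "s \<in> insert a S" for s
  proof (cases "s = a")
    case True then show ?thesis using g(2,6) by blast
  next
    case False
    then have "s \<in> S" using that by simp
    then obtain t where t: "t \<in> carrier T" "s = b \<otimes> t" using b(2) by blast
    have "s = g \<otimes> (b' \<otimes> t)" unfolding t(2) g(7) using g(1,3) t(1) by (rule m_assoc)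
    then show ?thesis using t(1) g(3) by blast
  qed
  ultimately show ?case by blast
qed

lemma finite_principal:
  assumes S: "finite S" "S \<subseteq> carrier T"
  obtains g where "g \<in> carrier T" "g \<in> Idl S" "Idl S = {g \<otimes> t |t. t \<in> carrier T}"
proof -
  obtain g where g: "g \<in> Idl S" "\<forall>s\<in>S. \<exists>t\<in>carrier T. s = g \<otimes> t" using finite_bezout[OF S] by blast
  interpret IS: ideal "Idl S" T by (rule genideal_ideal[OF S(2)])
  have gT: "g \<in> carrier T" using g IS.Icarr by simp
  have "Idl S \<subseteq> {g \<otimes> t |t. t \<in> carrier T}"
    by (rule genideal_minimal[OF multiples_ideal[OF gT]]) (use g in blast)
  moreover have "{g \<otimes> t |t. t \<in> carrier T} \<subseteq> Idl S" using g IS.I_r_closed by blast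
  ultimately show thesis using that[OF gT g(1)] by blast
qed

end

section \<open>Regular elements and principal ideals of domains\<close>

lemma (in domain) non_zero_divisor_iff: "non_zero_divisor R x \<longleftrightarrow> x \<in> carrier R \<and> x \<noteq> \<zero>"
  unfolding non_zero_divisor_def using integral by (metis one_closed one_not_zero r_null r_one l_null)

lemma (in domain) rickart: "rickart_ring R"
  unfolding rickart_ring_def
proof (intro conjI ballI is_cring)
  fix a assume a: "a \<in> carrier R"
  show "\<exists>e\<in>carrier R. e \<otimes> e = e \<and> e \<otimes> a = a \<and> (\<forall>x\<in>carrier R. a \<otimes> x = \<zero> \<longrightarrow> e \<otimes> x = \<zero>)"
  proof (cases "a = \<zero>")
    case True then show ?thesis by (intro bexI[of _ \<zero>]) auto
  next
    case False then show ?thesis using a integral by (intro bexI[of _ \<one>]) auto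
  qed
qed

lemma (in domain) principal_invertible:
  assumes g: "g \<in> carrier R" "g \<noteq> \<zero>" shows "invertible_ideal R {g \<otimes> t |t. t \<in> carrier R}"
proof -
  let ?I = "{g \<otimes> t |t. t \<in> carrier R}"
  have gI: "g \<in> ?I" using g by (metis (mono_tags, lifting) mem_Collect_eq one_closed r_one)
  have "\<one> \<in> colon R g ?I" by (rule colonI) (use g in auto)
  from ideal_prod.prod[OF gI this, of R] show ?thesis
    using invertible_idealI[OF multiples_ideal[OF g(1)] gI] g by (simp add: non_zero_divisor_iff)
qed

context conductor_two_generated begin

lemma invertible_principal:
  assumes "invertible_ideal T I"
  obtains g where "g \<in> carrier T" "g \<noteq> \<zero>" "I = {g \<otimes> t |t. t \<in> carrier T}"
proof -
  obtain q where q: "q \<in> I" "q \<noteq> \<zero>"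
    using assms by (auto simp: invertible_ideal_def non_zero_divisor_iff)
  obtain S where S: "S \<subseteq> carrier T" "finite S" "I = Idl S"
    using invertible_flat(1)[OF assms] unfolding finitely_generated_ideal_def by blast
  obtain g where g: "g \<in> carrier T" "g \<in> Idl S" "Idl S = {g \<otimes> t |t. t \<in> carrier T}"
    by (rule finite_principal[OF S(2,1)], rule that)
  have "g \<noteq> \<zero>" using q g(3) unfolding S(3) by auto
  then show thesis using that[OF g(1)] g(3) S(3) by simp
qed

text \<open>In a Bezout domain invertible ideals are principal, and the intersection is generated by
  the least common multiple \<open>g a' b'\<close>: the relation \<open>a' x + b' y = 1\<close>
  makes \<open>b'\<close> divide every \<open>m\<close> for which it divides
  \<open>a' m\<close>.\<close>

lemma generalized_gcd_T: "generalized_gcd_ring T"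
  unfolding generalized_gcd_ring_iff[OF rickart]
proof (intro allI impI, elim conjE)
  fix I J assume I: "invertible_ideal T I" and J: "invertible_ideal T J"
  obtain a where a: "a \<in> carrier T" "a \<noteq> \<zero>" "I = {a \<otimes> t |t. t \<in> carrier T}"
    by (rule invertible_principal[OF I], rule that)
  obtain b where b: "b \<in> carrier T" "b \<noteq> \<zero>" "J = {b \<otimes> t |t. t \<in> carrier T}"
    by (rule invertible_principal[OF J], rule that)
  obtain g a' b' x y where g: "g \<in> carrier T" "a' \<in> carrier T" "b' \<in> carrier T" "x \<in> carrier T" "y \<in> carrier T"
    "a = g \<otimes> a'" "b = g \<otimes> b'" "g = a \<otimes> x \<oplus> b \<otimes> y" by (rule bezout[OF a(1) b(1)], rule that)
  have g0: "g \<noteq> \<zero>" using a(2) g(2,6) by auto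
  have ab'0: "a' \<noteq> \<zero>" "b' \<noteq> \<zero>" using a(2) b(2) g(1,6,7) by auto
  have one: "a' \<otimes> x \<oplus> b' \<otimes> y = \<one>"
  proof -
    have "g \<otimes> (a' \<otimes> x \<oplus> b' \<otimes> y) = (g \<otimes> a') \<otimes> x \<oplus> (g \<otimes> b') \<otimes> y" using g(1-5) by algebra
    also have "\<dots> = g \<otimes> \<one>" using g(1) by (simp add: g(6,7,8)[symmetric])
    finally show ?thesis using m_lcancel[OF g0 g(1)] g(2-5) by simp
  qed
  let ?l = "g \<otimes> a' \<otimes> b'"
  have l: "?l \<in> carrier T" "?l \<noteq> \<zero>" using g(1-3) g0 ab'0 by (simp_all add: integral_iff)
  have "I \<inter> J = {?l \<otimes> t |t. t \<in> carrier T}"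
  proof (intro equalityI subsetI)
    fix z assume "z \<in> I \<inter> J"
    then obtain m n where mn: "m \<in> carrier T" "n \<in> carrier T" "z = a \<otimes> m" "z = b \<otimes> n" using a b by blast
    have "g \<otimes> (a' \<otimes> m) = a \<otimes> m" "g \<otimes> (b' \<otimes> n) = b \<otimes> n"
      unfolding g(6,7) using g(1-3) mn(1,2) by (simp_all add: m_assoc)
    then have "g \<otimes> (a' \<otimes> m) = g \<otimes> (b' \<otimes> n)" using mn(3,4) by simp
    then have e: "a' \<otimes> m = b' \<otimes> n" using m_lcancel[OF g0 g(1)] g(2,3) mn(1,2) by simp
    have "m = (a' \<otimes> x \<oplus> b' \<otimes> y) \<otimes> m" using one mn by simp
    also have "\<dots> = (a' \<otimes> m) \<otimes> x \<oplus> b' \<otimes> (y \<otimes> m)" using g(1-5) mn(1) by algebra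
    also have "\<dots> = b' \<otimes> (n \<otimes> x \<oplus> y \<otimes> m)" unfolding e using g(1-5) mn(1,2) by algebra
    finally have m: "m = b' \<otimes> (n \<otimes> x \<oplus> y \<otimes> m)" .
    have w: "n \<otimes> x \<oplus> y \<otimes> m \<in> carrier T" using g(4,5) mn(1,2) by simp
    have "z = ?l \<otimes> (n \<otimes> x \<oplus> y \<otimes> m)"
      unfolding mn(3) g(6) by (subst m) (use g(1-3) w in \<open>simp add: m_assoc\<close>)
    then show "z \<in> {?l \<otimes> t |t. t \<in> carrier T}" using w by blast
  next
    fix z assume "z \<in> {?l \<otimes> t |t. t \<in> carrier T}"
    then obtain t where t: "t \<in> carrier T" "z = ?l \<otimes> t" by blast
    have "z = a \<otimes> (b' \<otimes> t)" "z = b \<otimes> (a' \<otimes> t)"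
      unfolding t(2) g(6,7) using g(1-3) t(1) by algebra+
    moreover have "b' \<otimes> t \<in> carrier T" "a' \<otimes> t \<in> carrier T" using g(2,3) t(1) by simp_all
    ultimately show "z \<in> I \<inter> J" unfolding a(3) b(3) by blast
  qed
  then show "invertible_ideal T (I \<inter> J)" using principal_invertible[OF l] by simp
qed

end

section \<open>Surjective ring homomorphisms\<close>

text \<open>Serves two kinds of surjections: the projection of \<open>R\<close> onto
  \<open>A\<close> and the coordinate projections of \<open>A\<close>.\<close>

locale surjective_ring_hom = R: cring R + S: cring S
  for R :: "('a, 'm) ring_scheme" (structure) and S :: "('b, 'n) ring_scheme" (structure) +
  fixes h :: "'a \<Rightarrow> 'b"
  assumes hom: "h \<in> ring_hom R S" and surj: "h ` carrier R = carrier S"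
begin

lemma h_simps [simp]:
  "x \<in> carrier R \<Longrightarrow> h x \<in> carrier S"
  "x \<in> carrier R \<Longrightarrow> y \<in> carrier R \<Longrightarrow> h (x \<oplus> y) = h x \<oplus>\<^bsub>S\<^esub> h y"
  "x \<in> carrier R \<Longrightarrow> y \<in> carrier R \<Longrightarrow> h (x \<otimes> y) = h x \<otimes>\<^bsub>S\<^esub> h y"
  "h \<one> = \<one>\<^bsub>S\<^esub>"
  using ring_hom_closed[OF hom] ring_hom_add[OF hom] ring_hom_mult[OF hom] ring_hom_one[OF hom] by auto

sublocale H: ring_hom_ring R S h
  by (rule ring_hom_ringI2) (use hom R.ring_axioms S.ring_axioms in auto)

lemma h_minus [simp]: "x \<in> carrier R \<Longrightarrow> y \<in> carrier R \<Longrightarrow> h (x \<ominus> y) = h x \<ominus>\<^bsub>S\<^esub> h y"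
  by (simp add: a_minus_def)

lemma h_eq_iff: "x \<in> carrier R \<Longrightarrow> y \<in> carrier R \<Longrightarrow> h x = h y \<longleftrightarrow> h (x \<ominus> y) = \<zero>\<^bsub>S\<^esub>"
  by (simp add: S.r_right_minus_eq)

lemma lift:
  assumes "y \<in> carrier S" obtains x where "x \<in> carrier R" "h x = y"
  using assms surj by (metis imageE)

definition preimage :: "'b set \<Rightarrow> 'a set" where
  "preimage K = {x \<in> carrier R. h x \<in> K}"

lemma mem_preimage [simp]: "x \<in> preimage K \<longleftrightarrow> x \<in> carrier R \<and> h x \<in> K"
  by (simp add: preimage_def)

lemma preimage_Int: "preimage (K \<inter> L) = preimage K \<inter> preimage L"
  by auto

lemma preimage_ideal: assumes "ideal K S" shows "ideal (preimage K) R"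
proof -
  interpret K: ideal K S by fact
  show ?thesis by (rule R.idealI') (auto simp: K.I_l_closed H.hom_zero)
qed

lemma image_ideal: assumes "ideal I R" shows "ideal (h ` I) S"
proof -
  interpret I: ideal I R by fact
  show ?thesis
  proof (rule S.idealI')
    show "\<zero>\<^bsub>S\<^esub> \<in> h ` I" using H.hom_zero I.closed_simps(1) by (metis imageI)
  next
    fix x y assume "x \<in> h ` I" "y \<in> h ` I"
    then obtain x' y' where "x' \<in> I" "y' \<in> I" "x = h x'" "y = h y'" by blast
    then show "x \<oplus>\<^bsub>S\<^esub> y \<in> h ` I"
      using I.Icarr I.closed_simps(2) by (intro image_eqI[of _ _ "x' \<oplus> y'"]) auto
  next
    fix a x assume a: "a \<in> carrier S" and "x \<in> h ` I"
    then obtain x' where x': "x' \<in> I" "x = h x'" by blast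
    obtain a' where "a' \<in> carrier R" "h a' = a" using a by (rule lift)
    then show "a \<otimes>\<^bsub>S\<^esub> x \<in> h ` I"
      using x' I.Icarr I.I_l_closed by (intro image_eqI[of _ _ "a' \<otimes> x'"]) auto
  qed (use I.Icarr in auto)
qed

text \<open>Since \<open>h\<close> is onto, cofactors for the preimage map to cofactors for
  \<open>K\<close>, and a decomposition of \<open>q\<close> maps to one of \<open>h q\<close>.
  Regularity of \<open>h q\<close> is assumed separately because homomorphisms need not preserve
  it.\<close>

lemma image_invertible:
  assumes K: "ideal K S" and q: "q \<in> preimage K" "non_zero_divisor S (h q)"
    and prod: "q \<in> preimage K \<cdot> colon R q (preimage K)"
  shows "invertible_ideal S K"
proof -
  interpret K: ideal K S by fact
  have qR: "q \<in> carrier R" using q by simp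
  have P: "ideal (preimage K) R" by (rule preimage_ideal[OF K])
  have col: "h v \<in> colon S (h q) K" if v: "v \<in> colon R q (preimage K)" for v
  proof (rule colonI)
    have vR: "v \<in> carrier R" using v by (rule colon_carrier)
    then show "h v \<in> carrier S" by simp
    fix k assume k: "k \<in> K"
    obtain x where x: "x \<in> carrier R" "h x = k" using K.Icarr[OF k] by (rule lift)
    then have "x \<in> preimage K" using k by simp
    with v obtain t where t: "t \<in> carrier R" "v \<otimes> x = q \<otimes> t" by (rule colonE)
    have "h v \<otimes>\<^bsub>S\<^esub> k = h (v \<otimes> x)" using x vR by simp
    then show "\<exists>t\<in>carrier S. h v \<otimes>\<^bsub>S\<^esub> k = h q \<otimes>\<^bsub>S\<^esub> t" using t qR by (intro bexI[of _ "h t"]) simp_all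
  qed
  have "h q \<in> K \<cdot>\<^bsub>S\<^esub> colon S (h q) K"
  proof (rule ideal_prod_map[where f = h, OF prod])
    fix i j assume ij: "i \<in> preimage K" "j \<in> colon R q (preimage K)"
    then show "h (i \<otimes> j) \<in> K \<cdot>\<^bsub>S\<^esub> colon S (h q) K"
      using ideal_prod.prod[of "h i" K "h j" _ S] col[OF ij(2)] colon_carrier[OF ij(2)] by simp
  next
    fix a b assume "a \<in> preimage K \<cdot> colon R q (preimage K)" "b \<in> preimage K \<cdot> colon R q (preimage K)"
    moreover have "preimage K \<subseteq> carrier R" by auto
    ultimately have "a \<in> carrier R" "b \<in> carrier R"
      using R.ideal_prod_in_carrier[OF P R.colon_ideal[OF _ qR]] by blast+
    then show "h (a \<oplus> b) = h a \<oplus>\<^bsub>S\<^esub> h b" by simp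
  qed
  then show ?thesis using S.invertible_idealI[OF K _ q(2)] q(1) by simp
qed

text \<open>\<open>S\<close> is a direct factor of \<open>R\<close>.  Multiplying the lift of a cofactor by \<open>e\<close> removes the error
  term, which lies in the kernel.\<close>

lemma factor_preimage_invertible:
  assumes e: "e \<in> carrier R" "e \<otimes> e = e" and ker: "\<And>x. x \<in> carrier R \<Longrightarrow> h x = \<zero>\<^bsub>S\<^esub> \<longleftrightarrow> e \<otimes> x = \<zero>"
    and K: "invertible_ideal S K"
  shows "invertible_ideal R (preimage K)"
proof -
  obtain q0 where id: "ideal K S" and q0: "q0 \<in> K" "non_zero_divisor S q0" "q0 \<in> K \<cdot>\<^bsub>S\<^esub> colon S q0 K"
    using K by (auto simp: invertible_ideal_def)
  interpret K: ideal K S by (rule id)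
  let ?P = "preimage K"
  have P: "ideal ?P R" by (rule preimage_ideal[OF id])
  interpret P: ideal ?P R by (rule P)
  have eq_if: "e \<otimes> x = e \<otimes> y" if "x \<in> carrier R" "y \<in> carrier R" "h x = h y" for x y
  proof -
    have "h (x \<ominus> y) = \<zero>\<^bsub>S\<^esub>" using that h_eq_iff by blast
    then have "e \<otimes> (x \<ominus> y) = \<zero>" using ker[OF R.minus_closed[OF that(1,2)]] by blast
    moreover have "e \<otimes> (x \<ominus> y) = e \<otimes> x \<ominus> e \<otimes> y" using e(1) that(1,2) by algebra
    ultimately show ?thesis using e(1) that(1,2) by (simp add: R.r_right_minus_eq)
  qed
  have he: "h (e \<otimes> x) = h x" if x: "x \<in> carrier R" for x
  proof -
    have "e \<otimes> (e \<otimes> x \<ominus> x) = e \<otimes> e \<otimes> x \<ominus> e \<otimes> x" using e(1) x by algebra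
    then have "e \<otimes> (e \<otimes> x \<ominus> x) = \<zero>" using e x by (simp add: a_minus_def R.r_neg)
    then have "h (e \<otimes> x \<ominus> x) = \<zero>\<^bsub>S\<^esub>" using ker[of "e \<otimes> x \<ominus> x", THEN iffD2] e x by blast
    then show ?thesis using h_eq_iff[of "e \<otimes> x" x] e x by blast
  qed
  obtain q1 where q1: "q1 \<in> carrier R" "h q1 = q0" using K.Icarr[OF q0(1)] by (rule lift)
  define q where "q = e \<otimes> q1"
  have q: "q \<in> carrier R" "h q = q0" "e \<otimes> q = q"
    using e q1 he[OF q1(1)] by (simp_all add: q_def R.m_assoc[symmetric])
  have qP: "q \<in> ?P" using q q0 by simp
  \<comment> \<open>Elements fixed by \<open>e\<close> are determined by their images. Carrying
    \<open>e \<otimes> w' = w'\<close> through the induction therefore identifies the lift of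
    \<open>q0\<close> with \<open>q\<close>.\<close>
  have *: "\<exists>w'. w' \<in> ?P \<cdot> colon R q ?P \<and> h w' = w \<and> e \<otimes> w' = w'"
    if "w \<in> K \<cdot>\<^bsub>S\<^esub> colon S q0 K" for w
    using that
  proof induction
    case (prod i j)
    obtain x where x: "x \<in> carrier R" "h x = i" using K.Icarr[OF prod(1)] by (rule lift)
    obtain y where y: "y \<in> carrier R" "h y = j" using colon_carrier[OF prod(2)] by (rule lift)
    have "e \<otimes> y \<in> colon R q ?P"
    proof (rule colonI)
      fix p assume p: "p \<in> ?P"
      then have "h p \<in> K" by simp
      with prod(2) obtain t where t: "t \<in> carrier S" "j \<otimes>\<^bsub>S\<^esub> h p = q0 \<otimes>\<^bsub>S\<^esub> t" by (rule colonE)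
      obtain t' where t': "t' \<in> carrier R" "h t' = t" using t(1) by (rule lift)
      have "e \<otimes> (y \<otimes> p) = e \<otimes> (q \<otimes> t')" by (rule eq_if) (use y p q t t' in auto)
      then have "e \<otimes> y \<otimes> p = q \<otimes> t'" using e y p q t' by (simp add: R.m_assoc[symmetric])
      then show "\<exists>t\<in>carrier R. e \<otimes> y \<otimes> p = q \<otimes> t" using t' by blast
    qed (use e y in simp)
    moreover have "x \<in> ?P" using x prod by simp
    ultimately have "x \<otimes> (e \<otimes> y) \<in> ?P \<cdot> colon R q ?P" by (intro ideal_prod.prod)
    moreover have "h (x \<otimes> (e \<otimes> y)) = i \<otimes>\<^bsub>S\<^esub> j" using x y e he[OF y(1)] by (metis R.m_closed h_simps(3))
    moreover have "e \<otimes> (x \<otimes> (e \<otimes> y)) = x \<otimes> (e \<otimes> y)"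
    proof -
      have "e \<otimes> (x \<otimes> (e \<otimes> y)) = x \<otimes> ((e \<otimes> e) \<otimes> y)" using e(1) x(1) y(1) by algebra
      then show ?thesis using e by simp
    qed
    ultimately show ?case by blast
  next
    case (sum s1 s2)
    then obtain w1 w2 where w: "w1 \<in> ?P \<cdot> colon R q ?P" "h w1 = s1" "e \<otimes> w1 = w1"
      "w2 \<in> ?P \<cdot> colon R q ?P" "h w2 = s2" "e \<otimes> w2 = w2" by blast
    have "w1 \<in> carrier R" "w2 \<in> carrier R"
      using w(1,4) R.ideal_prod_in_carrier[OF P R.colon_ideal[OF P.a_subset q(1)]] by blast+
    then show ?case
      using w ideal_prod.sum[OF w(1,4)] e by (intro exI[of _ "w1 \<oplus> w2"]) (simp add: R.r_distr)
  qed
  obtain w where w: "w \<in> ?P \<cdot> colon R q ?P" "h w = q0" "e \<otimes> w = w" using *[OF q0(3)] by blast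
  have wR: "w \<in> carrier R"
    using w(1) R.ideal_prod_in_carrier[OF P R.colon_ideal[OF P.a_subset q(1)]] by blast
  have "w = q" using eq_if[OF wR q(1)] w q by simp
  then have "q \<in> ?P \<cdot> colon R q ?P" using w by simp
  moreover have "e \<otimes> x = \<zero>" if x: "x \<in> carrier R" "q \<otimes> x = \<zero>" for x
  proof -
    have "q0 \<otimes>\<^bsub>S\<^esub> h x = h (q \<otimes> x)" using q x(1) by simp
    then have "q0 \<otimes>\<^bsub>S\<^esub> h x = \<zero>\<^bsub>S\<^esub>" using x H.hom_zero by simp
    then have "h x = \<zero>\<^bsub>S\<^esub>" using q0(2) x(1) unfolding non_zero_divisor_def by simp
    then show ?thesis using ker[OF x(1)] by simp
  qed
  ultimately have "invertible_ideal R {a \<in> carrier R. e \<otimes> a \<in> ?P}"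
    by (rule R.invertible_ideal_extend[OF P e qP])
  moreover have "{a \<in> carrier R. e \<otimes> a \<in> ?P} = ?P" using e he by auto
  ultimately show ?thesis by simp
qed

text \<open>Preimages commute with intersections, so the intersection can be formed in
  \<open>R\<close> and mapped back. A regular \<open>q\<close> stays regular in a direct factor: if
  \<open>h q\<close> kills \<open>h x\<close>, then \<open>q\<close> kills
  \<open>e \<otimes> x\<close>.\<close>

lemma factor_generalized_gcd:
  assumes e: "e \<in> carrier R" "e \<otimes> e = e" and ker: "\<And>x. x \<in> carrier R \<Longrightarrow> h x = \<zero>\<^bsub>S\<^esub> \<longleftrightarrow> e \<otimes> x = \<zero>"
    and R: "rickart_ring R" "generalized_gcd_ring R" and S: "rickart_ring S"
  shows "generalized_gcd_ring S"
  unfolding generalized_gcd_ring_iff[OF S]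
proof (intro allI impI, elim conjE)
  fix K L assume K: "invertible_ideal S K" and L: "invertible_ideal S L"
  have id: "ideal (K \<inter> L) S" using K L S.i_intersect by (simp add: invertible_ideal_def)
  have "invertible_ideal R (preimage K \<inter> preimage L)"
    using R factor_preimage_invertible[OF e ker] K L by (simp add: generalized_gcd_ring_iff)
  then have "invertible_ideal R (preimage (K \<inter> L))" by (simp add: preimage_Int)
  then obtain q where q: "q \<in> preimage (K \<inter> L)" "non_zero_divisor R q"
    "q \<in> preimage (K \<inter> L) \<cdot> colon R q (preimage (K \<inter> L))"
    unfolding invertible_ideal_def by blast
  have qR: "q \<in> carrier R" using q(1) by simp
  have "non_zero_divisor S (h q)"
    unfolding non_zero_divisor_def
  proof (intro conjI ballI impI)
    fix s assume s: "s \<in> carrier S" "h q \<otimes>\<^bsub>S\<^esub> s = \<zero>\<^bsub>S\<^esub>"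
    obtain x where x: "x \<in> carrier R" "h x = s" using s(1) by (rule lift)
    have "h (q \<otimes> x) = \<zero>\<^bsub>S\<^esub>" using s x qR by simp
    then have "e \<otimes> (q \<otimes> x) = \<zero>" using ker[of "q \<otimes> x", THEN iffD1] x qR by blast
    then have "q \<otimes> (e \<otimes> x) = \<zero>" using e x qR by (simp add: R.m_lcomm)
    then have "e \<otimes> x = \<zero>" using q(2) e x unfolding non_zero_divisor_def by simp
    then show "s = \<zero>\<^bsub>S\<^esub>" using ker[OF x(1)] x(2) by simp
  qed (use qR in simp)
  then show "invertible_ideal S (K \<inter> L)" using image_invertible[OF id q(1) _ q(3)] by blast
qed

end

section \<open>Invertible ideals modulo the conductor\<close>

context conductor_two_generated begin

lemma R_nonzero_divisor: "x \<in> carrier R \<Longrightarrow> x \<noteq> \<zero> \<Longrightarrow> non_zero_divisor R x"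
  unfolding non_zero_divisor_def using integral[of x] R_carrier by auto

lemma R_domain: "domain R"
  by (intro domain.intro domain_axioms.intro cring_R) (use integral R_carrier in auto)

lemma inner_unit_nonzero: "s \<in> inner_units \<Longrightarrow> s \<noteq> \<zero>"
  unfolding inner_units_def using one_not_zero by auto

lemma unit_cancel_C:
  assumes s: "s \<in> carrier T" "t \<in> carrier T" "s \<otimes> t = \<one>" and x: "x \<in> carrier T" "s \<otimes> x \<in> C"
  shows "x \<in> C"
proof -
  have "x = (s \<otimes> t) \<otimes> x" using s x by simp
  also have "\<dots> = t \<otimes> (s \<otimes> x)" using s(1,2) x(1) by algebra
  finally show ?thesis using C.I_l_closed[OF x(2) s(2)] by simp
qed

lemma inner_unit_cancel_C:
  "s \<in> inner_units \<Longrightarrow> x \<in> carrier T \<Longrightarrow> s \<otimes> x \<in> C \<Longrightarrow> x \<in> C"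
  using unit_cancel_C inner_unitE R_carrier by metis

text \<open>As \<open>C\<close> is an ideal of \<open>T\<close>, each unit of \<open>T\<close> maps
  it onto itself. So a difference lying in \<open>C\<close> is divisible by any inner unit, with
  quotient again in \<open>C\<close>; this is how congruences modulo \<open>C\<close> become
  equations in \<open>R\<close>.\<close>

lemma inner_unit_divides_C:
  assumes s: "s \<in> inner_units" and x: "x \<in> C"
  obtains x' where "x' \<in> C" "x = s \<otimes> x'"
proof -
  obtain t where t: "t \<in> carrier T" "s \<otimes> t = \<one>" "s \<in> carrier R" using s by (rule inner_unitE)
  have "x = s \<otimes> (t \<otimes> x)" using t x C.Icarr by (simp add: m_assoc[symmetric])
  then show thesis using that[of "t \<otimes> x"] t x C.I_l_closed by blast
qed

lemma C_subset_ideal: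
  assumes U: "ideal U R" and p: "p \<in> U" "p \<in> inner_units" shows "C \<subseteq> U"
proof
  fix x assume "x \<in> C"
  then obtain x' where "x' \<in> C" "x = p \<otimes> x'" using inner_unit_divides_C[OF p(2)] by blast
  then show "x \<in> U" using R_idealD(6)[OF U _ p(1)] C_in_R by simp
qed

text \<open>Let \<open>d\<close> generate \<open>C\<close> and let \<open>g\<close> be a gcd of
  \<open>a\<close> and \<open>d\<close>, with \<open>d = g d'\<close>. Then \<open>a d'\<close> is a
  multiple of \<open>d\<close>, so regularity of \<open>a\<close> modulo \<open>C\<close> forces
  \<open>d'\<close> into \<open>C\<close>; thus \<open>d\<close> divides \<open>d'\<close>, and
  \<open>g\<close> is a unit. Hence \<open>a T + C = T\<close>, and clearing the denominator of the
  coefficient of \<open>a\<close> turns \<open>\<one>\<close> into an inner unit.\<close>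

lemma regular_mod_C:
  assumes a: "a \<in> carrier R" and reg: "\<And>x. x \<in> carrier R \<Longrightarrow> a \<otimes> x \<in> C \<Longrightarrow> x \<in> C"
  obtains s z y where "s \<in> inner_units" "z \<in> carrier R" "y \<in> C" "s = a \<otimes> z \<oplus> y"
proof -
  have aT: "a \<in> carrier T" using a by simp
  obtain d where "d \<in> carrier T" "C = Idl {d}" using principalideal.generate[OF C_principal] by blast
  then have d: "d \<in> carrier T" "C = {t \<otimes> d |t. t \<in> carrier T}"
    using cgenideal_eq_genideal[of d] unfolding cgenideal_def by auto
  have dC: "d \<in> C" unfolding d(2) using d(1) l_one one_closed by (metis (mono_tags, lifting) mem_Collect_eq)
  have d0: "d \<noteq> \<zero>" using c(1) c_nonzero unfolding d(2) by auto
  obtain g a' d' x y where g: "g \<in> carrier T" "a' \<in> carrier T" "d' \<in> carrier T" "x \<in> carrier T" "y \<in> carrier T"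
    "a = g \<otimes> a'" "d = g \<otimes> d'" "g = a \<otimes> x \<oplus> d \<otimes> y" by (rule bezout[OF aT d(1)], rule that)
  \<comment> \<open>The hypothesis \<open>reg\<close> speaks of elements of \<open>R\<close>, so
    \<open>d'\<close> is first multiplied by an inner unit, which cancels from
    \<open>C\<close>.\<close>
  obtain \<sigma>1 where \<sigma>1: "\<sigma>1 \<in> inner_units" "\<sigma>1 \<otimes> d' \<in> carrier R" using denominator[OF g(3)] by blast
  have \<sigma>1T: "\<sigma>1 \<in> carrier T" using \<sigma>1(1) inner_units_carrier by simp
  have "a \<otimes> (\<sigma>1 \<otimes> d') = (\<sigma>1 \<otimes> a') \<otimes> (g \<otimes> d')" unfolding g(6) using g(1-3) \<sigma>1T by algebra
  then have "a \<otimes> (\<sigma>1 \<otimes> d') = (\<sigma>1 \<otimes> a') \<otimes> d" using g(7) by simp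
  then have "a \<otimes> (\<sigma>1 \<otimes> d') \<in> C" using C.I_l_closed[OF dC, of "\<sigma>1 \<otimes> a'"] \<sigma>1T g(2) by simp
  then have "\<sigma>1 \<otimes> d' \<in> C" by (rule reg[OF \<sigma>1(2)])
  then have "d' \<in> C" by (rule inner_unit_cancel_C[OF \<sigma>1(1) g(3)])
  then obtain t where t: "t \<in> carrier T" "d' = t \<otimes> d" unfolding d(2) by blast
  have "d \<otimes> (g \<otimes> t) = g \<otimes> (t \<otimes> d)" using d(1) g(1) t(1) by algebra
  also have "\<dots> = d \<otimes> \<one>" using g(7) t(2) d(1) by simp
  finally have gt: "g \<otimes> t = \<one>" using m_lcancel[OF d0 d(1)] g(1) t(1) by simp
  obtain \<sigma> where \<sigma>: "\<sigma> \<in> inner_units" "\<sigma> \<otimes> (x \<otimes> t) \<in> carrier R" using denominator[of "x \<otimes> t"] g(4) t(1) by auto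
  have \<sigma>T: "\<sigma> \<in> carrier T" using \<sigma>(1) inner_units_carrier by simp
  have "\<sigma> = \<sigma> \<otimes> (g \<otimes> t)" using gt \<sigma>T by simp
  also have "\<dots> = \<sigma> \<otimes> ((a \<otimes> x \<oplus> d \<otimes> y) \<otimes> t)" using g(8) by simp
  also have "\<dots> = a \<otimes> (\<sigma> \<otimes> (x \<otimes> t)) \<oplus> (\<sigma> \<otimes> y \<otimes> t) \<otimes> d"
    using \<sigma>T aT d(1) g(4,5) t(1) by algebra
  finally have "\<sigma> = a \<otimes> (\<sigma> \<otimes> (x \<otimes> t)) \<oplus> (\<sigma> \<otimes> y \<otimes> t) \<otimes> d" .
  moreover have "(\<sigma> \<otimes> y \<otimes> t) \<otimes> d \<in> C" using C.I_l_closed[OF dC] \<sigma>T g(5) t(1) by simp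
  ultimately show thesis using that[OF \<sigma>] by blast
qed

end

text \<open>\<open>A\<close> is reached through an abstract surjection with kernel \<open>C\<close>,
  so that no cosets appear, and through the idempotents of \<open>A_rickart\<close>, which replace
  coordinates.\<close>

locale conductor_quotient = conductor_two_generated T R C c + Q: surjective_ring_hom R A \<pi>
  for T :: "('a, 'k) ring_scheme" (structure) and R :: "('a, 'm) ring_scheme" and C c
    and A :: "('c, 'n) ring_scheme" and \<pi> +
  assumes ker: "\<And>x. x \<in> carrier R \<Longrightarrow> \<pi> x = \<zero>\<^bsub>A\<^esub> \<longleftrightarrow> x \<in> C"
    and A_rickart: "rickart_ring A"
begin

lemma pi_mult [simp]: "x \<in> carrier R \<Longrightarrow> y \<in> carrier R \<Longrightarrow> \<pi> (x \<otimes> y) = \<pi> x \<otimes>\<^bsub>A\<^esub> \<pi> y"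
  using Q.h_simps(3)[of x y] by simp

lemma pi_add [simp]: "x \<in> carrier R \<Longrightarrow> y \<in> carrier R \<Longrightarrow> \<pi> (x \<oplus> y) = \<pi> x \<oplus>\<^bsub>A\<^esub> \<pi> y"
  using Q.h_simps(2)[of x y] by simp

lemma pi_one [simp]: "\<pi> \<one> = \<one>\<^bsub>A\<^esub>"
  using Q.h_simps(4) by simp

lemma pi_minus [simp]: "x \<in> carrier R \<Longrightarrow> y \<in> carrier R \<Longrightarrow> \<pi> (x \<ominus> y) = \<pi> x \<ominus>\<^bsub>A\<^esub> \<pi> y"
  using Q.h_minus[of x y] by (simp add: R_minus)

lemma pi_eq_iff: "x \<in> carrier R \<Longrightarrow> y \<in> carrier R \<Longrightarrow> \<pi> x = \<pi> y \<longleftrightarrow> x \<ominus> y \<in> C"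
  using ker[of "x \<ominus> y"] by (simp add: Q.S.r_right_minus_eq)

lemma pi_C: "x \<in> C \<Longrightarrow> \<pi> x = \<zero>\<^bsub>A\<^esub>"
  using ker C_in_R by blast

lemma pi_nonzero_divisor_iff:
  assumes a: "a \<in> carrier R"
  shows "non_zero_divisor A (\<pi> a) \<longleftrightarrow> (\<forall>x\<in>carrier R. a \<otimes> x \<in> C \<longrightarrow> x \<in> C)"
proof
  assume n: "non_zero_divisor A (\<pi> a)"
  show "\<forall>x\<in>carrier R. a \<otimes> x \<in> C \<longrightarrow> x \<in> C"
  proof (intro ballI impI)
    fix x assume x: "x \<in> carrier R" "a \<otimes> x \<in> C"
    have "\<pi> a \<otimes>\<^bsub>A\<^esub> \<pi> x = \<zero>\<^bsub>A\<^esub>" using pi_C[OF x(2)] x a by simp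
    then have "\<pi> x = \<zero>\<^bsub>A\<^esub>" using n x(1) unfolding non_zero_divisor_def by simp
    then show "x \<in> C" using ker x by simp
  qed
next
  assume *: "\<forall>x\<in>carrier R. a \<otimes> x \<in> C \<longrightarrow> x \<in> C"
  show "non_zero_divisor A (\<pi> a)"
    unfolding non_zero_divisor_def
  proof (intro conjI ballI impI)
    fix y assume y: "y \<in> carrier A" "\<pi> a \<otimes>\<^bsub>A\<^esub> y = \<zero>\<^bsub>A\<^esub>"
    obtain x where x: "x \<in> carrier R" "\<pi> x = y" using y(1) by (rule Q.lift)
    have "\<pi> (a \<otimes> x) = \<zero>\<^bsub>A\<^esub>" using x y a by simp
    then have "a \<otimes> x \<in> C" using ker[of "a \<otimes> x", THEN iffD1] R_closed(6)[OF a x(1)] by blast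
    then have "x \<in> C" using * x by blast
    then show "y = \<zero>\<^bsub>A\<^esub>" using pi_C x by simp
  qed (use a in simp)
qed

text \<open>An inner unit need not become a unit of \<open>A\<close>, because its inverse may lie
  outside \<open>R\<close>; but it cancels from \<open>C\<close>.\<close>

lemma inner_unit_regular: "s \<in> inner_units \<Longrightarrow> non_zero_divisor A (\<pi> s)"
  using pi_nonzero_divisor_iff inner_units_carrier inner_unit_cancel_C R_carrier by metis

text \<open>Together with \<open>inner_unit_regular\<close>, this makes inner units cofinal among
  the regular elements of \<open>A\<close> with respect to divisibility, so they can always serve as
  witnesses.\<close>

lemma regular_lift:
  assumes "a \<in> carrier R" "non_zero_divisor A (\<pi> a)"
  obtains s z where "s \<in> inner_units" "z \<in> carrier R" "\<pi> s = \<pi> a \<otimes>\<^bsub>A\<^esub> \<pi> z"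
proof -
  have "x \<in> C" if "x \<in> carrier R" "a \<otimes> x \<in> C" for x
    using that pi_nonzero_divisor_iff[OF assms(1)] assms(2) by blast
  then obtain s z y where s: "s \<in> inner_units" "z \<in> carrier R" "y \<in> C" "s = a \<otimes> z \<oplus> y"
    using regular_mod_C[OF assms(1)] by metis
  have "\<pi> s = \<pi> a \<otimes>\<^bsub>A\<^esub> \<pi> z"
    unfolding s(4) using s(2) assms(1) pi_C[OF s(3)] C_in_R[OF s(3)] by simp
  then show thesis using that s by blast
qed

text \<open>The witness is taken to be an inner unit \<open>s\<close>, which
  \<open>regular_lift\<close> finds in the preimage. A decomposition of \<open>\<pi> s\<close> lifts
  to some \<open>w\<close> with \<open>s - w\<close> in \<open>C\<close>, and this difference is
  \<open>s d\<close> with \<open>d\<close> in \<open>C\<close>. As \<open>C\<close> is contained in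
  the colon ideal of \<open>s\<close>, the error \<open>s d\<close> itself lies in the product
  ideal.\<close>

lemma preimage_invertible:
  assumes K: "invertible_ideal A K"
  shows "invertible_ideal R (Q.preimage K)" and "\<exists>p\<in>inner_units. p \<in> Q.preimage K"
proof -
  let ?P = "Q.preimage K"
  obtain q0 where id: "ideal K A" and q0: "q0 \<in> K" "non_zero_divisor A q0"
    using K by (auto simp: invertible_ideal_def)
  interpret K: ideal K A by (rule id)
  have P: "ideal ?P R" by (rule Q.preimage_ideal[OF id])
  interpret P: ideal ?P R by (rule P)
  obtain q where q: "q \<in> carrier R" "\<pi> q = q0" using K.Icarr[OF q0(1)] by (rule Q.lift)
  obtain s z where s: "s \<in> inner_units" "z \<in> carrier R" "\<pi> s = \<pi> q \<otimes>\<^bsub>A\<^esub> \<pi> z"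
    using regular_lift[OF q(1)] q(2) q0(2) by metis
  have sR: "s \<in> carrier R" using s(1) by (rule inner_units_carrier)
  have sK: "\<pi> s \<in> K" unfolding s(3) q(2) using K.I_r_closed[OF q0(1)] s(2) by simp
  then have sP: "s \<in> ?P" using sR by simp
  then show "\<exists>p\<in>inner_units. p \<in> ?P" using s(1) by blast
  have col: "ideal (colon R s ?P) R" by (rule R.colon_ideal[OF P.a_subset sR])
  have CP: "C \<subseteq> ?P" by (rule C_subset_ideal[OF P sP s(1)])
  have C_col: "v \<in> colon R s ?P" if v: "v \<in> C" for v
  proof (rule colonI)
    fix p assume p: "p \<in> ?P"
    then have "p \<in> carrier R" by simp
    then have "v \<otimes> p \<in> C" using v R_idealD(6)[OF C_R] by simp
    then obtain t where "t \<in> C" "v \<otimes> p = s \<otimes> t" by (rule inner_unit_divides_C[OF s(1)])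
    then show "\<exists>t\<in>carrier R. v \<otimes>\<^bsub>R\<^esub> p = s \<otimes>\<^bsub>R\<^esub> t" using C_in_R by (intro bexI[of _ t]) simp_all
  qed (rule C_in_R[OF v])
  have *: "\<exists>w'. w' \<in> ?P \<cdot>\<^bsub>R\<^esub> colon R s ?P \<and> \<pi> w' = w" if "w \<in> K \<cdot>\<^bsub>A\<^esub> colon A (\<pi> s) K" for w
    using that
  proof induction
    case (prod i j)
    obtain x where x: "x \<in> carrier R" "\<pi> x = i" using K.Icarr[OF prod(1)] by (rule Q.lift)
    obtain y where y: "y \<in> carrier R" "\<pi> y = j" using colon_carrier[OF prod(2)] by (rule Q.lift)
    have "y \<in> colon R s ?P"
    proof (rule colonI)
      fix p assume p: "p \<in> ?P"
      then have pR: "p \<in> carrier R" and "\<pi> p \<in> K" by auto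
      from prod(2) this(2) obtain t where t: "t \<in> carrier A" "j \<otimes>\<^bsub>A\<^esub> \<pi> p = \<pi> s \<otimes>\<^bsub>A\<^esub> t" by (rule colonE)
      obtain t' where t': "t' \<in> carrier R" "\<pi> t' = t" using t(1) by (rule Q.lift)
      have "\<pi> (y \<otimes> p) = \<pi> (s \<otimes> t')" using y pR sR t t' by simp
      then have "y \<otimes> p \<ominus> s \<otimes> t' \<in> C" using pi_eq_iff[of "y \<otimes> p" "s \<otimes> t'"] y(1) pR sR t'(1) by simp
      then obtain d where d: "d \<in> C" "y \<otimes> p \<ominus> s \<otimes> t' = s \<otimes> d" by (rule inner_unit_divides_C[OF s(1)])
      have dR: "d \<in> carrier R" using C_in_R d by simp
      have "y \<otimes> p = (y \<otimes> p \<ominus> s \<otimes> t') \<oplus> s \<otimes> t'"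
        using y(1)[THEN R_carrier] pR[THEN R_carrier] sR[THEN R_carrier] t'(1)[THEN R_carrier] by algebra
      also have "\<dots> = s \<otimes> (d \<oplus> t')" unfolding d(2) using dR sR t'(1) by (simp add: r_distr)
      finally show "\<exists>t\<in>carrier R. y \<otimes>\<^bsub>R\<^esub> p = s \<otimes>\<^bsub>R\<^esub> t" using dR t' by (intro bexI[of _ "d \<oplus> t'"]) simp_all
    qed (rule y(1))
    moreover have "x \<in> ?P" using x prod by simp
    ultimately have "x \<otimes>\<^bsub>R\<^esub> y \<in> ?P \<cdot>\<^bsub>R\<^esub> colon R s ?P" by (intro ideal_prod.prod)
    then show ?case using x y by (intro exI[of _ "x \<otimes> y"]) simp
  next
    case (sum s1 s2)
    then obtain w1 w2 where w: "w1 \<in> ?P \<cdot>\<^bsub>R\<^esub> colon R s ?P" "\<pi> w1 = s1"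
      "w2 \<in> ?P \<cdot>\<^bsub>R\<^esub> colon R s ?P" "\<pi> w2 = s2" by blast
    have "w1 \<in> carrier R" "w2 \<in> carrier R" using w(1,3) R.ideal_prod_in_carrier[OF P col] by blast+
    then show ?case using w ideal_prod.sum[OF w(1,3)] by (intro exI[of _ "w1 \<oplus>\<^bsub>R\<^esub> w2"]) simp
  qed
  obtain w where w: "w \<in> ?P \<cdot>\<^bsub>R\<^esub> colon R s ?P" "\<pi> w = \<pi> s"
    using *[OF Q.S.invertible_ideal_any[OF K sK]] by blast
  have wR: "w \<in> carrier R" using w(1) R.ideal_prod_in_carrier[OF P col] by blast
  have "s \<ominus> w \<in> C" using pi_eq_iff[OF sR wR] w(2) by simp
  then obtain d where d: "d \<in> C" "s \<ominus> w = s \<otimes> d" by (rule inner_unit_divides_C[OF s(1)])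
  have "w \<oplus>\<^bsub>R\<^esub> s \<otimes>\<^bsub>R\<^esub> d \<in> ?P \<cdot>\<^bsub>R\<^esub> colon R s ?P"
    by (rule ideal_prod.sum[OF w(1) ideal_prod.prod[OF sP C_col[OF d(1)]]])
  moreover have "w \<oplus>\<^bsub>R\<^esub> s \<otimes>\<^bsub>R\<^esub> d = s"
  proof -
    have "w \<oplus> (s \<ominus> w) = s" using wR[THEN R_carrier] sR[THEN R_carrier] by algebra
    then show ?thesis using d(2) by simp
  qed
  ultimately have "s \<in> ?P \<cdot>\<^bsub>R\<^esub> colon R s ?P" by simp
  then show "invertible_ideal R ?P"
    by (rule R.invertible_idealI[OF P sP R_nonzero_divisor[OF sR inner_unit_nonzero[OF s(1)]]])
qed

text \<open>An ideal meeting the inner units contains \<open>C\<close>, so it is the full preimage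
  of its image, and \<open>p\<close> has a regular image; the general statement on surjections
  applies.\<close>

lemma image_invertible:
  assumes U: "invertible_ideal R U" and p: "p \<in> U" "p \<in> inner_units"
  shows "invertible_ideal A (\<pi> ` U)"
proof -
  have id: "ideal U R" using U by (simp add: invertible_ideal_def)
  have CU: "C \<subseteq> U" by (rule C_subset_ideal[OF id p])
  have "Q.preimage (\<pi> ` U) = U"
  proof (intro equalityI subsetI)
    fix x assume "x \<in> Q.preimage (\<pi> ` U)"
    then obtain u where u: "x \<in> carrier R" "u \<in> U" "\<pi> x = \<pi> u" by auto
    have uR: "u \<in> carrier R" using R_idealD(1)[OF id u(2)] .
    have "x \<ominus> u \<in> U" using u uR pi_eq_iff CU by auto
    then have "(x \<ominus> u) \<oplus> u \<in> U" using R_idealD(3)[OF id] u by blast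
    moreover have "(x \<ominus> u) \<oplus> u = x" using u(1)[THEN R_carrier] uR[THEN R_carrier] by algebra
    ultimately show "x \<in> U" by simp
  qed (use R_idealD(1)[OF id] in auto)
  then show ?thesis
    using Q.image_invertible[OF Q.image_ideal[OF id], of p] p inner_unit_regular[OF p(2)]
      R.invertible_ideal_any[OF U p(1)] by simp
qed

lemma generalized_gcd_A_if_R:
  assumes "generalized_gcd_ring R" shows "generalized_gcd_ring A"
  unfolding generalized_gcd_ring_iff[OF A_rickart]
proof (intro allI impI, elim conjE)
  fix K L assume K: "invertible_ideal A K" and L: "invertible_ideal A L"
  let ?P = "Q.preimage (K \<inter> L)"
  have id: "ideal K A" "ideal L A" using K L by (simp_all add: invertible_ideal_def)
  have inv: "invertible_ideal R ?P"
    unfolding Q.preimage_Int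
    using assms preimage_invertible(1)[OF K] preimage_invertible(1)[OF L]
    by (simp add: generalized_gcd_ring_iff[OF domain.rickart[OF R_domain]])
  obtain p p' where p: "p \<in> inner_units" "p \<in> Q.preimage K" "p' \<in> inner_units" "p' \<in> Q.preimage L"
    using preimage_invertible(2)[OF K] preimage_invertible(2)[OF L] by blast
  have "p \<otimes> p' \<in> ?P"
    unfolding Q.preimage_Int
    using R_idealD(6)[OF Q.preimage_ideal[OF id(1)], of p' p] R_idealD(5)[OF Q.preimage_ideal[OF id(2)], of p p']
      p inner_units_carrier by simp
  then have "invertible_ideal A (\<pi> ` ?P)"
    by (rule image_invertible[OF inv _ inner_units_mult[OF p(1,3)]])
  moreover have "\<pi> ` ?P = K \<inter> L"
  proof (intro equalityI subsetI)
    interpret K: ideal K A by (rule id)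
    fix y assume y: "y \<in> K \<inter> L"
    obtain x where "x \<in> carrier R" "\<pi> x = y" using K.Icarr[of y] y Q.lift by blast
    then show "y \<in> \<pi> ` ?P" using y by force
  qed auto
  ultimately show "invertible_ideal A (K \<inter> L)" by simp
qed

text \<open>Adding the complement of \<open>e\<close> to \<open>a\<close> fills the factor on which
  \<open>a\<close> vanishes modulo \<open>C\<close>, so \<open>k\<close> is regular modulo
  \<open>C\<close> and \<open>a\<close> becomes \<open>e k\<close>. An inner unit divisible by
  \<open>k\<close> modulo \<open>C\<close> is then chosen; its cofactor \<open>z\<close> is regular
  as a factor of a regular element.\<close>

lemma regular_complement:
  assumes a: "a \<in> carrier R"
  obtains e k z s where "e \<in> carrier R" "k \<in> carrier R" "z \<in> carrier R" "s \<in> inner_units"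
    "\<pi> e \<otimes>\<^bsub>A\<^esub> \<pi> e = \<pi> e" "\<pi> e \<otimes>\<^bsub>A\<^esub> \<pi> a = \<pi> a" "\<pi> e \<otimes>\<^bsub>A\<^esub> \<pi> k = \<pi> a" "\<pi> s = \<pi> k \<otimes>\<^bsub>A\<^esub> \<pi> z"
    "non_zero_divisor A (\<pi> z)"
proof -
  obtain e0 where e0: "e0 \<in> carrier A" "e0 \<otimes>\<^bsub>A\<^esub> e0 = e0" "e0 \<otimes>\<^bsub>A\<^esub> \<pi> a = \<pi> a"
    "\<And>x. x \<in> carrier A \<Longrightarrow> \<pi> a \<otimes>\<^bsub>A\<^esub> x = \<zero>\<^bsub>A\<^esub> \<Longrightarrow> e0 \<otimes>\<^bsub>A\<^esub> x = \<zero>\<^bsub>A\<^esub>"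
    using A_rickart Q.h_simps(1)[OF a] unfolding rickart_ring_def by meson
  obtain e where e: "e \<in> carrier R" "\<pi> e = e0" using e0(1) by (rule Q.lift)
  define k where "k = a \<oplus> (\<one> \<ominus> e)"
  have k: "k \<in> carrier R" using a e by (simp add: k_def)
  have pk: "\<pi> k = \<pi> a \<oplus>\<^bsub>A\<^esub> (\<one>\<^bsub>A\<^esub> \<ominus>\<^bsub>A\<^esub> e0)" using a e by (simp add: k_def)
  have "non_zero_divisor A (e0 \<otimes>\<^bsub>A\<^esub> \<pi> a \<oplus>\<^bsub>A\<^esub> (\<one>\<^bsub>A\<^esub> \<ominus>\<^bsub>A\<^esub> e0))"
    by (rule Q.S.nonzero_divisor_complement) (use e0 a in auto)
  then have n: "non_zero_divisor A (\<pi> k)" using pk e0(3) by simp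
  obtain s z where s: "s \<in> inner_units" "z \<in> carrier R" "\<pi> s = \<pi> k \<otimes>\<^bsub>A\<^esub> \<pi> z"
    by (rule regular_lift[OF k n], rule that)
  have "non_zero_divisor A (\<pi> z)"
    using Q.S.nonzero_divisor_factor[of "\<pi> k" "\<pi> z"] inner_unit_regular[OF s(1)] s k by simp
  moreover have "e0 \<otimes>\<^bsub>A\<^esub> \<pi> k = \<pi> a"
    unfolding pk using e0 a Q.S.idempotent_complement[OF e0(1,2)] by (simp add: Q.S.r_distr)
  ultimately show thesis using that[OF e(1) k s(2,1)] e(2) e0 s(3) by simp
qed

text \<open>Write \<open>\<kappa> = e k\<close>, \<open>\<kappa>' = e' k'\<close> modulo \<open>C\<close> with \<open>k\<close>, \<open>k'\<close> regular, and \<open>s = k z\<close>, \<open>s' = k' z'\<close>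
  modulo \<open>C\<close> with \<open>s\<close>, \<open>s'\<close> units of \<open>T\<close>.  Then \<open>\<kappa> U \<inter> \<kappa>' U' = \<kappa> \<kappa>' W\<close> for
  \<open>W = {w \<in> T. \<kappa>' w \<in> U \<and> \<kappa> w \<in> U'}\<close>, and \<open>s s' W\<close> is the preimage in \<open>R\<close> of an intersection of two
  invertible ideals of \<open>A\<close>.\<close>

lemma coprime_scaled_intersection:
  assumes gcd: "generalized_gcd_ring A"
    and U: "invertible_ideal R U" "p \<in> U" "p \<in> inner_units"
    and U': "invertible_ideal R U'" "p' \<in> U'" "p' \<in> inner_units"
    and \<kappa>: "\<kappa> \<in> carrier R" "\<kappa> \<noteq> \<zero>" and \<kappa>': "\<kappa>' \<in> carrier R" "\<kappa>' \<noteq> \<zero>"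
    and \<alpha>\<gamma>: "\<alpha> \<in> carrier T" "\<gamma> \<in> carrier T" "\<kappa> \<otimes> \<alpha> \<oplus> \<kappa>' \<otimes> \<gamma> = \<one>"
  shows "invertible_ideal R ((\<lambda>x. \<kappa> \<otimes> x) ` U \<inter> (\<lambda>x. \<kappa>' \<otimes> x) ` U')"
proof -
  have idU: "ideal U R" "ideal U' R" using U U' by (simp_all add: invertible_ideal_def)
  have CU: "C \<subseteq> U" "C \<subseteq> U'" using C_subset_ideal[OF idU(1) U(2,3)] C_subset_ideal[OF idU(2) U'(2,3)] by auto
  obtain e k z s where e: "e \<in> carrier R" "k \<in> carrier R" "z \<in> carrier R" "s \<in> inner_units"
    "\<pi> e \<otimes>\<^bsub>A\<^esub> \<pi> e = \<pi> e" "\<pi> e \<otimes>\<^bsub>A\<^esub> \<pi> \<kappa> = \<pi> \<kappa>" "\<pi> e \<otimes>\<^bsub>A\<^esub> \<pi> k = \<pi> \<kappa>" "\<pi> s = \<pi> k \<otimes>\<^bsub>A\<^esub> \<pi> z"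
    "non_zero_divisor A (\<pi> z)" by (rule regular_complement[OF \<kappa>(1)], rule that)
  obtain e' k' z' s' where e': "e' \<in> carrier R" "k' \<in> carrier R" "z' \<in> carrier R" "s' \<in> inner_units"
    "\<pi> e' \<otimes>\<^bsub>A\<^esub> \<pi> e' = \<pi> e'" "\<pi> e' \<otimes>\<^bsub>A\<^esub> \<pi> \<kappa>' = \<pi> \<kappa>'" "\<pi> e' \<otimes>\<^bsub>A\<^esub> \<pi> k' = \<pi> \<kappa>'" "\<pi> s' = \<pi> k' \<otimes>\<^bsub>A\<^esub> \<pi> z'"
    "non_zero_divisor A (\<pi> z')" by (rule regular_complement[OF \<kappa>'(1)], rule that)
  have sR: "s \<in> carrier R" "s' \<in> carrier R" using e(4) e'(4) inner_units_carrier by auto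
  \<comment> \<open>\<open>\<alpha>\<close>, \<open>\<gamma>\<close> and the quotient
    \<open>w\<close> constructed below lie only in \<open>T\<close>, so congruences modulo
    \<open>C\<close> are computed in \<open>T/C\<close>; on elements of \<open>R\<close> they agree
    with equality under \<open>\<pi>\<close>.\<close>
  define B where "B = T Quot C"
  define \<beta> where "\<beta> = (+>) C"
  interpret B: ring_hom_cring T B \<beta> unfolding B_def \<beta>_def by (rule C.rcos_ring_hom_cring[OF is_cring])
  have \<beta>0: "\<beta> x = \<zero>\<^bsub>B\<^esub> \<longleftrightarrow> x \<in> C" if "x \<in> carrier T" for x
    using that C.rcos_const_imp_mem[of x] a_rcos_zero[OF C_T, of x] by (auto simp: B_def \<beta>_def FactRing_def)
  have \<beta>_eq: "\<beta> x = \<beta> y \<longleftrightarrow> x \<ominus> y \<in> C" if "x \<in> carrier T" "y \<in> carrier T" for x y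
    using \<beta>0[of "x \<ominus> y"] that by (simp add: a_minus_def B.S.r_right_minus_eq[unfolded a_minus_def])
  have \<beta>_pi: "\<beta> x = \<beta> y" if "x \<in> carrier R" "y \<in> carrier R" "\<pi> x = \<pi> y" for x y
    using pi_eq_iff[OF that(1,2)] \<beta>_eq[of x y] that by simp
  note TR = e(1-3)[THEN R_carrier] e'(1-3)[THEN R_carrier] sR[THEN R_carrier] \<kappa>(1)[THEN R_carrier] \<kappa>'(1)[THEN R_carrier]
  define E K Z S where "E = \<beta> e" and "K = \<beta> k" and "Z = \<beta> z" and "S = \<beta> s"
  define E' K' Z' S' where "E' = \<beta> e'" and "K' = \<beta> k'" and "Z' = \<beta> z'" and "S' = \<beta> s'"
  have Bc [simp]: "E \<in> carrier B" "K \<in> carrier B" "Z \<in> carrier B" "S \<in> carrier B"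
    "E' \<in> carrier B" "K' \<in> carrier B" "Z' \<in> carrier B" "S' \<in> carrier B"
    using TR by (auto simp: E_def K_def Z_def S_def E'_def K'_def Z'_def S'_def)
  have "\<beta> (e \<otimes> e) = \<beta> e" "\<beta> (e \<otimes> k) = \<beta> \<kappa>" "\<beta> s = \<beta> (k \<otimes> z)"
    by (rule \<beta>_pi; use e \<kappa> sR in simp)+
  then have E: "E \<otimes>\<^bsub>B\<^esub> E = E" "\<beta> \<kappa> = E \<otimes>\<^bsub>B\<^esub> K" "S = K \<otimes>\<^bsub>B\<^esub> Z"
    using TR by (simp_all add: E_def K_def Z_def S_def)
  have "\<beta> (e' \<otimes> e') = \<beta> e'" "\<beta> (e' \<otimes> k') = \<beta> \<kappa>'" "\<beta> s' = \<beta> (k' \<otimes> z')"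
    by (rule \<beta>_pi; use e' \<kappa>' sR in simp)+
  then have E': "E' \<otimes>\<^bsub>B\<^esub> E' = E'" "\<beta> \<kappa>' = E' \<otimes>\<^bsub>B\<^esub> K'" "S' = K' \<otimes>\<^bsub>B\<^esub> Z'"
    using TR by (simp_all add: E'_def K'_def Z'_def S'_def)
  \<comment> \<open>Multiply \<open>\<kappa> \<alpha> + \<kappa>' \<gamma> = 1\<close> by the
    product of the complements: modulo \<open>C\<close>, \<open>e\<close> divides
    \<open>\<kappa>\<close> and \<open>e'\<close> divides \<open>\<kappa>'\<close>, so each term on
    the left vanishes.\<close>
  have comp: "(\<one> \<ominus> e) \<otimes> (\<one> \<ominus> e') \<in> C"
  proof -
    have "\<one>\<^bsub>B\<^esub> = (E \<otimes>\<^bsub>B\<^esub> K) \<otimes>\<^bsub>B\<^esub> \<beta> \<alpha> \<oplus>\<^bsub>B\<^esub> (E' \<otimes>\<^bsub>B\<^esub> K') \<otimes>\<^bsub>B\<^esub> \<beta> \<gamma>"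
      unfolding E(2)[symmetric] E'(2)[symmetric] using \<alpha>\<gamma> TR by (metis B.hom_add B.hom_mult B.hom_one m_closed)
    then have one: "F \<otimes>\<^bsub>B\<^esub> F' = ((E \<otimes>\<^bsub>B\<^esub> K) \<otimes>\<^bsub>B\<^esub> \<beta> \<alpha> \<oplus>\<^bsub>B\<^esub> (E' \<otimes>\<^bsub>B\<^esub> K') \<otimes>\<^bsub>B\<^esub> \<beta> \<gamma>) \<otimes>\<^bsub>B\<^esub> (F \<otimes>\<^bsub>B\<^esub> F')"
      if "F \<in> carrier B" "F' \<in> carrier B" for F F'
      using that by (metis B.S.l_one B.S.m_closed)
    define F F' where "F = \<one>\<^bsub>B\<^esub> \<ominus>\<^bsub>B\<^esub> E" and "F' = \<one>\<^bsub>B\<^esub> \<ominus>\<^bsub>B\<^esub> E'"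
    have F: "F \<in> carrier B" "F' \<in> carrier B" "E \<otimes>\<^bsub>B\<^esub> F = \<zero>\<^bsub>B\<^esub>" "E' \<otimes>\<^bsub>B\<^esub> F' = \<zero>\<^bsub>B\<^esub>"
      using B.S.idempotent_complement(1)[OF Bc(1) E(1)] B.S.idempotent_complement(1)[OF Bc(5) E'(1)]
      by (simp_all add: F_def F'_def)
    have "F \<otimes>\<^bsub>B\<^esub> F' = ((E \<otimes>\<^bsub>B\<^esub> K) \<otimes>\<^bsub>B\<^esub> \<beta> \<alpha> \<oplus>\<^bsub>B\<^esub> (E' \<otimes>\<^bsub>B\<^esub> K') \<otimes>\<^bsub>B\<^esub> \<beta> \<gamma>) \<otimes>\<^bsub>B\<^esub> (F \<otimes>\<^bsub>B\<^esub> F')"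
      by (rule one[OF F(1,2)])
    also have "\<dots> = (E \<otimes>\<^bsub>B\<^esub> F) \<otimes>\<^bsub>B\<^esub> (K \<otimes>\<^bsub>B\<^esub> \<beta> \<alpha> \<otimes>\<^bsub>B\<^esub> F') \<oplus>\<^bsub>B\<^esub> (E' \<otimes>\<^bsub>B\<^esub> F') \<otimes>\<^bsub>B\<^esub> (K' \<otimes>\<^bsub>B\<^esub> \<beta> \<gamma> \<otimes>\<^bsub>B\<^esub> F)"
      using F(1,2) Bc(1,2,5,6) B.hom_closed[OF \<alpha>\<gamma>(1)] B.hom_closed[OF \<alpha>\<gamma>(2)] by algebra
    also have "\<dots> = \<zero>\<^bsub>B\<^esub>" using \<alpha>\<gamma> F by simp
    finally have "\<beta> ((\<one> \<ominus> e) \<otimes> (\<one> \<ominus> e')) = \<zero>\<^bsub>B\<^esub>"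
      using TR by (simp add: F_def F'_def E_def E'_def a_minus_def)
    then show ?thesis using \<beta>0[of "(\<one> \<ominus> e) \<otimes> (\<one> \<ominus> e')"] TR by simp
  qed
  have ss': "s \<otimes> s' \<in> inner_units" using inner_units_mult e(4) e'(4) by blast
  \<comment> \<open>For \<open>y = s s' w\<close> one has \<open>e' y = s z' \<kappa>' w\<close>
    modulo \<open>C\<close>, because \<open>s' = k' z'\<close> and \<open>\<kappa>' = e' k'\<close>.
    So \<open>\<kappa>' w \<in> U\<close> turns into \<open>e' y \<in> s z' U\<close>, and
    symmetrically for \<open>I2\<close>.\<close>
  define I1 where "I1 = (\<lambda>x. \<pi> (s \<otimes> z') \<otimes>\<^bsub>A\<^esub> x) ` (\<pi> ` U)"
  define I2 where "I2 = (\<lambda>x. \<pi> (s' \<otimes> z) \<otimes>\<^bsub>A\<^esub> x) ` (\<pi> ` U')"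
  have "invertible_ideal A I1" "invertible_ideal A I2"
  proof -
    have n: "non_zero_divisor A (\<pi> (s \<otimes> z'))" "non_zero_divisor A (\<pi> (s' \<otimes> z))"
      using Q.S.nonzero_divisor_mult[OF inner_unit_regular[OF e(4)] e'(9)]
        Q.S.nonzero_divisor_mult[OF inner_unit_regular[OF e'(4)] e(9)] sR e(3) e'(3) by simp_all
    have i: "invertible_ideal A (\<pi> ` U)" "invertible_ideal A (\<pi> ` U')"
      using image_invertible[OF U] image_invertible[OF U'] by auto
    show "invertible_ideal A I1" "invertible_ideal A I2"
      unfolding I1_def I2_def
      using Q.S.invertible_ideal_scale_iff[OF _ n(1), of "\<pi> ` U"] Q.S.invertible_ideal_scale_iff[OF _ n(2), of "\<pi> ` U'"] i
      by (auto simp: invertible_ideal_def)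
  qed
  then have "invertible_ideal A {a \<in> carrier A. \<pi> e' \<otimes>\<^bsub>A\<^esub> a \<in> I1}" "invertible_ideal A {a \<in> carrier A. \<pi> e \<otimes>\<^bsub>A\<^esub> a \<in> I2}"
    using Q.S.invertible_ideal_idempotent e(1,5) e'(1,5) by simp_all
  then have "invertible_ideal A ({a \<in> carrier A. \<pi> e' \<otimes>\<^bsub>A\<^esub> a \<in> I1} \<inter> {a \<in> carrier A. \<pi> e \<otimes>\<^bsub>A\<^esub> a \<in> I2})"
    (is "invertible_ideal A ?Y") using gcd by (simp add: generalized_gcd_ring_iff[OF A_rickart])
  define P where "P = Q.preimage ?Y"
  have P: "invertible_ideal R P" unfolding P_def by (rule preimage_invertible(1)) fact
  have P_iff: "y \<in> P \<longleftrightarrow> (\<exists>u\<in>U. \<beta> (e' \<otimes> y) = \<beta> (s \<otimes> z' \<otimes> u)) \<and> (\<exists>u\<in>U'. \<beta> (e \<otimes> y) = \<beta> (s' \<otimes> z \<otimes> u))"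
    if y: "y \<in> carrier R" for y
  proof -
    have eq: "\<pi> x = \<pi> w \<longleftrightarrow> \<beta> x = \<beta> w" if "x \<in> carrier R" "w \<in> carrier R" for x w
      using pi_eq_iff[OF that] \<beta>_eq[of x w] that by simp
    have "\<pi> e' \<otimes>\<^bsub>A\<^esub> \<pi> y \<in> I1 \<longleftrightarrow> (\<exists>u\<in>U. \<pi> (e' \<otimes> y) = \<pi> (s \<otimes> z' \<otimes> u))"
      unfolding I1_def using y e' sR R_idealD(1)[OF idU(1)] by (auto simp: image_iff)
    also have "\<dots> \<longleftrightarrow> (\<exists>u\<in>U. \<beta> (e' \<otimes> y) = \<beta> (s \<otimes> z' \<otimes> u))"
      by (intro bex_cong refl eq) (use y e' sR R_idealD(1)[OF idU(1)] in simp_all)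
    finally have 1: "\<pi> e' \<otimes>\<^bsub>A\<^esub> \<pi> y \<in> I1 \<longleftrightarrow> (\<exists>u\<in>U. \<beta> (e' \<otimes> y) = \<beta> (s \<otimes> z' \<otimes> u))" .
    have "\<pi> e \<otimes>\<^bsub>A\<^esub> \<pi> y \<in> I2 \<longleftrightarrow> (\<exists>u\<in>U'. \<pi> (e \<otimes> y) = \<pi> (s' \<otimes> z \<otimes> u))"
      unfolding I2_def using y e sR R_idealD(1)[OF idU(2)] by (auto simp: image_iff)
    also have "\<dots> \<longleftrightarrow> (\<exists>u\<in>U'. \<beta> (e \<otimes> y) = \<beta> (s' \<otimes> z \<otimes> u))"
      by (intro bex_cong refl eq) (use y e sR R_idealD(1)[OF idU(2)] in simp_all)
    finally show ?thesis using 1 y by (simp add: P_def)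
  qed
  \<comment> \<open>A congruence modulo \<open>C\<close> becomes divisibility by
    \<open>s s'\<close>: the error lies in \<open>C = s s' C\<close>, and \<open>C\<close> is
    contained in \<open>V\<close>.\<close>
  have key: "\<exists>v\<in>V. \<mu> \<otimes> y = s \<otimes> s' \<otimes> v"
    if V: "ideal V R" "C \<subseteq> V" and u: "u \<in> V" and y: "y \<in> carrier R" and \<mu>: "\<mu> \<in> carrier T"
      and \<beta>u: "\<beta> (\<mu> \<otimes> y) = \<beta> (s \<otimes> s' \<otimes> u)" for V \<mu> y u
  proof -
    have uR: "u \<in> carrier R" using R_idealD(1)[OF V(1) u] .
    have "\<mu> \<otimes> y \<ominus> s \<otimes> s' \<otimes> u \<in> C" 
      by (rule \<beta>_eq[THEN iffD1, OF _ _ \<beta>u]) (use \<mu> y uR TR in simp_all)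
    then obtain d where d: "d \<in> C" "\<mu> \<otimes> y \<ominus> s \<otimes> s' \<otimes> u = s \<otimes> s' \<otimes> d" by (rule inner_unit_divides_C[OF ss'])
    have "\<mu> \<otimes> y = (\<mu> \<otimes> y \<ominus> s \<otimes> s' \<otimes> u) \<oplus> s \<otimes> s' \<otimes> u"
      using \<mu> y[THEN R_carrier] uR[THEN R_carrier] sR[THEN R_carrier] by algebra
    also have "\<dots> = s \<otimes> s' \<otimes> (d \<oplus> u)" unfolding d(2) using d(1) C.Icarr uR sR by (simp add: r_distr)
    finally show ?thesis using d(1) V u R_idealD(3)[OF V(1)] by blast
  qed
  have ss'T: "s \<otimes> s' \<in> carrier T" and ss'0: "s \<otimes> s' \<noteq> \<zero>"
    using sR inner_unit_nonzero[OF ss'] by simp_all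
  have "(\<lambda>x. (\<kappa> \<otimes> \<kappa>') \<otimes> x) ` P = (\<lambda>x. (s \<otimes> s') \<otimes> x) ` ((\<lambda>x. \<kappa> \<otimes> x) ` U \<inter> (\<lambda>x. \<kappa>' \<otimes> x) ` U')"
  proof (intro equalityI subsetI)
    fix x assume "x \<in> (\<lambda>x. (\<kappa> \<otimes> \<kappa>') \<otimes> x) ` P"
    then obtain y where y: "y \<in> P" "x = \<kappa> \<otimes> \<kappa>' \<otimes> y" by blast
    have yR: "y \<in> carrier R" using y(1) by (simp add: P_def)
    obtain u u' where u: "u \<in> U" "\<beta> (e' \<otimes> y) = \<beta> (s \<otimes> z' \<otimes> u)" and u': "u' \<in> U'" "\<beta> (e \<otimes> y) = \<beta> (s' \<otimes> z \<otimes> u')"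
      using P_iff[OF yR] y(1) by blast
    have uT: "u \<in> carrier T" "u' \<in> carrier T" "y \<in> carrier T"
      using R_idealD(1)[OF idU(1) u(1)] R_idealD(1)[OF idU(2) u'(1)] yR by simp_all
    have "\<beta> (\<kappa>' \<otimes> y) = K' \<otimes>\<^bsub>B\<^esub> (E' \<otimes>\<^bsub>B\<^esub> \<beta> y)"
      using E'(2) uT TR by (simp add: B.S.m_ac)
    also have "E' \<otimes>\<^bsub>B\<^esub> \<beta> y = S \<otimes>\<^bsub>B\<^esub> Z' \<otimes>\<^bsub>B\<^esub> \<beta> u"
      using u(2) uT TR by (simp add: E'_def S_def Z'_def)
    also have "K' \<otimes>\<^bsub>B\<^esub> (S \<otimes>\<^bsub>B\<^esub> Z' \<otimes>\<^bsub>B\<^esub> \<beta> u) = S \<otimes>\<^bsub>B\<^esub> (K' \<otimes>\<^bsub>B\<^esub> Z') \<otimes>\<^bsub>B\<^esub> \<beta> u"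
      using Bc B.hom_closed[OF uT(1)] by algebra
    also have "\<dots> = \<beta> (s \<otimes> s' \<otimes> u)"
      unfolding E'(3)[symmetric] using uT TR by (simp add: S_def S'_def)
    finally obtain v where v: "v \<in> U" "\<kappa>' \<otimes> y = s \<otimes> s' \<otimes> v"
      using key[OF idU(1) CU(1) u(1) yR TR(10)] by blast
    have "\<beta> (\<kappa> \<otimes> y) = K \<otimes>\<^bsub>B\<^esub> (E \<otimes>\<^bsub>B\<^esub> \<beta> y)"
      using E(2) uT TR by (simp add: B.S.m_ac)
    also have "E \<otimes>\<^bsub>B\<^esub> \<beta> y = S' \<otimes>\<^bsub>B\<^esub> Z \<otimes>\<^bsub>B\<^esub> \<beta> u'"
      using u'(2) uT TR by (simp add: E_def S'_def Z_def)
    also have "K \<otimes>\<^bsub>B\<^esub> (S' \<otimes>\<^bsub>B\<^esub> Z \<otimes>\<^bsub>B\<^esub> \<beta> u') = (K \<otimes>\<^bsub>B\<^esub> Z) \<otimes>\<^bsub>B\<^esub> S' \<otimes>\<^bsub>B\<^esub> \<beta> u'"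
      using Bc B.hom_closed[OF uT(2)] by algebra
    also have "\<dots> = \<beta> (s \<otimes> s' \<otimes> u')"
      unfolding E(3)[symmetric] using uT TR by (simp add: S_def S'_def)
    finally obtain v' where v': "v' \<in> U'" "\<kappa> \<otimes> y = s \<otimes> s' \<otimes> v'"
      using key[OF idU(2) CU(2) u'(1) yR TR(9)] by blast
    have vT: "v \<in> carrier T" "v' \<in> carrier T"
      using R_idealD(1)[OF idU(1) v(1)] R_idealD(1)[OF idU(2) v'(1)] by simp_all
    have x1: "x = (s \<otimes> s') \<otimes> (\<kappa> \<otimes> v)"
    proof -
      have "x = \<kappa> \<otimes> (\<kappa>' \<otimes> y)" unfolding y(2) using TR uT(3) by (simp add: m_assoc)
      then show ?thesis unfolding v(2) using ss'T vT(1) TR(9) by (simp add: m_lcomm)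
    qed
    have x2: "x = (s \<otimes> s') \<otimes> (\<kappa>' \<otimes> v')"
    proof -
      have "x = \<kappa>' \<otimes> (\<kappa> \<otimes> y)" unfolding y(2) using TR uT(3) by (simp add: m_ac)
      then show ?thesis unfolding v'(2) using ss'T vT(2) TR(10) by (simp add: m_lcomm)
    qed
    have "\<kappa> \<otimes> v = \<kappa>' \<otimes> v'" using m_lcancel[OF ss'0 ss'T] x1 x2 vT TR(9,10) by simp
    then have "\<kappa> \<otimes> v \<in> (\<lambda>x. \<kappa> \<otimes> x) ` U \<inter> (\<lambda>x. \<kappa>' \<otimes> x) ` U'" using v(1) v'(1) by blast
    then show "x \<in> (\<lambda>x. (s \<otimes> s') \<otimes> x) ` ((\<lambda>x. \<kappa> \<otimes> x) ` U \<inter> (\<lambda>x. \<kappa>' \<otimes> x) ` U')" unfolding x1 by blast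
  next
    fix x assume "x \<in> (\<lambda>x. (s \<otimes> s') \<otimes> x) ` ((\<lambda>x. \<kappa> \<otimes> x) ` U \<inter> (\<lambda>x. \<kappa>' \<otimes> x) ` U')"
    then obtain u u' where u: "u \<in> U" "u' \<in> U'" "\<kappa> \<otimes> u = \<kappa>' \<otimes> u'" "x = (s \<otimes> s') \<otimes> (\<kappa> \<otimes> u)" by auto
    have uR: "u \<in> carrier R" "u' \<in> carrier R"
      using R_idealD(1)[OF idU(1) u(1)] R_idealD(1)[OF idU(2) u(2)] .
    have uT: "u \<in> carrier T" "u' \<in> carrier T" using uR by simp_all
    \<comment> \<open>The common value of \<open>u / \<kappa>'\<close> and
      \<open>u' / \<kappa>\<close>, written without fractions by means of \<open>\<alpha>\<close>
      and \<open>\<gamma>\<close>.\<close>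
    define w where "w = u \<otimes> \<gamma> \<oplus> u' \<otimes> \<alpha>"
    have w: "w \<in> carrier T" using uT \<alpha>\<gamma> by (simp add: w_def)
    have \<kappa>w: "\<kappa> \<otimes> w = u'"
    proof -
      have "\<kappa> \<otimes> w = (\<kappa> \<otimes> u) \<otimes> \<gamma> \<oplus> \<kappa> \<otimes> u' \<otimes> \<alpha>" unfolding w_def using uT \<alpha>\<gamma>(1,2) TR(9,10) by algebra
      also have "\<dots> = (\<kappa> \<otimes> \<alpha> \<oplus> \<kappa>' \<otimes> \<gamma>) \<otimes> u'" unfolding u(3) using uT \<alpha>\<gamma>(1,2) TR(9,10) by algebra
      finally show ?thesis using \<alpha>\<gamma>(3) uT by simp
    qed
    have \<kappa>'w: "\<kappa>' \<otimes> w = u"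
    proof -
      have "\<kappa>' \<otimes> w = \<kappa>' \<otimes> u \<otimes> \<gamma> \<oplus> (\<kappa>' \<otimes> u') \<otimes> \<alpha>" unfolding w_def using uT \<alpha>\<gamma>(1,2) TR(9,10) by algebra
      also have "\<dots> = (\<kappa> \<otimes> \<alpha> \<oplus> \<kappa>' \<otimes> \<gamma>) \<otimes> u" unfolding u(3)[symmetric] using uT \<alpha>\<gamma>(1,2) TR(9,10) by algebra
      finally show ?thesis using \<alpha>\<gamma>(3) uT by simp
    qed
    define y where "y = s \<otimes> s' \<otimes> w"
    have yT: "y \<in> carrier T" using ss'T w by (simp add: y_def)
    have \<beta>e': "\<beta> (e' \<otimes> y) = \<beta> (s \<otimes> z' \<otimes> u)"
    proof -
      have "\<beta> (e' \<otimes> y) = E' \<otimes>\<^bsub>B\<^esub> (S \<otimes>\<^bsub>B\<^esub> (K' \<otimes>\<^bsub>B\<^esub> Z') \<otimes>\<^bsub>B\<^esub> \<beta> w)"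
        unfolding y_def E'(3)[symmetric] using TR w by (simp add: E'_def S_def S'_def)
      also have "\<dots> = S \<otimes>\<^bsub>B\<^esub> Z' \<otimes>\<^bsub>B\<^esub> ((E' \<otimes>\<^bsub>B\<^esub> K') \<otimes>\<^bsub>B\<^esub> \<beta> w)" using Bc B.hom_closed[OF w] by algebra
      also have "\<dots> = S \<otimes>\<^bsub>B\<^esub> Z' \<otimes>\<^bsub>B\<^esub> \<beta> (\<kappa>' \<otimes> w)" using TR w by (simp add: E'(2))
      finally show ?thesis unfolding \<kappa>'w using TR uT by (simp add: S_def Z'_def)
    qed
    have \<beta>e: "\<beta> (e \<otimes> y) = \<beta> (s' \<otimes> z \<otimes> u')"
    proof -
      have "\<beta> (e \<otimes> y) = E \<otimes>\<^bsub>B\<^esub> ((K \<otimes>\<^bsub>B\<^esub> Z) \<otimes>\<^bsub>B\<^esub> S' \<otimes>\<^bsub>B\<^esub> \<beta> w)"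
        unfolding y_def E(3)[symmetric] using TR w by (simp add: E_def S_def S'_def)
      also have "\<dots> = S' \<otimes>\<^bsub>B\<^esub> Z \<otimes>\<^bsub>B\<^esub> ((E \<otimes>\<^bsub>B\<^esub> K) \<otimes>\<^bsub>B\<^esub> \<beta> w)" using Bc B.hom_closed[OF w] by algebra
      also have "\<dots> = S' \<otimes>\<^bsub>B\<^esub> Z \<otimes>\<^bsub>B\<^esub> \<beta> (\<kappa> \<otimes> w)" using TR w by (simp add: E(2))
      finally show ?thesis unfolding \<kappa>w using TR uT by (simp add: S'_def Z_def)
    qed
    have in_R: "a \<in> carrier R" if "a \<in> carrier T" "b \<in> carrier R" "\<beta> a = \<beta> b" for a b
    proof -
      have "a \<ominus> b \<in> carrier R" using \<beta>_eq[of a b] that C_in_R by simp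
      then have "(a \<ominus> b) \<oplus> b \<in> carrier R" using that by simp
      moreover have "(a \<ominus> b) \<oplus> b = a" using that(1) R_carrier[OF that(2)] by algebra
      ultimately show ?thesis by simp
    qed
    have ey: "e \<otimes> y \<in> carrier R" "e' \<otimes> y \<in> carrier R"
      using in_R[OF _ _ \<beta>e] in_R[OF _ _ \<beta>e'] yT TR uR sR e e' by simp_all
    \<comment> \<open>By construction \<open>y\<close> is only in \<open>T\<close>. The parts
      \<open>e y\<close> and \<open>e' y\<close> lie in \<open>R\<close> by \<open>ey\<close>, and
      the remainder has the factor \<open>(1 - e) (1 - e')\<close>, which lies in \<open>C\<close>
      by \<open>comp\<close>.\<close>
    have "y = e \<otimes> y \<oplus> e' \<otimes> y \<ominus> e \<otimes> (e' \<otimes> y) \<oplus> (\<one> \<ominus> e) \<otimes> (\<one> \<ominus> e') \<otimes> y"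
      using TR(1,4) yT by algebra
    moreover have "(\<one> \<ominus> e) \<otimes> (\<one> \<ominus> e') \<otimes> y \<in> carrier R"
      using C_in_R C.I_r_closed[OF comp yT] by simp
    ultimately have yR: "y \<in> carrier R" using ey e(1) by (metis R_closed(4,5,6))
    have "y \<in> P" using P_iff[OF yR] \<beta>e \<beta>e' u(1,2) by blast
    moreover have "x = \<kappa> \<otimes> \<kappa>' \<otimes> y"
    proof -
      have "\<kappa> \<otimes> \<kappa>' \<otimes> y = (s \<otimes> s') \<otimes> (\<kappa> \<otimes> (\<kappa>' \<otimes> w))" unfolding y_def using TR(7-10) w by algebra
      then show ?thesis unfolding u(4) \<kappa>'w by simp
    qed
    ultimately show "x \<in> (\<lambda>x. (\<kappa> \<otimes> \<kappa>') \<otimes> x) ` P" by blast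
  qed
  moreover have "invertible_ideal R ((\<lambda>x. (\<kappa> \<otimes> \<kappa>') \<otimes> x) ` P)"
    using R.invertible_ideal_scale_iff[of P "\<kappa> \<otimes> \<kappa>'"] P \<kappa> \<kappa>' R_nonzero_divisor[of "\<kappa> \<otimes> \<kappa>'"] integral_iff
    by (simp add: invertible_ideal_def)
  moreover have "ideal ((\<lambda>x. \<kappa> \<otimes> x) ` U \<inter> (\<lambda>x. \<kappa>' \<otimes> x) ` U') R"
    using R.i_intersect[OF R.ideal_scale[OF idU(1) \<kappa>(1)] R.ideal_scale[OF idU(2) \<kappa>'(1)]] by simp
  ultimately show ?thesis
    using R.invertible_ideal_scale_iff[of "(\<lambda>x. \<kappa> \<otimes> x) ` U \<inter> (\<lambda>x. \<kappa>' \<otimes> x) ` U'" "s \<otimes> s'"]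
      R_nonzero_divisor[OF inner_units_carrier[OF ss'] ss'0] by simp
qed

end

section \<open>Invertible ideals of the subring\<close>

context conductor_two_generated begin

lemma one_inner_unit: "\<one> \<in> inner_units"
  by (rule inner_unitI[of _ \<one>]) auto

lemma common_denominator:
  assumes "finite S" "g \<in> carrier T" "\<And>x. x \<in> S \<Longrightarrow> \<exists>t\<in>carrier T. x = g \<otimes> t"
  shows "\<exists>r\<in>inner_units. \<forall>x\<in>S. \<exists>u\<in>carrier R. r \<otimes> x = g \<otimes> u"
  using assms
proof (induction S rule: finite_induct)
  case empty
  then show ?case using one_inner_unit by blast
next
  case (insert x S)
  then obtain r where r: "r \<in> inner_units" "\<forall>x\<in>S. \<exists>u\<in>carrier R. r \<otimes> x = g \<otimes> u" by blast
  obtain t where t: "t \<in> carrier T" "x = g \<otimes> t" using insert by blast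
  obtain s where s: "s \<in> inner_units" "s \<otimes> t \<in> carrier R" using denominator[OF t(1)] by blast
  have rs: "r \<in> carrier R" "s \<in> carrier R" using r s inner_units_carrier by auto
  note rsT = rs[THEN R_carrier]
  have "\<exists>u\<in>carrier R. r \<otimes> s \<otimes> y = g \<otimes> u" if y: "y \<in> insert x S" for y
  proof (cases "y = x")
    case True
    have "r \<otimes> s \<otimes> x = g \<otimes> (r \<otimes> (s \<otimes> t))" unfolding t(2) using insert(4) t(1) rsT by algebra
    then show ?thesis using True rs(1) s(2) R_closed(6) by blast
  next
    case False
    then have "y \<in> S" using y by simp
    then obtain u where u: "u \<in> carrier R" "r \<otimes> y = g \<otimes> u" using r by blast
    obtain t' where "t' \<in> carrier T" "y = g \<otimes> t'" using insert.prems(2)[OF y] by blast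
    then have yT: "y \<in> carrier T" using insert(4) by simp
    have "r \<otimes> s \<otimes> y = s \<otimes> (r \<otimes> y)" using rsT yT by algebra
    also have "\<dots> = g \<otimes> (s \<otimes> u)" unfolding u(2) using rsT insert(4) u(1)[THEN R_carrier] by algebra
    finally show ?thesis using rs u R_closed(6) by blast
  qed
  then show ?case using inner_units_mult[OF r(1) s(1)] by blast
qed

text \<open>In the Bezout domain \<open>T\<close> the ideal \<open>I T\<close> is generated by one
  element \<open>g\<close>, which can be taken in \<open>R\<close>. A common denominator
  \<open>r\<close> of the quotients of the generators by \<open>g\<close> gives
  \<open>r I = g U\<close>. Since \<open>g\<close> lies in \<open>I T\<close>, some inner unit
  \<open>\<sigma>\<close> brings it into \<open>I\<close>, and so \<open>r \<sigma>\<close> lies in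
  \<open>U\<close>.\<close>

lemma invertible_normal_form:
  assumes I: "invertible_ideal R I"
  obtains r g U p where "r \<in> inner_units" "g \<in> carrier R" "g \<noteq> \<zero>" "invertible_ideal R U"
    "p \<in> U" "p \<in> inner_units" "(\<lambda>x. r \<otimes> x) ` I = (\<lambda>x. g \<otimes> x) ` U"
proof -
  obtain q where id: "ideal I R" and q: "q \<in> I" "non_zero_divisor R q"
    using I by (auto simp: invertible_ideal_def)
  have qR: "q \<in> carrier R" using R_idealD(1)[OF id q(1)] .
  have q0: "q \<noteq> \<zero>"
    using q(2) domain.non_zero_divisor_iff[OF R_domain, of q] by simp
  obtain S where S: "S \<subseteq> carrier R" "finite S" "I = Idl\<^bsub>R\<^esub> S"
    using R.invertible_flat(1)[OF I] unfolding finitely_generated_ideal_def by blast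
  have SI: "S \<subseteq> I" unfolding S(3) by (rule R.genideal_self[OF S(1)])
  have ST: "S \<subseteq> carrier T" using S(1) by auto
  obtain g0 where g0: "g0 \<in> carrier T" "g0 \<in> Idl S" "Idl S = {g0 \<otimes> t |t. t \<in> carrier T}"
    by (rule finite_principal[OF S(2) ST], rule that)
  obtain \<tau> where \<tau>: "\<tau> \<in> inner_units" "\<tau> \<otimes> g0 \<in> carrier R" using denominator[OF g0(1)] by blast
  obtain \<tau>' where \<tau>': "\<tau>' \<in> carrier T" "\<tau> \<otimes> \<tau>' = \<one>" "\<tau> \<in> carrier R" using \<tau>(1) by (rule inner_unitE)
  define g where "g = \<tau> \<otimes> g0"
  have g: "g \<in> carrier R" using \<tau> by (simp add: g_def)
  have gT: "g \<in> carrier T" using g by simp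
  have "\<exists>t\<in>carrier T. x = g \<otimes> t" if "x \<in> S" for x
  proof -
    have "x \<in> Idl S" using that genideal_self[OF ST] by blast
    then obtain t where t: "t \<in> carrier T" "x = g0 \<otimes> t" unfolding g0(3) by blast
    have "g \<otimes> (\<tau>' \<otimes> t) = (\<tau> \<otimes> \<tau>') \<otimes> (g0 \<otimes> t)"
      unfolding g_def using g0(1) \<tau>'(1) \<tau>'(3)[THEN R_carrier] t(1) by algebra
    then have "x = g \<otimes> (\<tau>' \<otimes> t)" using \<tau>'(2) t g0(1) by simp
    then show ?thesis using \<tau>'(1) t(1) by blast
  qed
  then obtain r where r: "r \<in> inner_units" "\<And>x. x \<in> S \<Longrightarrow> \<exists>u\<in>carrier R. r \<otimes> x = g \<otimes> u"
    using common_denominator[OF S(2) gT] by blast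
  have rR: "r \<in> carrier R" using r(1) by (rule inner_units_carrier)
  note rT = R_carrier[OF rR]
  have "ideal {x \<in> carrier R. \<exists>u\<in>carrier R. r \<otimes> x = g \<otimes> u} R" (is "ideal ?J R")
  proof (rule R_idealI)
    have "r \<otimes> \<zero> = g \<otimes> \<zero>" using rT gT by simp
    then show "\<zero> \<in> ?J" using R_closed(1) by blast
  next
    fix x y assume "x \<in> ?J" "y \<in> ?J"
    then obtain u v where xy: "x \<in> carrier R" "y \<in> carrier R" "u \<in> carrier R" "r \<otimes> x = g \<otimes> u"
      "v \<in> carrier R" "r \<otimes> y = g \<otimes> v" by blast
    then have "r \<otimes> (x \<oplus> y) = g \<otimes> (u \<oplus> v)" using rT gT by (simp add: r_distr)
    then show "x \<oplus> y \<in> ?J" using xy R_closed(4) by blast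
  next
    fix a x assume a: "a \<in> carrier R" and "x \<in> ?J"
    then obtain u where x: "x \<in> carrier R" "u \<in> carrier R" "r \<otimes> x = g \<otimes> u" by blast
    have "r \<otimes> (a \<otimes> x) = a \<otimes> (r \<otimes> x)" using rT a x(1) by (simp add: m_lcomm)
    also have "\<dots> = g \<otimes> (a \<otimes> u)" using x gT a by (simp add: m_lcomm)
    finally show "a \<otimes> x \<in> ?J" using a x R_closed(6) by blast
  qed blast
  moreover have "S \<subseteq> ?J" using r(2) S(1) by blast
  ultimately have IJ: "I \<subseteq> ?J" unfolding S(3) by (rule R.genideal_minimal)
  define U where "U = {u \<in> carrier R. \<exists>x\<in>I. g \<otimes> u = r \<otimes> x}"
  have U: "ideal U R"
  proof (rule R_idealI)
    have "g \<otimes> \<zero> = r \<otimes> \<zero>" using rT gT by simp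
    then show "\<zero> \<in> U" unfolding U_def using R_closed(1) R_idealD(2)[OF id] by blast
  next
    fix x y assume "x \<in> U" "y \<in> U"
    then obtain u v where xy: "x \<in> carrier R" "y \<in> carrier R" "u \<in> I" "g \<otimes> x = r \<otimes> u"
      "v \<in> I" "g \<otimes> y = r \<otimes> v" unfolding U_def by blast
    have "u \<in> carrier T" "v \<in> carrier T" using R_idealD(1)[OF id] xy by simp_all
    then have "g \<otimes> (x \<oplus> y) = r \<otimes> (u \<oplus> v)" using xy rT gT by (simp add: r_distr)
    then show "x \<oplus> y \<in> U" unfolding U_def using xy R_closed(4) R_idealD(3)[OF id] by blast
  next
    fix a x assume a: "a \<in> carrier R" and "x \<in> U"
    then obtain u where x: "x \<in> carrier R" "u \<in> I" "g \<otimes> x = r \<otimes> u" unfolding U_def by blast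
    have uT: "u \<in> carrier T" using R_idealD(1)[OF id] x by simp
    have "g \<otimes> (a \<otimes> x) = a \<otimes> (g \<otimes> x)" using gT a x(1) by (simp add: m_lcomm)
    also have "\<dots> = r \<otimes> (a \<otimes> u)" using x rT a uT by (simp add: m_lcomm)
    finally show "a \<otimes> x \<in> U" unfolding U_def using a x R_closed(6) R_idealD(5)[OF id] by blast
  qed (auto simp: U_def)
  have eq: "(\<lambda>x. r \<otimes> x) ` I = (\<lambda>x. g \<otimes> x) ` U"
  proof (intro equalityI subsetI)
    fix y assume "y \<in> (\<lambda>x. r \<otimes> x) ` I"
    then obtain x where x: "x \<in> I" "y = r \<otimes> x" by blast
    then obtain u where u: "u \<in> carrier R" "r \<otimes> x = g \<otimes> u" using IJ by blast
    have "u \<in> U" unfolding U_def using u(1) u(2)[symmetric] x(1) by blast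
    then show "y \<in> (\<lambda>x. g \<otimes> x) ` U" unfolding x(2) u(2) by blast
  next
    fix y assume "y \<in> (\<lambda>x. g \<otimes> x) ` U"
    then show "y \<in> (\<lambda>x. r \<otimes> x) ` I" unfolding U_def by auto
  qed
  have "g \<noteq> \<zero>"
  proof
    assume "g = \<zero>"
    moreover obtain u where "u \<in> carrier R" "r \<otimes> q = g \<otimes> u" using IJ q(1) by blast
    ultimately have "r \<otimes> q = \<zero>" by simp
    then show False using integral[OF _ rT R_carrier[OF qR]] q0 inner_unit_nonzero[OF r(1)] by blast
  qed
  \<comment> \<open>This is \<open>I T\<close>, described as in a localization, which makes the
    inner unit \<open>\<sigma>\<close> explicit. It contains the generators, hence
    \<open>g\<close>.\<close>
  have "ideal {y \<in> carrier T. \<exists>\<sigma>\<in>inner_units. \<sigma> \<otimes> y \<in> I} T" (is "ideal ?L T")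
  proof (rule idealI')
    have "\<one> \<otimes> \<zero> \<in> I" using R_idealD(2)[OF id] by simp
    then show "\<zero> \<in> ?L" using one_inner_unit zero_closed by blast
  next
    fix x y assume "x \<in> ?L" "y \<in> ?L"
    then obtain \<sigma> \<sigma>' where *: "x \<in> carrier T" "y \<in> carrier T" "\<sigma> \<in> inner_units" "\<sigma>' \<in> inner_units"
      "\<sigma> \<otimes> x \<in> I" "\<sigma>' \<otimes> y \<in> I" by blast
    have R: "\<sigma> \<in> carrier R" "\<sigma>' \<in> carrier R" using * inner_units_carrier by auto
    have "(\<sigma> \<otimes> \<sigma>') \<otimes> (x \<oplus> y) = \<sigma>' \<otimes> (\<sigma> \<otimes> x) \<oplus> \<sigma> \<otimes> (\<sigma>' \<otimes> y)"
      using *(1,2) R[THEN R_carrier] by algebra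
    moreover have "\<sigma>' \<otimes> (\<sigma> \<otimes> x) \<oplus> \<sigma> \<otimes> (\<sigma>' \<otimes> y) \<in> I"
      using R_idealD(3)[OF id] R_idealD(5)[OF id] R * by blast
    ultimately have "(\<sigma> \<otimes> \<sigma>') \<otimes> (x \<oplus> y) \<in> I" by simp
    then show "x \<oplus> y \<in> ?L" using inner_units_mult[OF *(3,4)] *(1,2) a_closed by blast
  next
    fix t x assume t: "t \<in> carrier T" and "x \<in> ?L"
    then obtain \<sigma> where *: "x \<in> carrier T" "\<sigma> \<in> inner_units" "\<sigma> \<otimes> x \<in> I" by blast
    obtain \<sigma>' where \<sigma>': "\<sigma>' \<in> inner_units" "\<sigma>' \<otimes> t \<in> carrier R" using denominator[OF t] by blast
    have "(\<sigma>' \<otimes> \<sigma>) \<otimes> (t \<otimes> x) = (\<sigma>' \<otimes> t) \<otimes> (\<sigma> \<otimes> x)"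
      using t *(1) R_carrier[OF inner_units_carrier[OF *(2)]] R_carrier[OF inner_units_carrier[OF \<sigma>'(1)]] by algebra
    moreover have "(\<sigma>' \<otimes> t) \<otimes> (\<sigma> \<otimes> x) \<in> I" by (rule R_idealD(5)[OF id \<sigma>'(2) *(3)])
    ultimately have "(\<sigma>' \<otimes> \<sigma>) \<otimes> (t \<otimes> x) \<in> I" by simp
    then show "t \<otimes> x \<in> ?L" using inner_units_mult[OF \<sigma>'(1) *(2)] t *(1) m_closed by blast
  qed blast
  moreover have "S \<subseteq> ?L"
  proof
    fix x assume x: "x \<in> S"
    then have "x \<in> carrier T" "x \<in> I" using ST SI by blast+
    moreover from this have "\<one> \<otimes> x \<in> I" by simp
    ultimately show "x \<in> ?L" using one_inner_unit by blast
  qed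
  ultimately have "Idl S \<subseteq> ?L" by (rule genideal_minimal)
  moreover have "g \<in> Idl S"
  proof -
    interpret J: ideal "Idl S" T by (rule genideal_ideal[OF ST])
    show ?thesis unfolding g_def by (rule J.I_l_closed[OF g0(2) R_carrier[OF \<tau>'(3)]])
  qed
  ultimately obtain \<sigma> where \<sigma>: "\<sigma> \<in> inner_units" "\<sigma> \<otimes> g \<in> I" by blast
  have \<sigma>R: "\<sigma> \<in> carrier R" using \<sigma>(1) by (rule inner_units_carrier)
  have "g \<otimes> (r \<otimes> \<sigma>) = r \<otimes> (\<sigma> \<otimes> g)" using gT rT R_carrier[OF \<sigma>R] by algebra
  then have p: "r \<otimes> \<sigma> \<in> U" unfolding U_def using \<sigma>(2) rR \<sigma>R R_closed(6) by blast
  have "invertible_ideal R ((\<lambda>x. g \<otimes> x) ` U)"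
    unfolding eq[symmetric]
    using R.invertible_ideal_scale_iff[OF id R_nonzero_divisor[OF rR inner_unit_nonzero[OF r(1)]]] I by simp
  then have "invertible_ideal R U"
    using R.invertible_ideal_scale_iff[OF U R_nonzero_divisor[OF g \<open>g \<noteq> \<zero>\<close>]] by simp
  then show thesis
    using that[OF r(1) g \<open>g \<noteq> \<zero>\<close> _ p inner_units_mult[OF r(1) \<sigma>(1)] eq] by blast
qed

lemma scale_invertible_meets_units:
  assumes U: "invertible_ideal R U" "p \<in> U" "p \<in> inner_units" and r: "r \<in> inner_units"
  shows "invertible_ideal R ((\<lambda>x. r \<otimes> x) ` U)" "r \<otimes> p \<in> (\<lambda>x. r \<otimes> x) ` U" "r \<otimes> p \<in> inner_units"
proof -
  have "ideal U R" using U by (simp add: invertible_ideal_def)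
  then show "invertible_ideal R ((\<lambda>x. r \<otimes> x) ` U)"
    using R.invertible_ideal_scale_iff[OF _ R_nonzero_divisor[OF inner_units_carrier[OF r] inner_unit_nonzero[OF r]]] U(1)
    by simp
qed (use U r inner_units_mult in auto)

end

text \<open>Splitting off a gcd \<open>h\<close> of \<open>g\<close> and \<open>g'\<close> leaves
  coprime factors, and up to scaling by \<open>n\<close> and \<open>m\<close> the intersection is
  the one treated in \<open>coprime_scaled_intersection\<close>.\<close>

lemma (in conductor_quotient) generalized_gcd_R_if_A:
  assumes gcd: "generalized_gcd_ring A" shows "generalized_gcd_ring R"
  unfolding generalized_gcd_ring_iff[OF domain.rickart[OF R_domain]]
proof (intro allI impI, elim conjE)
  fix I J assume I: "invertible_ideal R I" and J: "invertible_ideal R J"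
  have id: "ideal I R" "ideal J R" using I J by (simp_all add: invertible_ideal_def)
  obtain r g U p where U: "r \<in> inner_units" "g \<in> carrier R" "g \<noteq> \<zero>" "invertible_ideal R U"
    "p \<in> U" "p \<in> inner_units" "(\<lambda>x. r \<otimes> x) ` I = (\<lambda>x. g \<otimes> x) ` U"
    by (rule invertible_normal_form[OF I], rule that)
  obtain r' g' U' p' where U': "r' \<in> inner_units" "g' \<in> carrier R" "g' \<noteq> \<zero>" "invertible_ideal R U'"
    "p' \<in> U'" "p' \<in> inner_units" "(\<lambda>x. r' \<otimes> x) ` J = (\<lambda>x. g' \<otimes> x) ` U'"
    by (rule invertible_normal_form[OF J], rule that)
  have gT: "g \<in> carrier T" "g' \<in> carrier T" using U U' by simp_all
  obtain h a b x y where h: "h \<in> carrier T" "a \<in> carrier T" "b \<in> carrier T" "x \<in> carrier T" "y \<in> carrier T"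
    "g = h \<otimes> a" "g' = h \<otimes> b" "h = g \<otimes> x \<oplus> g' \<otimes> y" by (rule bezout[OF gT], rule that)
  have h0: "h \<noteq> \<zero>" using U(3) h(2,6) by auto
  have ab: "a \<otimes> x \<oplus> b \<otimes> y = \<one>"
  proof -
    have "h \<otimes> (a \<otimes> x \<oplus> b \<otimes> y) = (h \<otimes> a) \<otimes> x \<oplus> (h \<otimes> b) \<otimes> y" using h(1-5) by algebra
    also have "\<dots> = h \<otimes> \<one>" using h(1) by (simp add: h(6,7,8)[symmetric])
    finally show ?thesis using m_lcancel[OF h0 h(1)] h(2-5) by simp
  qed
  obtain s1 where s1: "s1 \<in> inner_units" "s1 \<otimes> a \<in> carrier R" using denominator[OF h(2)] by blast
  obtain s2 where s2: "s2 \<in> inner_units" "s2 \<otimes> b \<in> carrier R" using denominator[OF h(3)] by blast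
  obtain s3 where s3: "s3 \<in> inner_units" "s3 \<otimes> h \<in> carrier R" using denominator[OF h(1)] by blast
  have sR: "s1 \<in> carrier R" "s2 \<in> carrier R" "s3 \<in> carrier R" "r \<in> carrier R" "r' \<in> carrier R"
    using s1 s2 s3 U(1) U'(1) inner_units_carrier by auto
  note sT = sR[THEN R_carrier]
  \<comment> \<open>\<open>\<kappa>\<close> and \<open>\<kappa>'\<close> carry the same factor
    \<open>s1 s2\<close>, so both lie in \<open>R\<close> and the Bezout relation survives up to a
    unit. The crossed factors \<open>r'\<close> and \<open>r\<close> in \<open>?V\<close> and
    \<open>?V'\<close> bring \<open>r I = g U\<close> and \<open>r' J = g' U'\<close> to the common
    multiplier \<open>n\<close>: \<open>n I = m \<kappa> r' U\<close> and
    \<open>n J = m \<kappa>' r U'\<close>.\<close>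
  define \<kappa> where "\<kappa> = s2 \<otimes> (s1 \<otimes> a)"
  define \<kappa>' where "\<kappa>' = s1 \<otimes> (s2 \<otimes> b)"
  define m where "m = s3 \<otimes> h"
  define n where "n = s1 \<otimes> s2 \<otimes> s3 \<otimes> (r \<otimes> r')"
  have \<kappa>: "\<kappa> \<in> carrier R" "\<kappa>' \<in> carrier R" "m \<in> carrier R"
    using s1 s2 s3 sR unfolding \<kappa>_def \<kappa>'_def m_def by simp_all
  note \<kappa>T = \<kappa>[THEN R_carrier]
  have a0: "a \<noteq> \<zero>" "b \<noteq> \<zero>" using U(3) U'(3) h(1,6,7) by auto
  have nz: "\<kappa> \<noteq> \<zero>" "\<kappa>' \<noteq> \<zero>" "m \<noteq> \<zero>"
    using a0 h0 sT h(1-3) inner_unit_nonzero[OF s1(1)] inner_unit_nonzero[OF s2(1)] inner_unit_nonzero[OF s3(1)]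
    unfolding \<kappa>_def \<kappa>'_def m_def by (simp_all add: integral_iff)
  have nS: "n \<in> inner_units" unfolding n_def by (intro inner_units_mult s1(1) s2(1) s3(1) U(1) U'(1))
  have nT: "n \<in> carrier T" using inner_units_carrier[OF nS] by simp
  have bez: "\<exists>\<alpha>\<in>carrier T. \<exists>\<gamma>\<in>carrier T. \<kappa> \<otimes> \<alpha> \<oplus> \<kappa>' \<otimes> \<gamma> = \<one>"
  proof -
    obtain t where t: "t \<in> carrier T" "(s1 \<otimes> s2) \<otimes> t = \<one>"
      using inner_units_mult[OF s1(1) s2(1)] by (rule inner_unitE)
    have "\<kappa> \<otimes> (x \<otimes> t) \<oplus> \<kappa>' \<otimes> (y \<otimes> t) = ((s1 \<otimes> s2) \<otimes> t) \<otimes> (a \<otimes> x \<oplus> b \<otimes> y)"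
      unfolding \<kappa>_def \<kappa>'_def using sT(1,2) h(2-5) t(1) by algebra
    then have "\<kappa> \<otimes> (x \<otimes> t) \<oplus> \<kappa>' \<otimes> (y \<otimes> t) = \<one>" using t(2) ab by simp
    then show ?thesis using h(4,5) t(1) by blast
  qed
  let ?V = "(\<lambda>x. r' \<otimes> x) ` U" and ?V' = "(\<lambda>x. r \<otimes> x) ` U'"
  have inv: "invertible_ideal R ((\<lambda>x. \<kappa> \<otimes> x) ` ?V \<inter> (\<lambda>x. \<kappa>' \<otimes> x) ` ?V')" (is "invertible_ideal R ?K")
    using coprime_scaled_intersection[OF gcd scale_invertible_meets_units[OF U(4-6) U'(1)]
        scale_invertible_meets_units[OF U'(4-6) U(1)] \<kappa>(1) nz(1) \<kappa>(2) nz(2)] bez by blast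
  have UT: "u \<in> carrier T" if "u \<in> U" for u
    using U(4) that R_idealD(1)[of U] by (simp add: invertible_ideal_def)
  have U'T: "u \<in> carrier T" if "u \<in> U'" for u
    using U'(4) that R_idealD(1)[of U'] by (simp add: invertible_ideal_def)
  have IT: "i \<in> carrier T" if "i \<in> I" for i using R_idealD(1)[OF id(1) that] by simp
  have JT: "i \<in> carrier T" if "i \<in> J" for i using R_idealD(1)[OF id(2) that] by simp
  have n1: "n \<otimes> i = m \<otimes> (\<kappa> \<otimes> (r' \<otimes> u))" if "i \<in> I" "u \<in> U" "r \<otimes> i = g \<otimes> u" for i u
  proof -
    have "n \<otimes> i = s1 \<otimes> s2 \<otimes> s3 \<otimes> r' \<otimes> (r \<otimes> i)" unfolding n_def using sT IT[OF that(1)] by algebra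
    also have "\<dots> = m \<otimes> (\<kappa> \<otimes> (r' \<otimes> u))"
      unfolding that(3) h(6) m_def \<kappa>_def using sT h(1,2) UT[OF that(2)] by algebra
    finally show ?thesis .
  qed
  have n2: "n \<otimes> i = m \<otimes> (\<kappa>' \<otimes> (r \<otimes> u))" if "i \<in> J" "u \<in> U'" "r' \<otimes> i = g' \<otimes> u" for i u
  proof -
    have "n \<otimes> i = s1 \<otimes> s2 \<otimes> s3 \<otimes> r \<otimes> (r' \<otimes> i)" unfolding n_def using sT JT[OF that(1)] by algebra
    also have "\<dots> = m \<otimes> (\<kappa>' \<otimes> (r \<otimes> u))"
      unfolding that(3) h(7) m_def \<kappa>'_def using sT h(1,3) U'T[OF that(2)] by algebra
    finally show ?thesis .
  qed
  have "(\<lambda>x. n \<otimes> x) ` (I \<inter> J) = (\<lambda>x. m \<otimes> x) ` ?K"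
  proof (intro equalityI subsetI)
    fix w assume "w \<in> (\<lambda>x. n \<otimes> x) ` (I \<inter> J)"
    then obtain i where i: "i \<in> I" "i \<in> J" "w = n \<otimes> i" by blast
    obtain u where u: "u \<in> U" "r \<otimes> i = g \<otimes> u" using i(1) U(7) by blast
    obtain u' where u': "u' \<in> U'" "r' \<otimes> i = g' \<otimes> u'" using i(2) U'(7) by blast
    have e: "w = m \<otimes> (\<kappa> \<otimes> (r' \<otimes> u))" "w = m \<otimes> (\<kappa>' \<otimes> (r \<otimes> u'))"
      unfolding i(3) using n1[OF i(1) u] n2[OF i(2) u'] by auto
    then have "\<kappa> \<otimes> (r' \<otimes> u) = \<kappa>' \<otimes> (r \<otimes> u')"
      using m_lcancel[OF nz(3) \<kappa>T(3)] \<kappa>T sT UT[OF u(1)] U'T[OF u'(1)] by simp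
    then have "\<kappa> \<otimes> (r' \<otimes> u) \<in> ?K" using u(1) u'(1) by blast
    then show "w \<in> (\<lambda>x. m \<otimes> x) ` ?K" unfolding e(1) by blast
  next
    fix w assume "w \<in> (\<lambda>x. m \<otimes> x) ` ?K"
    then obtain u u' where u: "u \<in> U" "u' \<in> U'" "\<kappa> \<otimes> (r' \<otimes> u) = \<kappa>' \<otimes> (r \<otimes> u')" "w = m \<otimes> (\<kappa> \<otimes> (r' \<otimes> u))"
      by auto
    have "g \<otimes> u \<in> (\<lambda>x. r \<otimes> x) ` I" "g' \<otimes> u' \<in> (\<lambda>x. r' \<otimes> x) ` J" unfolding U(7) U'(7) using u(1,2) by blast+
    then obtain i j where i: "i \<in> I" "r \<otimes> i = g \<otimes> u" and j: "j \<in> J" "r' \<otimes> j = g' \<otimes> u'" by (metis imageE)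
    have "n \<otimes> i = w" "n \<otimes> j = w" using n1[OF i(1) u(1) i(2)] n2[OF j(1) u(2) j(2)] u(3,4) by auto
    then have "i = j"
      using m_lcancel[OF inner_unit_nonzero[OF nS] nT IT[OF i(1)] JT[OF j(1)]] by simp
    then show "w \<in> (\<lambda>x. n \<otimes> x) ` (I \<inter> J)" using i(1) j(1) \<open>n \<otimes> i = w\<close> by blast
  qed
  moreover have "invertible_ideal R ((\<lambda>x. m \<otimes> x) ` ?K)"
    using R.invertible_ideal_scale_iff[of ?K m] R_nonzero_divisor[OF \<kappa>(3) nz(3)] inv
    by (simp add: invertible_ideal_def)
  ultimately show "invertible_ideal R (I \<inter> J)"
    using R.invertible_ideal_scale_iff[OF R.i_intersect[OF id], of n]
      R_nonzero_divisor[OF inner_units_carrier[OF nS] inner_unit_nonzero[OF nS]] by simp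
qed

section \<open>Products of integral domains and their coordinates\<close>

locale domain_product = cring A for A :: "('c, 'n) ring_scheme" (structure) +
  fixes \<Lambda> :: "'i set" and F :: "'i \<Rightarrow> 'b ring" and f :: "'c \<Rightarrow> 'i \<Rightarrow> 'b"
  assumes domains: "\<And>l. l \<in> \<Lambda> \<Longrightarrow> domain (F l)" and iso: "f \<in> ring_iso A (product_ring \<Lambda> F)"
begin

lemma component_simps:
  assumes "l \<in> \<Lambda>"
  shows "x \<in> carrier A \<Longrightarrow> f x l \<in> carrier (F l)"
    and "x \<in> carrier A \<Longrightarrow> y \<in> carrier A \<Longrightarrow> f (x \<otimes> y) l = f x l \<otimes>\<^bsub>F l\<^esub> f y l"
    and "x \<in> carrier A \<Longrightarrow> y \<in> carrier A \<Longrightarrow> f (x \<oplus> y) l = f x l \<oplus>\<^bsub>F l\<^esub> f y l"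
    and "f \<one> l = \<one>\<^bsub>F l\<^esub>"
  using iso assms by (auto simp: ring_iso_def ring_hom_def product_ring_def)

lemma component_eqI:
  assumes "x \<in> carrier A" "y \<in> carrier A" "\<And>l. l \<in> \<Lambda> \<Longrightarrow> f x l = f y l"
  shows "x = y"
proof -
  have "inj_on f (carrier A)" "f x \<in> (\<Pi>\<^sub>E l\<in>\<Lambda>. carrier (F l))" "f y \<in> (\<Pi>\<^sub>E l\<in>\<Lambda>. carrier (F l))"
    using iso assms(1,2) by (auto simp: ring_iso_def ring_hom_def product_ring_def bij_betw_def)
  then show ?thesis using assms by (metis PiE_ext inj_onD)
qed

lemma component_exists:
  assumes "\<And>l. l \<in> \<Lambda> \<Longrightarrow> b l \<in> carrier (F l)"
  obtains x where "x \<in> carrier A" "\<And>l. l \<in> \<Lambda> \<Longrightarrow> f x l = b l"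
proof -
  have "restrict b \<Lambda> \<in> f ` carrier A"
    using iso assms by (auto simp: ring_iso_def product_ring_def bij_betw_def)
  then obtain x where "x \<in> carrier A" "f x = restrict b \<Lambda>" by auto
  then show thesis using that by (metis restrict_apply')
qed

lemma component_hom: assumes l: "l \<in> \<Lambda>" shows "surjective_ring_hom A (F l) (\<lambda>a. f a l)"
proof -
  interpret Fl: domain "F l" by (rule domains[OF l])
  show ?thesis
  proof
    show "(\<lambda>a. f a l) \<in> ring_hom A (F l)"
      by (rule ring_hom_memI) (simp_all add: component_simps[OF l])
    show "(\<lambda>a. f a l) ` carrier A = carrier (F l)"
    proof (intro equalityI subsetI)
      fix y assume y: "y \<in> carrier (F l)"
      have "(if j = l then y else \<zero>\<^bsub>F j\<^esub>) \<in> carrier (F j)" if "j \<in> \<Lambda>" for j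
      proof -
        interpret Fj: domain "F j" by (rule domains[OF that])
        show ?thesis using y by simp
      qed
      then obtain x where "x \<in> carrier A" "\<And>j. j \<in> \<Lambda> \<Longrightarrow> f x j = (if j = l then y else \<zero>\<^bsub>F j\<^esub>)"
        using component_exists[of "\<lambda>j. if j = l then y else \<zero>\<^bsub>F j\<^esub>"] by metis
      then show "y \<in> (\<lambda>a. f a l) ` carrier A" using l by force
    qed (use component_simps[OF l] in auto)
  qed
qed

lemma component_zero: assumes l: "l \<in> \<Lambda>" shows "f \<zero> l = \<zero>\<^bsub>F l\<^esub>"
proof -
  interpret h: surjective_ring_hom A "F l" "\<lambda>a. f a l" by (rule component_hom[OF l])
  show ?thesis by (rule h.H.hom_zero)
qed

text \<open>The idempotent is the indicator of the support of \<open>a\<close>; it exists because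
  the product is full, and in each coordinate the domain property decides whether \<open>a\<close>
  or \<open>x\<close> vanishes.\<close>

lemma rickart: "rickart_ring A"
  unfolding rickart_ring_def
proof (intro conjI ballI is_cring)
  fix a assume a: "a \<in> carrier A"
  have dom: "\<zero>\<^bsub>F l\<^esub> \<in> carrier (F l)" "\<one>\<^bsub>F l\<^esub> \<in> carrier (F l)" if "l \<in> \<Lambda>" for l
  proof -
    interpret Fl: domain "F l" by (rule domains[OF that])
    show "\<zero>\<^bsub>F l\<^esub> \<in> carrier (F l)" "\<one>\<^bsub>F l\<^esub> \<in> carrier (F l)" by simp_all
  qed
  obtain e where e: "e \<in> carrier A" "\<And>l. l \<in> \<Lambda> \<Longrightarrow> f e l = (if f a l = \<zero>\<^bsub>F l\<^esub> then \<zero>\<^bsub>F l\<^esub> else \<one>\<^bsub>F l\<^esub>)"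
    using component_exists[of "\<lambda>l. if f a l = \<zero>\<^bsub>F l\<^esub> then \<zero>\<^bsub>F l\<^esub> else \<one>\<^bsub>F l\<^esub>"] dom by metis
  show "\<exists>e\<in>carrier A. e \<otimes> e = e \<and> e \<otimes> a = a \<and> (\<forall>x\<in>carrier A. a \<otimes> x = \<zero> \<longrightarrow> e \<otimes> x = \<zero>)"
  proof (intro bexI[of _ e] conjI ballI impI e(1))
    show "e \<otimes> e = e"
    proof (rule component_eqI)
      fix l assume l: "l \<in> \<Lambda>"
      interpret Fl: domain "F l" by (rule domains[OF l])
      show "f (e \<otimes> e) l = f e l" using e(2)[OF l] e(1) l by (simp add: component_simps)
    qed (use e in auto)
    show "e \<otimes> a = a"
    proof (rule component_eqI)
      fix l assume l: "l \<in> \<Lambda>"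
      interpret Fl: domain "F l" by (rule domains[OF l])
      show "f (e \<otimes> a) l = f a l" using e(2)[OF l] e(1) l a by (simp add: component_simps)
    qed (use e a in auto)
    fix x assume x: "x \<in> carrier A" "a \<otimes> x = \<zero>"
    show "e \<otimes> x = \<zero>"
    proof (rule component_eqI)
      fix l assume l: "l \<in> \<Lambda>"
      interpret Fl: domain "F l" by (rule domains[OF l])
      have "f a l \<otimes>\<^bsub>F l\<^esub> f x l = \<zero>\<^bsub>F l\<^esub>"
        using component_simps(2)[OF l a x(1)] x(2) component_zero[OF l] by simp
      then have "f a l = \<zero>\<^bsub>F l\<^esub> \<or> f x l = \<zero>\<^bsub>F l\<^esub>" using Fl.integral component_simps(1)[OF l] a x(1) by blast
      then show "f (e \<otimes> x) l = f \<zero> l"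
        using e(2)[OF l] e(1) l x(1) by (auto simp: component_simps component_zero)
    qed (use e x in auto)
  qed
qed

text \<open>The element with coordinate \<open>1\<close> at \<open>l\<close> and \<open>0\<close>
  elsewhere is an idempotent that exhibits \<open>F l\<close> as a direct factor of
  \<open>A\<close>: its annihilator is the kernel of the coordinate.\<close>

lemma component_generalized_gcd:
  assumes gcd: "generalized_gcd_ring A" and l: "l \<in> \<Lambda>" shows "generalized_gcd_ring (F l)"
proof -
  interpret h: surjective_ring_hom A "F l" "\<lambda>a. f a l" by (rule component_hom[OF l])
  have dom: "\<zero>\<^bsub>F j\<^esub> \<in> carrier (F j)" "\<one>\<^bsub>F j\<^esub> \<in> carrier (F j)" if "j \<in> \<Lambda>" for j
  proof -
    interpret Fj: domain "F j" by (rule domains[OF that])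
    show "\<zero>\<^bsub>F j\<^esub> \<in> carrier (F j)" "\<one>\<^bsub>F j\<^esub> \<in> carrier (F j)" by simp_all
  qed
  obtain e where e: "e \<in> carrier A" "\<And>j. j \<in> \<Lambda> \<Longrightarrow> f e j = (if j = l then \<one>\<^bsub>F j\<^esub> else \<zero>\<^bsub>F j\<^esub>)"
    using component_exists[of "\<lambda>j. if j = l then \<one>\<^bsub>F j\<^esub> else \<zero>\<^bsub>F j\<^esub>"] dom by metis
  have comp: "f (e \<otimes> x) j = (if j = l then f x j else \<zero>\<^bsub>F j\<^esub>)" if j: "j \<in> \<Lambda>" and x: "x \<in> carrier A" for j x
  proof -
    interpret Fj: domain "F j" by (rule domains[OF j])
    show ?thesis using e(2)[OF j] component_simps[OF j] x e(1) by simp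
  qed
  have "e \<otimes> e = e" by (rule component_eqI) (use e comp in auto)
  moreover have "f x l = \<zero>\<^bsub>F l\<^esub> \<longleftrightarrow> e \<otimes> x = \<zero>" if x: "x \<in> carrier A" for x
  proof
    assume "f x l = \<zero>\<^bsub>F l\<^esub>"
    then show "e \<otimes> x = \<zero>"
      by (intro component_eqI) (use e x in \<open>auto simp: comp component_zero\<close>)
  next
    assume "e \<otimes> x = \<zero>"
    then show "f x l = \<zero>\<^bsub>F l\<^esub>" using comp[OF l x] component_zero[OF l] by simp
  qed
  ultimately show ?thesis
    using h.factor_generalized_gcd[OF e(1) _ _ rickart gcd domain.rickart[OF domains[OF l]]] by blast
qed

end

theorem theorem5p11:
  fixes R T :: "'a ring" and C :: "'a set" and A B :: "'a set ring"
    and \<Lambda> :: "'i set" and A\<^sub>\<Lambda> :: "'i \<Rightarrow> 'b ring"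
  assumes square: "regular_conductor_square R T C A B"
    and flat: "flat_module R (ring_module T (carrier T))"
    and principal: "principalideal C T"
    and two_gen: "\<And>I. two_generated_ideal R I \<Longrightarrow> I \<noteq> {\<zero>\<^bsub>R\<^esub>} \<Longrightarrow>
      (\<exists>r\<in>carrier R. \<exists>s\<in>carrier R. \<exists>U. ideal U R \<and>
         U \<cdot>\<^bsub>T\<^esub> carrier T = carrier T \<and> PIdl\<^bsub>T\<^esub> r = carrier T \<and>
         r <#\<^bsub>R\<^esub> I = s <#\<^bsub>R\<^esub> U \<and>
         (\<lambda>x. r \<otimes>\<^bsub>R\<^esub> x) \<in> module_iso R (ring_module R I) (ring_module R (r <#\<^bsub>R\<^esub> I)) \<and>
         (\<lambda>x. s \<otimes>\<^bsub>R\<^esub> x) \<in> module_iso R (ring_module R U) (ring_module R (s <#\<^bsub>R\<^esub> U)))"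
    and domains: "\<And>l. l \<in> \<Lambda> \<Longrightarrow> domain (A\<^sub>\<Lambda> l)"
    and product: "A \<simeq> product_ring \<Lambda> A\<^sub>\<Lambda>"
  shows "(generalized_gcd_ring R \<longrightarrow>
            generalized_gcd_ring T \<and> generalized_gcd_ring A \<and>
            (\<forall>l\<in>\<Lambda>. generalized_gcd_ring (A\<^sub>\<Lambda> l)))
       \<and> (generalized_gcd_ring A \<longrightarrow>
            generalized_gcd_ring T \<and> generalized_gcd_ring R \<and>
            (\<forall>l\<in>\<Lambda>. generalized_gcd_ring (A\<^sub>\<Lambda> l)))"
proof -
  have sq: "cring T" "subcring (carrier R) T" "R = T\<lparr>carrier := carrier R\<rparr>"
    "\<exists>I. common_ideal R T I \<and> I \<noteq> {\<zero>\<^bsub>T\<^esub>}" "ideal C R" "ideal C T" "A = R Quot C"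
    using square unfolding regular_conductor_square_def conductor_square_def common_ideal_def by blast+
  obtain c where c: "c \<in> C" "non_zero_divisor T c"
    using square unfolding regular_conductor_square_def by blast
  interpret T: cring T by (rule sq(1))
  have cring_R: "cring R"
    using T.subcring_iff[OF subcringE(1)[OF sq(2)]] sq(2) sq(3)[symmetric] by simp
  have ops: "x \<oplus>\<^bsub>R\<^esub> y = x \<oplus>\<^bsub>T\<^esub> y" "x \<otimes>\<^bsub>R\<^esub> y = x \<otimes>\<^bsub>T\<^esub> y" "\<zero>\<^bsub>R\<^esub> = \<zero>\<^bsub>T\<^esub>" "\<one>\<^bsub>R\<^esub> = \<one>\<^bsub>T\<^esub>" for x y
    by (subst sq(3), simp)+
  \<comment> \<open>Regularity of \<open>c\<close> does not exclude the zero ring, where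
    \<open>0\<close> counts as regular; the non-zero common ideal does.\<close>
  have nontrivial: "\<one>\<^bsub>T\<^esub> \<noteq> \<zero>\<^bsub>T\<^esub>"
  proof
    assume "\<one>\<^bsub>T\<^esub> = \<zero>\<^bsub>T\<^esub>"
    then have triv: "carrier T = {\<zero>\<^bsub>T\<^esub>}" by (rule T.one_zeroD)
    obtain I where I: "ideal I T" "I \<noteq> {\<zero>\<^bsub>T\<^esub>}" using sq(4) unfolding common_ideal_def by blast
    then interpret I: ideal I T by simp
    show False using I(2) I.a_subset I.closed_simps(1) triv by blast
  qed
  interpret overring T R
    by (intro overring.intro overring_axioms.intro) (use sq(1,2) cring_R ops in auto)
  interpret conductor_two_generated T R C c
    by (intro conductor_two_generated.intro conductor_two_generated_axioms.intro overring_axioms)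
      (use sq(5,6) nontrivial c principal two_gen in auto)
  have A: "cring A" unfolding sq(7) by (rule ideal.quotient_is_cring[OF sq(5) cring_R])
  obtain f where f: "f \<in> ring_iso A (product_ring \<Lambda> A\<^sub>\<Lambda>)"
    using product unfolding is_ring_iso_def by blast
  interpret P: domain_product A \<Lambda> A\<^sub>\<Lambda> f
    by (intro domain_product.intro domain_product_axioms.intro A) (use domains f in auto)
  interpret conductor_quotient T R C c A "(+>\<^bsub>R\<^esub>) C"
  proof (intro conductor_quotient.intro conductor_quotient_axioms.intro conductor_two_generated_axioms P.rickart)
    show "surjective_ring_hom R A ((+>\<^bsub>R\<^esub>) C)"
    proof (intro surjective_ring_hom.intro surjective_ring_hom_axioms.intro A cring_R)
      show "(+>\<^bsub>R\<^esub>) C \<in> ring_hom R A" unfolding sq(7) by (rule ideal.rcos_ring_hom[OF sq(5)])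
      show "(+>\<^bsub>R\<^esub>) C ` carrier R = carrier A" unfolding sq(7) FactRing_def A_RCOSETS_def' by auto
    qed
    show "C +>\<^bsub>R\<^esub> x = \<zero>\<^bsub>A\<^esub> \<longleftrightarrow> x \<in> C" if "x \<in> carrier R" for x
      using ideal.rcos_const_imp_mem[OF sq(5) that] R.a_rcos_zero[OF sq(5), of x] unfolding sq(7) FactRing_def by auto
  qed
  show ?thesis
    using generalized_gcd_T generalized_gcd_A_if_R generalized_gcd_R_if_A P.component_generalized_gcd by blast
qed

end
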